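(* Suppose the Markov decision model $(X,A,\{A(x):x\in X\},Q,C)$ with discount factor $\alpha\in(0,1)$ satisfies the growth conditions (G) and the compactness-continuity conditions (K) stated in the context. Let $f_0\in\mathbb{F}$ be an arbitrary stationary policy and let $\{v_n\}$ be the policy iteration functions generated by the policy iteration algorithm started at $f_0$; that is, for every $n\in\mathbb{N}_0$, $v_n:=V_{f_n}$, and $f_{n+1}\in\mathbb{F}$ is a selector with $Tv_n^e=T_{f_{n+1}}v_n^e$. Then $\{v_n\}$ converges linearly to $V_\ast$ in the $W$-norm. In fact, $$\|v_{n+1}-V_\ast\|_W\le\gamma\|v_n-V_\ast\|_W\le L\gamma^n\quad\text{for all }n\in\mathbb{N},$$ with $L:=\|v_0-V_\ast\|_W$. Thus, $$\limsup_{n\to\infty}\frac{\|v_{n+1}-V_\ast\|_W}{\|v_n-V_\ast\|_W}\le\gamma.$$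
   Context: Model. $X$ (states) and $A$ (actions) are Borel spaces, i.e. Borel subsets of complete separable metric spaces. For each $x\in X$, $A(x)\subset A$ is the set of admissible actions; $\mathbb{K}:=\{(x,a):x\in X,a\in A(x)\}$ is a Borel subset of $X\times A$. $Q$ is a stochastic kernel on $X$ given $\mathbb{K}$: $Q(\cdot|x,a)$ is a probability measure on $X$ for each $(x,a)\in\mathbb{K}$, and $Q(B|\cdot,\cdot)$ is Borel measurable on $\mathbb{K}$ for each Borel $B\subset X$. The one-step cost $C:\mathbb{K}\to\mathbb{R}$ is Borel measurable. $\alpha\in(0,1)$ is a fixed discount factor. $\mathbb{N}=\{1,2,\ldots\}$ and $\mathbb{N}_0=\{0,1,2,\ldots\}$. Policies. $H_0:=X$ and $H_n$ is the set of histories $h_n=(x_0,a_0,\ldots,x_{n-1},a_{n-1},x_n)$ with $(x_k,a_k)\in\mathbb{K}$ for $k<n$ and $x_n\in X$. A policy is a sequence $\pi=\{\pi_n\}_{n\ge 0}$ of stochastic kernels $\pi_n$ on $A$ given $H_n$ with $\pi_n(A(x_n)|h_n)=1$ for all $h_n\in H_n$; $\Pi$ is the class of all policies. $\mathbb{F}$ is the class of measurable functions $f:X\to A$ with $f(x)\in A(x)$ for all $x\in X$; $f\in\mathbb{F}$ is identified with the stationary policy for which $\pi_n(\cdot|h_n)$ is concentrated at $f(x_n)$. For $\pi\in\Pi$ and $x\in X$, $P_x^\pi$ is the unique probability measure on $(X\times A)^\infty$ (product $\sigma$-algebra) with $P_x^\pi[x_0=x]=1$, $P_x^\pi[a_n\in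 D|h_n]=\pi_n(D|h_n)$, $P_x^\pi[x_{n+1}\in B|h_n,a_n]=Q(B|x_n,a_n)$; $E_x^\pi$ is its expectation. The discounted cost is $V_\pi(x):=E_x^\pi\sum_{k=0}^\infty\alpha^kC(x_k,a_k)$, and the optimal value function is $V_\ast(x):=\inf_{\pi\in\Pi}V_\pi(x)$. Growth conditions (G). There exist constants $M>0$, $\beta>1$ and a function $W:X\to[1,\infty)$ such that: $|C(x,a)|\le MW(x)$ for all $(x,a)\in\mathbb{K}$; $QW(x,a):=\int_XW(y)Q(dy|x,a)\le\beta W(x)$ for all $(x,a)\in\mathbb{K}$; and $\gamma:=\beta\alpha<1$. Compactness-continuity conditions (K). The multifunction $x\mapsto A(x)$ is upper semicontinuous and compact-valued; $C$ is lower semicontinuous on $\mathbb{K}$; $Q$ is weakly continuous on $\mathbb{K}$, i.e. $(x,a)\mapsto\int_Xu(y)Q(dy|x,a)$ is continuous on $\mathbb{K}$ for each bounded continuous $u:X\to\mathbb{R}$; and the functions $W$ and $QW$ (with $W$ the function in (G)) are continuous. Operators. $\|u\|_W:=\sup_{x\in X}|u(x)|/W(x)$ is the $W$-norm, and $B_W(X)$ is the class of measurable $u:X\to\mathbb{R}$ with $\|u\|_W<\infty$. For $u\in B_W(X)$, $Qu(x,a):=\int_Xu(y)Q(dy|x,a)$, and for $f\in\mathbb{F}$, $T_fu(x):=C(x,f(x))+\alpha Qu(x,f(x))$; also $Tu(x):=\inf_{a\in A(x)}[C(x,a)+\alpha Qu(x,a)]$, $x\in X$. Lower semicontinuous envelope.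 For $u:X\to\mathbb{R}$, $u^e(x):=\sup_{r>0}\inf_{y\in B_r(x)}u(y)$, where $B_r(x)$ is the open ball in $X$ of radius $r$ centered at $x$. Convention: the ratio in the limsup is read as $0$ when both its numerator and denominator are $0$. *)

theory Defs
  imports "HOL-Probability.Probability"
begin

section \<open>Markov decision models\<close>

text \<open>
  Borel spaces are Borel subsets of Polish types, with the induced metric, topology and
  Borel sets. Only the values of \<open>adm\<close> on the states, and of \<open>trans\<close> and \<open>cost\<close> on the
  admissible pairs, are meaningful.
\<close>

record ('x, 'a) mdp =
  states :: "'x set"
  actions :: "'a set"
  adm :: "'x \<Rightarrow> 'a set"
  trans :: "'x \<times> 'a \<Rightarrow> 'x measure"
  cost :: "'x \<times> 'a \<Rightarrow> real"

definition adm_pairs :: "('x, 'a) mdp \<Rightarrow> ('x \<times> 'a) set" where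
  "adm_pairs \<M> = {(x, a). x \<in> states \<M> \<and> a \<in> adm \<M> x}"

definition state_algebra :: "('x::polish_space, 'a) mdp \<Rightarrow> 'x measure" where
  "state_algebra \<M> = restrict_space borel (states \<M>)"

definition action_algebra :: "('x, 'a::polish_space) mdp \<Rightarrow> 'a measure" where
  "action_algebra \<M> = restrict_space borel (actions \<M>)"

definition markov_decision_model :: "('x::polish_space, 'a::polish_space) mdp \<Rightarrow> bool" where
  "markov_decision_model \<M> \<longleftrightarrow>
     states \<M> \<in> sets borel \<and>
     actions \<M> \<in> sets borel \<and>
     (\<forall>x\<in>states \<M>. adm \<M> x \<subseteq> actions \<M>) \<and>
     adm_pairs \<M> \<in> sets (state_algebra \<M> \<Otimes>\<^sub>M action_algebra \<M>) \<and>
     trans \<M> \<in> restrict_space borel (adm_pairs \<M>) \<rightarrow>\<^sub>M prob_algebra (state_algebra \<M>) \<and>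
     cost \<M> \<in> borel_measurable (restrict_space borel (adm_pairs \<M>))"

section \<open>Policies and the induced measures\<close>

text \<open>
  A trajectory is a sequence of pairs \<open>(x\<^sub>k, a\<^sub>k)\<close>. The history
  \<open>(x\<^sub>0, a\<^sub>0, \<dots>, x\<^sub>n\<^sub>-\<^sub>1, a\<^sub>n\<^sub>-\<^sub>1, x\<^sub>n)\<close> is encoded as a pair: the family of the first
  \<open>n\<close> state-action pairs, indexed by \<open>{0..<n}\<close>, and the current state.
\<close>

type_synonym ('x, 'a) history = "(nat \<Rightarrow> 'x \<times> 'a) \<times> 'x"

definition history_algebra ::
    "('x::polish_space, 'a::polish_space) mdp \<Rightarrow> nat \<Rightarrow> ('x, 'a) history measure" where
  "history_algebra \<M> n =
     (\<Pi>\<^sub>M k\<in>{0..<n}. state_algebra \<M> \<Otimes>\<^sub>M action_algebra \<M>) \<Otimes>\<^sub>M state_algebra \<M>"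

definition histories :: "('x, 'a) mdp \<Rightarrow> nat \<Rightarrow> ('x, 'a) history set" where
  "histories \<M> n = (\<Pi>\<^sub>E k\<in>{0..<n}. adm_pairs \<M>) \<times> states \<M>"

definition policies ::
    "('x::polish_space, 'a::polish_space) mdp \<Rightarrow> (nat \<Rightarrow> ('x, 'a) history \<Rightarrow> 'a measure) set" where
  "policies \<M> = {\<pi>. \<forall>n.
     \<pi> n \<in> restrict_space (history_algebra \<M> n) (histories \<M> n) \<rightarrow>\<^sub>M prob_algebra (action_algebra \<M>) \<and>
     (\<forall>h\<in>histories \<M> n. measure (\<pi> n h) (adm \<M> (snd h)) = 1)}"

definition selectors :: "('x::polish_space, 'a::polish_space) mdp \<Rightarrow> ('x \<Rightarrow> 'a) set" where
  "selectors \<M> =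
     {f \<in> state_algebra \<M> \<rightarrow>\<^sub>M action_algebra \<M>. \<forall>x\<in>states \<M>. f x \<in> adm \<M> x}"

definition stationary ::
    "('x, 'a::polish_space) mdp \<Rightarrow> ('x \<Rightarrow> 'a) \<Rightarrow> nat \<Rightarrow> ('x, 'a) history \<Rightarrow> 'a measure" where
  "stationary \<M> f = (\<lambda>n h. return (action_algebra \<M>) (f (snd h)))"

definition trajectory_algebra ::
    "('x::polish_space, 'a::polish_space) mdp \<Rightarrow> (nat \<Rightarrow> 'x \<times> 'a) measure" where
  "trajectory_algebra \<M> = (\<Pi>\<^sub>M k\<in>UNIV. state_algebra \<M> \<Otimes>\<^sub>M action_algebra \<M>)"

definition history :: "nat \<Rightarrow> (nat \<Rightarrow> 'x \<times> 'a) \<Rightarrow> ('x, 'a) history" where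
  "history n \<omega> = (restrict \<omega> {0..<n}, fst (\<omega> n))"

text \<open>
  The conditional probabilities given \<open>h\<^sub>n\<close> and \<open>(h\<^sub>n, a\<^sub>n)\<close> are conditional expectations of
  indicators with respect to the \<open>\<sigma>\<close>-algebras generated by these random elements.
\<close>

definition is_strategic_measure ::
    "('x::polish_space, 'a::polish_space) mdp \<Rightarrow> (nat \<Rightarrow> ('x, 'a) history \<Rightarrow> 'a measure) \<Rightarrow> 'x
      \<Rightarrow> (nat \<Rightarrow> 'x \<times> 'a) measure \<Rightarrow> bool" where
  "is_strategic_measure \<M> \<pi> x P \<longleftrightarrow>
     prob_space P \<and> sets P = sets (trajectory_algebra \<M>) \<and>
     measure P {\<omega> \<in> space P. fst (\<omega> 0) = x} = 1 \<and>
     (\<forall>n. \<forall>D \<in> sets (action_algebra \<M>). AE \<omega> in P.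
        real_cond_exp P (vimage_algebra (space P) (history n) (history_algebra \<M> n))
          (indicator {\<omega> \<in> space P. snd (\<omega> n) \<in> D}) \<omega>
        = measure (\<pi> n (history n \<omega>)) D) \<and>
     (\<forall>n. \<forall>B \<in> sets (state_algebra \<M>). AE \<omega> in P.
        real_cond_exp P
          (vimage_algebra (space P) (\<lambda>\<omega>. (history n \<omega>, snd (\<omega> n)))
            (history_algebra \<M> n \<Otimes>\<^sub>M action_algebra \<M>))
          (indicator {\<omega> \<in> space P. fst (\<omega> (Suc n)) \<in> B}) \<omega>
        = measure (trans \<M> (\<omega> n)) B)"

definition strategic_measure ::
    "('x::polish_space, 'a::polish_space) mdp \<Rightarrow> (nat \<Rightarrow> ('x, 'a) history \<Rightarrow> 'a measure) \<Rightarrow> 'x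
      \<Rightarrow> (nat \<Rightarrow> 'x \<times> 'a) measure" where
  "strategic_measure \<M> \<pi> x = (THE P. is_strategic_measure \<M> \<pi> x P)"

text \<open>
  The cost is only defined, and only measurable, on the admissible pairs. They carry all the
  mass, but a cost with arbitrary values elsewhere could fail to be integrable for
  lack of measurability, so it is replaced by \<open>0\<close> there.
\<close>

definition policy_value ::
    "('x::polish_space, 'a::polish_space) mdp \<Rightarrow> real \<Rightarrow> (nat \<Rightarrow> ('x, 'a) history \<Rightarrow> 'a measure)
      \<Rightarrow> 'x \<Rightarrow> real" where
  "policy_value \<M> \<alpha> \<pi> x =
     (\<integral>\<omega>. (\<Sum>k. \<alpha> ^ k * (if \<omega> k \<in> adm_pairs \<M> then cost \<M> (\<omega> k) else 0))
        \<partial>strategic_measure \<M> \<pi> x)"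

definition optimal_value ::
    "('x::polish_space, 'a::polish_space) mdp \<Rightarrow> real \<Rightarrow> 'x \<Rightarrow> real" where
  "optimal_value \<M> \<alpha> x = (INF \<pi>\<in>policies \<M>. policy_value \<M> \<alpha> \<pi> x)"

section \<open>Operators, weighted norm and lower semicontinuous envelope\<close>

definition trans_op :: "('x, 'a) mdp \<Rightarrow> ('x \<Rightarrow> real) \<Rightarrow> 'x \<times> 'a \<Rightarrow> real" where
  "trans_op \<M> u k = (\<integral>y. u y \<partial>trans \<M> k)"

definition policy_op ::
    "('x, 'a) mdp \<Rightarrow> real \<Rightarrow> ('x \<Rightarrow> 'a) \<Rightarrow> ('x \<Rightarrow> real) \<Rightarrow> 'x \<Rightarrow> real" where
  "policy_op \<M> \<alpha> f u x = cost \<M> (x, f x) + \<alpha> * trans_op \<M> u (x, f x)"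

definition bellman_op :: "('x, 'a) mdp \<Rightarrow> real \<Rightarrow> ('x \<Rightarrow> real) \<Rightarrow> 'x \<Rightarrow> real" where
  "bellman_op \<M> \<alpha> u x = (INF a\<in>adm \<M> x. cost \<M> (x, a) + \<alpha> * trans_op \<M> u (x, a))"

definition weighted_norm :: "('x, 'a) mdp \<Rightarrow> ('x \<Rightarrow> real) \<Rightarrow> ('x \<Rightarrow> real) \<Rightarrow> ennreal" where
  "weighted_norm \<M> W u = (SUP x\<in>states \<M>. ennreal (\<bar>u x\<bar> / W x))"

text \<open>
  The infimum over a large ball may be \<open>-\<infinity>\<close>, so the envelope is computed in the extended
  reals; the resulting supremum is finite wherever \<open>u\<close> is locally bounded below.
\<close>

definition lsc_envelope ::
    "('x::metric_space, 'a) mdp \<Rightarrow> ('x \<Rightarrow> real) \<Rightarrow> 'x \<Rightarrow> real" where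
  "lsc_envelope \<M> u x =
     real_of_ereal (SUP r\<in>{0<..}. INF y\<in>ball x r \<inter> states \<M>. ereal (u y))"

section \<open>Growth and compactness-continuity conditions\<close>

text \<open>Integrability is required explicitly because the Bochner integral of a non-integrable function is 0.\<close>

definition growth_conditions ::
    "('x, 'a) mdp \<Rightarrow> real \<Rightarrow> real \<Rightarrow> real \<Rightarrow> ('x \<Rightarrow> real) \<Rightarrow> bool" where
  "growth_conditions \<M> \<alpha> M \<beta> W \<longleftrightarrow>
     M > 0 \<and> \<beta> > 1 \<and> (\<forall>x\<in>states \<M>. W x \<ge> 1) \<and>
     (\<forall>(x, a)\<in>adm_pairs \<M>. \<bar>cost \<M> (x, a)\<bar> \<le> M * W x) \<and>
     (\<forall>(x, a)\<in>adm_pairs \<M>. integrable (trans \<M> (x, a)) W \<and> trans_op \<M> W (x, a) \<le> \<beta> * W x) \<and>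
     \<beta> * \<alpha> < 1"

definition upper_semicontinuous_multifunction ::
    "'x::topological_space set \<Rightarrow> 'a::topological_space set \<Rightarrow> ('x \<Rightarrow> 'a set) \<Rightarrow> bool" where
  "upper_semicontinuous_multifunction X A F \<longleftrightarrow>
     (\<forall>U. openin (top_of_set A) U \<longrightarrow> openin (top_of_set X) {x \<in> X. F x \<subseteq> U})"

definition lower_semicontinuous_on :: "'b::topological_space set \<Rightarrow> ('b \<Rightarrow> real) \<Rightarrow> bool" where
  "lower_semicontinuous_on S g \<longleftrightarrow> (\<forall>c. openin (top_of_set S) {z \<in> S. c < g z})"

definition compactness_continuity_conditions ::
    "('x::polish_space, 'a::polish_space) mdp \<Rightarrow> ('x \<Rightarrow> real) \<Rightarrow> bool" where
  "compactness_continuity_conditions \<M> W \<longleftrightarrow>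
     upper_semicontinuous_multifunction (states \<M>) (actions \<M>) (adm \<M>) \<and>
     (\<forall>x\<in>states \<M>. compact (adm \<M> x)) \<and>
     lower_semicontinuous_on (adm_pairs \<M>) (cost \<M>) \<and>
     (\<forall>u. continuous_on (states \<M>) u \<and> bounded (u ` states \<M>) \<longrightarrow>
        continuous_on (adm_pairs \<M>) (trans_op \<M> u)) \<and>
     continuous_on (states \<M>) W \<and>
     continuous_on (adm_pairs \<M>) (trans_op \<M> W)"

end

theory Submission
  imports Defs
begin

text \<open>
  For every policy the increments of \<open>\<alpha>\<^sup>k u(x\<^sub>k)\<close> along the trajectory telescope, so
  \<open>V\<^sub>\<pi>(x) - u(x)\<close> is the discounted expected sum of \<open>C + \<alpha>Qu - u\<close>. Hence subsolutions of the
  optimality equation lie below every \<open>V\<^sub>\<pi>\<close>, and \<open>V\<^sub>f\<close> is a fixed point of \<open>T\<^sub>f\<close>.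

  By Knaster--Tarski, \<open>T\<close> has a lower semicontinuous fixed point \<open>w\<close>, and \<open>w\<close> lies below every
  \<open>v\<^sub>n\<close>, hence below \<open>v\<^sub>n\<^sup>e\<close>. As \<open>T v\<^sub>n\<^sup>e\<close> is lower semicontinuous and below \<open>T\<^sub>f v\<^sub>n = v\<^sub>n\<close> for
  \<open>f = f\<^sub>n\<close>, it is below \<open>v\<^sub>n\<^sup>e\<close>; so \<open>v\<^sub>n\<^sup>e\<close> is a supersolution for \<open>f\<^sub>n\<^sub>+\<^sub>1\<close> and
  \<open>w \<le> v\<^sub>n\<^sub>+\<^sub>1 \<le> T v\<^sub>n\<^sup>e\<close>. The contraction property of \<open>T\<close> then gives the rate \<open>\<gamma>\<close> towards \<open>w\<close>.
  In particular the policies \<open>f\<^sub>n\<close> themselves show \<open>w = V\<^sub>*\<close>, and no measurable selection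
  theorem is needed.
\<close>

section \<open>Conditional distributions\<close>

text \<open>Two obstacles shape the proof. The trajectory measure is a definite description in terms
  of conditional expectations, so \<open>policy_value\<close> is opaque until existence and
  uniqueness are settled; conditional expectations are therefore traded for integral identities, in
  which both become computations with kernels. And \<open>v n\<close> is merely measurable, whereas
  weak continuity makes \<open>bellman_op\<close> well behaved on lower semicontinuous functions.
  The envelope is the greatest lower semicontinuous minorant, so every lower semicontinuous bound
  below \<open>v n\<close> passes to it.

  Lower semicontinuity also carries the Knaster--Tarski argument: an uncountable supremum of
  measurable functions can fail to be measurable, one of lower semicontinuous functions is again
  lower semicontinuous. For a fixed selector, which is only measurable, a monotone iteration takes
  its place. The fixed points live in the ball
  \<open>\<bar>u x\<bar> \<le> M / (1 - \<gamma>) * W x\<close>, which the operators preserve. As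
  \<open>w\<close> is below every \<open>v n\<close>, errors are one-sided and the contraction is
  tracked from above only.\<close>

definition disintegrates ::
    "'w measure \<Rightarrow> ('w \<Rightarrow> 'y) \<Rightarrow> 'y measure \<Rightarrow> ('w \<Rightarrow> 'z) \<Rightarrow> 'z measure \<Rightarrow> ('y \<Rightarrow> 'z measure) \<Rightarrow> bool" where
  "disintegrates P Y N Z R \<kappa> \<longleftrightarrow>
     (\<forall>g\<in>borel_measurable (N \<Otimes>\<^sub>M R).
        (\<integral>\<^sup>+\<omega>. g (Y \<omega>, Z \<omega>) \<partial>P) = (\<integral>\<^sup>+\<omega>. \<integral>\<^sup>+z. g (Y \<omega>, z) \<partial>\<kappa> (Y \<omega>) \<partial>P))"

text \<open>\<open>disintegrates\<close> says that \<open>\<kappa>\<close> is a regular conditional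
  distribution of \<open>Z\<close> given \<open>Y\<close>; nonnegative test functions spare all
  integrability conditions. Rectangles suffice because they form an intersection-stable generator,
  on which two finite measures are compared.\<close>

lemma disintegrates_rectangle:
  assumes P: "prob_space P"
    and Y[measurable]: "Y \<in> P \<rightarrow>\<^sub>M N" and Z[measurable]: "Z \<in> P \<rightarrow>\<^sub>M R"
    and \<kappa>[measurable]: "\<kappa> \<in> N \<rightarrow>\<^sub>M prob_algebra R"
    and rect: "\<And>A D. A \<in> sets N \<Longrightarrow> D \<in> sets R \<Longrightarrow>
      (\<integral>\<^sup>+\<omega>. indicator A (Y \<omega>) * indicator D (Z \<omega>) \<partial>P)
        = (\<integral>\<^sup>+\<omega>. indicator A (Y \<omega>) * emeasure (\<kappa> (Y \<omega>)) D \<partial>P)"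
  shows "disintegrates P Y N Z R \<kappa>"
proof -
  interpret prob_space P by fact
  have \<kappa>'[measurable]: "\<kappa> \<in> N \<rightarrow>\<^sub>M subprob_algebra R" by (rule measurable_prob_algebraD) fact
  have ne: "space P \<noteq> {}" by (rule not_empty)
  \<comment> \<open>\<open>?B \<omega>\<close> is the law of \<open>(Y \<omega>, z)\<close> with
    \<open>z\<close> drawn from \<open>\<kappa> (Y \<omega>)\<close>, so \<open>P \<bind> ?B\<close>
    is the joint law that the disintegration predicts for \<open>Y\<close> and
    \<open>Z\<close>.\<close>
  let ?B = "\<lambda>\<omega>. distr (\<kappa> (Y \<omega>)) (N \<Otimes>\<^sub>M R) (Pair (Y \<omega>))"
  have B[measurable]: "?B \<in> P \<rightarrow>\<^sub>M subprob_algebra (N \<Otimes>\<^sub>M R)"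
    by (rule measurable_distr2[where M=R]) measurable
  have sk: "sets (\<kappa> (Y \<omega>)) = sets R" "space (\<kappa> (Y \<omega>)) = space R" if "\<omega> \<in> space P" for \<omega>
    using subprob_measurableD[OF \<kappa>'] measurable_space[OF Y that] by auto
  have "distr P (N \<Otimes>\<^sub>M R) (\<lambda>\<omega>. (Y \<omega>, Z \<omega>)) = P \<bind> ?B"
  proof (rule measure_eqI_generator_eq[OF Int_stable_pair_measure_generator[of N R],
        where \<Omega>="space N \<times> space R" and A="\<lambda>_. space N \<times> space R"])
    show "{a \<times> b |a b. a \<in> sets N \<and> b \<in> sets R} \<subseteq> Pow (space N \<times> space R)"
      by (rule pair_measure_closed)
    show "sets (distr P (N \<Otimes>\<^sub>M R) (\<lambda>\<omega>. (Y \<omega>, Z \<omega>))) = sigma_sets (space N \<times> space R) {a \<times> b |a b. a \<in> sets N \<and> b \<in> sets R}"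
      by (simp add: sets_pair_measure)
    show "sets (P \<bind> ?B) = sigma_sets (space N \<times> space R) {a \<times> b |a b. a \<in> sets N \<and> b \<in> sets R}"
      by (simp add: sets_bind_measurable[OF B ne] sets_pair_measure)
    fix X assume "X \<in> {a \<times> b |a b. a \<in> sets N \<and> b \<in> sets R}"
    then obtain A D where X: "X = A \<times> D" and [measurable]: "A \<in> sets N" "D \<in> sets R" by auto
    have "emeasure (distr P (N \<Otimes>\<^sub>M R) (\<lambda>\<omega>. (Y \<omega>, Z \<omega>))) X
        = (\<integral>\<^sup>+w. indicator X w \<partial>distr P (N \<Otimes>\<^sub>M R) (\<lambda>\<omega>. (Y \<omega>, Z \<omega>)))"
      unfolding X by simp
    also have "\<dots> = (\<integral>\<^sup>+\<omega>. indicator X (Y \<omega>, Z \<omega>) \<partial>P)"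
      unfolding X by (subst nn_integral_distr) auto
    also have "\<dots> = (\<integral>\<^sup>+\<omega>. indicator A (Y \<omega>) * indicator D (Z \<omega>) \<partial>P)"
      unfolding X by (intro nn_integral_cong) (auto split: split_indicator)
    also have "\<dots> = (\<integral>\<^sup>+\<omega>. indicator A (Y \<omega>) * emeasure (\<kappa> (Y \<omega>)) D \<partial>P)"
      by (rule rect) fact+
    also have "\<dots> = (\<integral>\<^sup>+\<omega>. emeasure (?B \<omega>) X \<partial>P)"
    proof (intro nn_integral_cong)
      fix \<omega> assume \<omega>: "\<omega> \<in> space P"
      have "Pair (Y \<omega>) \<in> \<kappa> (Y \<omega>) \<rightarrow>\<^sub>M N \<Otimes>\<^sub>M R"
        using sk[OF \<omega>] measurable_space[OF Y \<omega>] by (simp cong: measurable_cong_sets)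
      moreover have "Pair (Y \<omega>) -` X \<inter> space (\<kappa> (Y \<omega>)) = (if Y \<omega> \<in> A then D else {})"
        using sets.sets_into_space[OF \<open>D \<in> sets R\<close>] sk[OF \<omega>] by (auto simp: X)
      ultimately show "indicator A (Y \<omega>) * emeasure (\<kappa> (Y \<omega>)) D = emeasure (?B \<omega>) X"
        by (subst emeasure_distr) (auto simp: X)
    qed
    also have "\<dots> = emeasure (P \<bind> ?B) X"
      unfolding X by (subst emeasure_bind[OF ne B]) auto
    finally show "emeasure (distr P (N \<Otimes>\<^sub>M R) (\<lambda>\<omega>. (Y \<omega>, Z \<omega>))) X = emeasure (P \<bind> ?B) X" .
  next
    fix i :: nat
    interpret D: prob_space "distr P (N \<Otimes>\<^sub>M R) (\<lambda>\<omega>. (Y \<omega>, Z \<omega>))"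
      by (rule prob_space_distr) measurable
    show "emeasure (distr P (N \<Otimes>\<^sub>M R) (\<lambda>\<omega>. (Y \<omega>, Z \<omega>))) (space N \<times> space R) \<noteq> \<infinity>"
      by simp
  qed auto
  then have eq: "(\<integral>\<^sup>+w. g w \<partial>distr P (N \<Otimes>\<^sub>M R) (\<lambda>\<omega>. (Y \<omega>, Z \<omega>))) = (\<integral>\<^sup>+w. g w \<partial>(P \<bind> ?B))" for g
    by simp
  show ?thesis
    unfolding disintegrates_def
  proof
    fix g :: "'b \<times> 'c \<Rightarrow> ennreal" assume g[measurable]: "g \<in> borel_measurable (N \<Otimes>\<^sub>M R)"
    have "(\<integral>\<^sup>+\<omega>. g (Y \<omega>, Z \<omega>) \<partial>P) = (\<integral>\<^sup>+\<omega>. \<integral>\<^sup>+w. g w \<partial>?B \<omega> \<partial>P)"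
      using eq[of g] by (simp add: nn_integral_distr nn_integral_bind[OF g B])
    also have "\<dots> = (\<integral>\<^sup>+\<omega>. \<integral>\<^sup>+z. g (Y \<omega>, z) \<partial>\<kappa> (Y \<omega>) \<partial>P)"
    proof (intro nn_integral_cong)
      fix \<omega> assume \<omega>: "\<omega> \<in> space P"
      have "Pair (Y \<omega>) \<in> \<kappa> (Y \<omega>) \<rightarrow>\<^sub>M N \<Otimes>\<^sub>M R"
        using sk[OF \<omega>] measurable_space[OF Y \<omega>] by (simp cong: measurable_cong_sets)
      then show "(\<integral>\<^sup>+w. g w \<partial>?B \<omega>) = (\<integral>\<^sup>+z. g (Y \<omega>, z) \<partial>\<kappa> (Y \<omega>))"
        by (subst nn_integral_distr) auto
    qed
    finally show "(\<integral>\<^sup>+\<omega>. g (Y \<omega>, Z \<omega>) \<partial>P) = (\<integral>\<^sup>+\<omega>. \<integral>\<^sup>+z. g (Y \<omega>, z) \<partial>\<kappa> (Y \<omega>) \<partial>P)" .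
  qed
qed

text \<open>The events generated by \<open>Y\<close> are the preimages of sets \<open>A\<close> in
  \<open>N\<close>, so the defining integrals of the conditional probability of \<open>D\<close> are
  exactly the integrals over rectangles \<open>A \<times> D\<close>. This turns the almost sure
  identities of \<open>is_strategic_measure\<close> into integral identities.\<close>

lemma cond_exp_iff_disintegrates:
  assumes P: "prob_space P"
    and Y[measurable]: "Y \<in> P \<rightarrow>\<^sub>M N" and Z[measurable]: "Z \<in> P \<rightarrow>\<^sub>M R"
    and \<kappa>[measurable]: "\<kappa> \<in> N \<rightarrow>\<^sub>M prob_algebra R"
  shows "(\<forall>D\<in>sets R. AE \<omega> in P.
      real_cond_exp P (vimage_algebra (space P) Y N) (indicator {\<omega> \<in> space P. Z \<omega> \<in> D}) \<omega>
        = measure (\<kappa> (Y \<omega>)) D) \<longleftrightarrow> disintegrates P Y N Z R \<kappa>"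
proof -
  interpret prob_space P by fact
  let ?F = "vimage_algebra (space P) Y N"
  have \<kappa>'[measurable]: "\<kappa> \<in> N \<rightarrow>\<^sub>M subprob_algebra R" by (rule measurable_prob_algebraD) fact
  have sub: "subalgebra P ?F"
    unfolding subalgebra_def using measurable_sets[OF Y] measurable_space[OF Y]
    by (auto simp: sets_vimage_algebra2)
  interpret finite_measure_subalgebra P ?F
    by standard (rule sub)
  have YF: "Y \<in> ?F \<rightarrow>\<^sub>M N"
    by (rule measurable_vimage_algebra1) (use measurable_space[OF Y] in auto)
  have pk: "prob_space (\<kappa> (Y \<omega>))" if "\<omega> \<in> space P" for \<omega>
    using measurable_space[OF \<kappa> measurable_space[OF Y that]] by (auto simp: space_prob_algebra)
  have ennm: "ennreal (measure (\<kappa> (Y \<omega>)) D) = emeasure (\<kappa> (Y \<omega>)) D" if "\<omega> \<in> space P" for \<omega> D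
    by (metis finite_measure.emeasure_eq_measure pk prob_space_def that)
  have le1: "measure (\<kappa> (Y \<omega>)) D \<le> 1" if "\<omega> \<in> space P" for \<omega> D
    using prob_space.prob_le_1[OF pk[OF that]] .
  have mk: "(\<lambda>\<omega>. measure (\<kappa> (Y \<omega>)) D) \<in> borel_measurable P" if [measurable]: "D \<in> sets R" for D
    by measurable
  have mkF: "(\<lambda>\<omega>. measure (\<kappa> (Y \<omega>)) D) \<in> borel_measurable ?F" if [measurable]: "D \<in> sets R" for D
    by (rule measurable_compose[OF YF]) measurable
  have ik: "integrable P (\<lambda>\<omega>. measure (\<kappa> (Y \<omega>)) D)" if "D \<in> sets R" for D
    by (rule integrable_const_bound[where B=1]) (use le1 mk[OF that] in auto)
  have ii: "integrable P (indicator {\<omega> \<in> space P. Z \<omega> \<in> D} :: _ \<Rightarrow> real)" if [measurable]: "D \<in> sets R" for D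
    by (rule integrable_const_bound[where B=1]) (auto simp: indicator_def)
  have setF: "A' \<in> sets ?F \<longleftrightarrow> (\<exists>A\<in>sets N. A' = Y -` A \<inter> space P)" for A'
    using measurable_space[OF Y] by (subst sets_vimage_algebra2) auto
  have lhs: "(\<integral>\<omega>\<in>(Y -` A \<inter> space P). indicator {\<omega> \<in> space P. Z \<omega> \<in> D} \<omega> \<partial>P)
      = enn2real (\<integral>\<^sup>+\<omega>. indicator A (Y \<omega>) * indicator D (Z \<omega>) \<partial>P)"
    if [measurable]: "A \<in> sets N" "D \<in> sets R" for A D
    unfolding set_lebesgue_integral_def
    by (subst integral_eq_nn_integral)
      (auto intro!: arg_cong[where f=enn2real] nn_integral_cong split: split_indicator)
  have rhs: "(\<integral>\<omega>\<in>(Y -` A \<inter> space P). measure (\<kappa> (Y \<omega>)) D \<partial>P)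
      = enn2real (\<integral>\<^sup>+\<omega>. indicator A (Y \<omega>) * emeasure (\<kappa> (Y \<omega>)) D \<partial>P)"
    if [measurable]: "A \<in> sets N" "D \<in> sets R" for A D
    unfolding set_lebesgue_integral_def
    by (subst integral_eq_nn_integral)
      (auto simp: ennm intro!: arg_cong[where f=enn2real] nn_integral_cong split: split_indicator)
  \<comment> \<open>Finiteness of both sides makes the passage through \<open>enn2real\<close>
    reversible.\<close>
  have fin1: "(\<integral>\<^sup>+\<omega>. indicator A (Y \<omega>) * indicator D (Z \<omega>) \<partial>P) < \<infinity>" for A D
  proof -
    have "(\<integral>\<^sup>+\<omega>. indicator A (Y \<omega>) * indicator D (Z \<omega>) \<partial>P) \<le> (\<integral>\<^sup>+\<omega>. 1 \<partial>P)"
      by (intro nn_integral_mono) (auto split: split_indicator)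
    then show ?thesis by (simp add: emeasure_space_1 order_le_less_trans)
  qed
  have fin2: "(\<integral>\<^sup>+\<omega>. indicator A (Y \<omega>) * emeasure (\<kappa> (Y \<omega>)) D \<partial>P) < \<infinity>" for A D
  proof -
    have "(\<integral>\<^sup>+\<omega>. indicator A (Y \<omega>) * emeasure (\<kappa> (Y \<omega>)) D \<partial>P) \<le> (\<integral>\<^sup>+\<omega>. 1 \<partial>P)"
      by (intro nn_integral_mono) (auto split: split_indicator simp: prob_space.emeasure_le_1 pk)
    then show ?thesis by (simp add: emeasure_space_1 order_le_less_trans)
  qed
  show ?thesis
  proof
    assume L: "\<forall>D\<in>sets R. AE \<omega> in P.
      real_cond_exp P ?F (indicator {\<omega> \<in> space P. Z \<omega> \<in> D}) \<omega> = measure (\<kappa> (Y \<omega>)) D"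
    show "disintegrates P Y N Z R \<kappa>"
    proof (rule disintegrates_rectangle[OF P Y Z \<kappa>])
      fix A D assume [measurable]: "A \<in> sets N" "D \<in> sets R"
      have "(\<integral>\<omega>\<in>(Y -` A \<inter> space P). indicator {\<omega> \<in> space P. Z \<omega> \<in> D} \<omega> \<partial>P)
        = (\<integral>\<omega>\<in>(Y -` A \<inter> space P). real_cond_exp P ?F (indicator {\<omega> \<in> space P. Z \<omega> \<in> D}) \<omega> \<partial>P)"
        by (rule real_cond_exp_intA[OF ii]) (auto simp: setF)
      also have "\<dots> = (\<integral>\<omega>\<in>(Y -` A \<inter> space P). measure (\<kappa> (Y \<omega>)) D \<partial>P)"
        unfolding set_lebesgue_integral_def
        using L[rule_format, OF \<open>D \<in> sets R\<close>] mk[OF \<open>D \<in> sets R\<close>]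
        by (intro integral_cong_AE) auto
      finally have "enn2real (\<integral>\<^sup>+\<omega>. indicator A (Y \<omega>) * indicator D (Z \<omega>) \<partial>P)
        = enn2real (\<integral>\<^sup>+\<omega>. indicator A (Y \<omega>) * emeasure (\<kappa> (Y \<omega>)) D \<partial>P)"
        by (simp only: lhs[OF \<open>A \<in> sets N\<close> \<open>D \<in> sets R\<close>] rhs[OF \<open>A \<in> sets N\<close> \<open>D \<in> sets R\<close>])
      from this[THEN arg_cong[where f=ennreal]]
      show "(\<integral>\<^sup>+\<omega>. indicator A (Y \<omega>) * indicator D (Z \<omega>) \<partial>P)
        = (\<integral>\<^sup>+\<omega>. indicator A (Y \<omega>) * emeasure (\<kappa> (Y \<omega>)) D \<partial>P)"
        using fin1[of A D] fin2[of A D] by (simp only: ennreal_enn2real infinity_ennreal_def)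
    qed
  next
    assume R: "disintegrates P Y N Z R \<kappa>"
    show "\<forall>D\<in>sets R. AE \<omega> in P.
      real_cond_exp P ?F (indicator {\<omega> \<in> space P. Z \<omega> \<in> D}) \<omega> = measure (\<kappa> (Y \<omega>)) D"
    proof
      fix D assume D[measurable]: "D \<in> sets R"
      show "AE \<omega> in P. real_cond_exp P ?F (indicator {\<omega> \<in> space P. Z \<omega> \<in> D}) \<omega> = measure (\<kappa> (Y \<omega>)) D"
      proof (rule real_cond_exp_charact[OF _ ii[OF D] ik[OF D] mkF[OF D]])
        fix A' assume "A' \<in> sets ?F"
        then obtain A where A[measurable]: "A \<in> sets N" and A': "A' = Y -` A \<inter> space P"
          by (auto simp: setF)
        have "(\<integral>\<^sup>+\<omega>. indicator A (Y \<omega>) * indicator D (Z \<omega>) \<partial>P)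
            = (\<integral>\<^sup>+\<omega>. indicator A (Y \<omega>) * emeasure (\<kappa> (Y \<omega>)) D \<partial>P)"
        proof -
          have "(\<integral>\<^sup>+\<omega>. indicator (A \<times> D) (Y \<omega>, Z \<omega>) \<partial>P)
              = (\<integral>\<^sup>+\<omega>. \<integral>\<^sup>+z. indicator (A \<times> D) (Y \<omega>, z) \<partial>\<kappa> (Y \<omega>) \<partial>P)"
            using R by (simp add: disintegrates_def)
          moreover have "(\<integral>\<^sup>+z. indicator (A \<times> D) (Y \<omega>, z) \<partial>\<kappa> (Y \<omega>))
              = indicator A (Y \<omega>) * emeasure (\<kappa> (Y \<omega>)) D" if "\<omega> \<in> space P" for \<omega>
          proof -
            have "D \<in> sets (\<kappa> (Y \<omega>))"
              using subprob_measurableD(2)[OF \<kappa>' measurable_space[OF Y that]] by simp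
            then show ?thesis
              by (simp add: indicator_times nn_integral_cmult)
          qed
          ultimately show ?thesis
            by (simp add: indicator_times cong: nn_integral_cong)
        qed
        then show "(\<integral>\<omega>\<in>A'. indicator {\<omega> \<in> space P. Z \<omega> \<in> D} \<omega> \<partial>P) = (\<integral>\<omega>\<in>A'. measure (\<kappa> (Y \<omega>)) D \<partial>P)"
          by (simp add: A' lhs rhs)
      qed
    qed
  qed
qed

section \<open>The measure induced by a policy\<close>

locale mdp_model =
  fixes \<M> :: "('x::polish_space, 'a::polish_space) mdp"
  assumes model: "markov_decision_model \<M>"
begin

abbreviation "S \<equiv> state_algebra \<M>"
abbreviation "Act \<equiv> action_algebra \<M>"
abbreviation "K \<equiv> adm_pairs \<M>"
abbreviation "H \<equiv> history_algebra \<M>"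

lemma space_S[simp]: "space S = states \<M>"
  by (simp add: state_algebra_def space_restrict_space)

lemma space_Act[simp]: "space Act = actions \<M>"
  by (simp add: action_algebra_def space_restrict_space)

lemma K_sets[measurable]: "K \<in> sets (S \<Otimes>\<^sub>M Act)"
  using model by (simp add: markov_decision_model_def)

lemma K_sub: "K \<subseteq> states \<M> \<times> actions \<M>"
  using sets.sets_into_space[OF K_sets] by (simp add: space_pair_measure)

lemma pair_borel: "(\<lambda>k. k) \<in> S \<Otimes>\<^sub>M Act \<rightarrow>\<^sub>M borel"
proof -
  have "fst \<in> borel_measurable (S \<Otimes>\<^sub>M Act)"
    by (rule measurable_compose[OF measurable_fst]) (simp add: state_algebra_def measurable_restrict_space1)
  moreover have "snd \<in> borel_measurable (S \<Otimes>\<^sub>M Act)"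
    by (rule measurable_compose[OF measurable_snd]) (simp add: action_algebra_def measurable_restrict_space1)
  ultimately have "(\<lambda>k. (fst k, snd k)) \<in> borel_measurable (S \<Otimes>\<^sub>M Act)"
    by (rule borel_measurable_Pair)
  then show ?thesis by simp
qed

text \<open>The kernel and the cost are assumed measurable for the Borel sets of the product type,
  whereas trajectories carry the product of the two restricted algebras. The identity map transfers
  measurability from the former to the latter.\<close>

lemma id_K: "(\<lambda>k. k) \<in> restrict_space (S \<Otimes>\<^sub>M Act) K \<rightarrow>\<^sub>M restrict_space borel K"
  by (intro measurable_restrict_space2 measurable_restrict_space1 pair_borel) (auto simp: space_restrict_space)

lemma trans_K: "trans \<M> \<in> restrict_space (S \<Otimes>\<^sub>M Act) K \<rightarrow>\<^sub>M prob_algebra S"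
  using model measurable_compose[OF id_K] by (auto simp: markov_decision_model_def)

lemma cost_K: "cost \<M> \<in> borel_measurable (restrict_space (S \<Otimes>\<^sub>M Act) K)"
  using model measurable_compose[OF id_K] by (auto simp: markov_decision_model_def)

lemma trans_sets: "k \<in> K \<Longrightarrow> sets (trans \<M> k) = sets S"
  and trans_space: "k \<in> K \<Longrightarrow> space (trans \<M> k) = states \<M>"
proof -
  assume k: "k \<in> K"
  then have "k \<in> space (restrict_space (S \<Otimes>\<^sub>M Act) K)"
    using K_sub by (auto simp: space_restrict_space space_pair_measure)
  from measurable_space[OF trans_K this]
  show 1: "sets (trans \<M> k) = sets S"
    by (simp add: space_prob_algebra)
  show "space (trans \<M> k) = states \<M>" using sets_eq_imp_space_eq[OF 1] by simp
qed

definition cost0 :: "'x \<times> 'a \<Rightarrow> real" where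
  "cost0 k = (if k \<in> K then cost \<M> k else 0)"

lemma cost0_meas[measurable]: "cost0 \<in> borel_measurable (S \<Otimes>\<^sub>M Act)"
  unfolding cost0_def[abs_def]
  by (subst measurable_If_restrict_space_iff)
    (use cost_K in \<open>auto simp: measurable_restrict_space1\<close>)

lemma histories_sets[measurable]: "histories \<M> n \<in> sets (H n)"
  unfolding histories_def history_algebra_def
  using sets.top[of S] by (intro pair_measureI sets_PiM_I_finite) (auto simp: K_sets)

lemma restrict_H: "(\<lambda>\<omega>. restrict \<omega> {0..<n}) \<in> trajectory_algebra \<M> \<rightarrow>\<^sub>M Pi\<^sub>M {0..<n} (\<lambda>_. S \<Otimes>\<^sub>M Act)"
  unfolding trajectory_algebra_def by (rule measurable_restrict_subset) auto

lemma comp_T: "(\<lambda>\<omega>. \<omega> n) \<in> trajectory_algebra \<M> \<rightarrow>\<^sub>M S \<Otimes>\<^sub>M Act"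
  unfolding trajectory_algebra_def by (rule measurable_component_singleton) simp

lemma history_T: "history n \<in> trajectory_algebra \<M> \<rightarrow>\<^sub>M H n"
  unfolding history_algebra_def history_def[abs_def]
  by (intro measurable_Pair restrict_H measurable_compose[OF comp_T measurable_fst])

end

section \<open>Total kernels and almost sure admissibility of the trajectories\<close>

locale mdp_policy = mdp_model \<M>
  for \<M> :: "('x::polish_space, 'a::polish_space) mdp" +
  fixes \<pi> :: "nat \<Rightarrow> ('x, 'a) history \<Rightarrow> 'a measure" and x0 :: 'x
  assumes \<pi>: "\<pi> \<in> policies \<M>" and x0: "x0 \<in> states \<M>"
begin

text \<open>A policy and the transition kernel are constrained only on the histories and on the
  admissible pairs; these extensions are kernels on the whole spaces, and agree with the
  given ones almost surely.\<close>

definition pol :: "nat \<Rightarrow> ('x, 'a) history \<Rightarrow> 'a measure" where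
  "pol n h = (if h \<in> histories \<M> n then \<pi> n h else return Act (SOME a. a \<in> actions \<M>))"

definition ker :: "'x \<times> 'a \<Rightarrow> 'x measure" where
  "ker k = (if k \<in> K then trans \<M> k else return S x0)"

text \<open>Guarantees the default action in \<open>pol\<close>: a policy yields a probability
  measure on the action space at the initial history, so that space is nonempty.\<close>

lemma actions_ne: "(SOME a. a \<in> actions \<M>) \<in> actions \<M>"
proof -
  have "((\<lambda>_. undefined), x0) \<in> histories \<M> 0" using x0 by (simp add: histories_def)
  then have h: "((\<lambda>_. undefined), x0) \<in> space (restrict_space (H 0) (histories \<M> 0))"
    using sets.sets_into_space[OF histories_sets] by (auto simp: space_restrict_space)
  have "\<pi> 0 \<in> restrict_space (H 0) (histories \<M> 0) \<rightarrow>\<^sub>M prob_algebra Act"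
    using \<pi> by (auto simp: policies_def)
  from measurable_space[OF this h] have "prob_space (\<pi> 0 ((\<lambda>_. undefined), x0))"
    "space (\<pi> 0 ((\<lambda>_. undefined), x0)) = actions \<M>"
    by (auto simp: space_prob_algebra dest: sets_eq_imp_space_eq)
  then have "actions \<M> \<noteq> {}" using prob_space.not_empty by metis
  then show ?thesis by (simp add: some_in_eq)
qed

lemma pol_meas[measurable]: "pol n \<in> H n \<rightarrow>\<^sub>M prob_algebra Act"
proof -
  have "\<pi> n \<in> restrict_space (H n) (histories \<M> n) \<rightarrow>\<^sub>M prob_algebra Act"
    using \<pi> by (auto simp: policies_def)
  moreover have "return Act (SOME a. a \<in> actions \<M>) \<in> space (prob_algebra Act)"
    using actions_ne by (auto simp: space_prob_algebra intro!: prob_space_return)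
  ultimately show ?thesis
    unfolding pol_def[abs_def]
    by (subst measurable_If_restrict_space_iff)
      (auto intro!: measurable_const)
qed

lemma ker_meas[measurable]: "ker \<in> S \<Otimes>\<^sub>M Act \<rightarrow>\<^sub>M prob_algebra S"
proof -
  have "return S x0 \<in> space (prob_algebra S)"
    using x0 by (auto simp: space_prob_algebra intro!: prob_space_return)
  then show ?thesis
    unfolding ker_def[abs_def]
    by (subst measurable_If_restrict_space_iff)
      (auto intro!: measurable_const trans_K)
qed

text \<open>The integral form of \<open>is_strategic_measure\<close>, with the total kernels. In the
  last condition \<open>w\<close> pairs a history with an action, so \<open>snd (fst w)\<close> is
  the current state.\<close>

definition strategic :: "(nat \<Rightarrow> 'x \<times> 'a) measure \<Rightarrow> bool" where
  "strategic P \<longleftrightarrow> prob_space P \<and> sets P = sets (trajectory_algebra \<M>) \<and>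
     measure P {\<omega> \<in> space P. fst (\<omega> 0) = x0} = 1 \<and>
     (\<forall>n. disintegrates P (history n) (H n) (\<lambda>\<omega>. snd (\<omega> n)) Act (pol n)) \<and>
     (\<forall>n. disintegrates P (\<lambda>\<omega>. (history n \<omega>, snd (\<omega> n))) (H n \<Otimes>\<^sub>M Act) (\<lambda>\<omega>. fst (\<omega> (Suc n))) S
            (\<lambda>w. ker (snd (fst w), snd w)))"


lemma pol_prob: "h \<in> space (H n) \<Longrightarrow> prob_space (pol n h) \<and> sets (pol n h) = sets Act \<and> space (pol n h) = actions \<M>"
  using measurable_space[OF pol_meas, of h n] sets_eq_imp_space_eq[of "pol n h" Act]
  by (simp add: space_prob_algebra)

lemma ker_hist[measurable]: "(\<lambda>w. ker (snd (fst w), snd w)) \<in> H n \<Otimes>\<^sub>M Act \<rightarrow>\<^sub>M prob_algebra S"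
proof -
  have "(\<lambda>w. (snd (fst w), snd w)) \<in> H n \<Otimes>\<^sub>M Act \<rightarrow>\<^sub>M S \<Otimes>\<^sub>M Act"
    unfolding history_algebra_def by measurable
  from measurable_compose[OF this ker_meas] show ?thesis .
qed

lemma pol_adm:
  assumes "h \<in> histories \<M> n"
  shows "AE a in pol n h. (snd h, a) \<in> K"
proof -
  have h: "h \<in> space (H n)" using assms sets.sets_into_space[OF histories_sets] by auto
  interpret p: prob_space "pol n h" using pol_prob[OF h] by simp
  have s: "snd h \<in> states \<M>" using assms by (auto simp: histories_def)
  have eq: "adm \<M> (snd h) = {a \<in> space (pol n h). (snd h, a) \<in> K}"
    using s K_sub pol_prob[OF h] by (auto simp: adm_pairs_def)
  have "measure (pol n h) (adm \<M> (snd h)) = 1"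
    using \<pi> assms by (auto simp: policies_def pol_def)
  moreover have "adm \<M> (snd h) \<in> sets (pol n h)"
  proof -
    have "(\<lambda>a. (snd h, a)) \<in> Act \<rightarrow>\<^sub>M S \<Otimes>\<^sub>M Act" using s by (intro measurable_Pair1') simp
    from measurable_sets[OF this K_sets] show ?thesis
      using pol_prob[OF h] by (simp add: eq vimage_def Int_def conj_commute)
  qed
  ultimately show ?thesis
    unfolding eq by (subst (asm) p.prob_Collect_eq_1) auto
qed

text \<open>Test the disintegration with the indicator of the complement of \<open>K\<close>: its
  inner integral vanishes at every admissible history by \<open>pol_adm\<close>.\<close>

lemma AE_step:
  assumes P: "prob_space P" "sets P = sets (trajectory_algebra \<M>)"
    and dis: "disintegrates P (history n) (H n) (\<lambda>\<omega>. snd (\<omega> n)) Act (pol n)"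
    and hist: "AE \<omega> in P. history n \<omega> \<in> histories \<M> n"
  shows "AE \<omega> in P. \<omega> n \<in> K"
proof -
  have hm[measurable]: "history n \<in> P \<rightarrow>\<^sub>M H n" using history_T P(2) by (simp cong: measurable_cong_sets)
  have cm[measurable]: "(\<lambda>\<omega>. \<omega> n) \<in> P \<rightarrow>\<^sub>M S \<Otimes>\<^sub>M Act" using comp_T P(2) by (simp cong: measurable_cong_sets)
  define g :: "('x,'a) history \<times> 'a \<Rightarrow> ennreal" where
    "g = (\<lambda>(h, a). indicator (space (S \<Otimes>\<^sub>M Act) - K) (snd h, a))"
  have g: "g \<in> borel_measurable (H n \<Otimes>\<^sub>M Act)"
    unfolding g_def history_algebra_def by measurable
  have "(\<integral>\<^sup>+\<omega>. g (history n \<omega>, snd (\<omega> n)) \<partial>P) = (\<integral>\<^sup>+\<omega>. \<integral>\<^sup>+a. g (history n \<omega>, a) \<partial>pol n (history n \<omega>) \<partial>P)"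
    using dis g by (simp add: disintegrates_def)
  also have "\<dots> = (\<integral>\<^sup>+\<omega>. 0 \<partial>P)"
  proof (rule nn_integral_cong_AE)
    show "AE \<omega> in P. (\<integral>\<^sup>+a. g (history n \<omega>, a) \<partial>pol n (history n \<omega>)) = 0"
      using hist
    proof eventually_elim
      case (elim \<omega>)
      have "(\<integral>\<^sup>+a. g (history n \<omega>, a) \<partial>pol n (history n \<omega>)) = (\<integral>\<^sup>+a. 0 \<partial>pol n (history n \<omega>))"
        using pol_adm[OF elim] by (intro nn_integral_cong_AE) (auto simp: g_def)
      then show ?case by simp
    qed
  qed
  finally have "AE \<omega> in P. g (history n \<omega>, snd (\<omega> n)) = 0"
    by (simp add: nn_integral_0_iff_AE[OF measurable_compose[OF _ g]] measurable_Pair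
        measurable_compose[OF cm measurable_snd])
  moreover have "AE \<omega> in P. \<omega> n \<in> space (S \<Otimes>\<^sub>M Act)"
    using measurable_space[OF cm] by auto
  ultimately show ?thesis
    by eventually_elim (auto simp: g_def history_def split: split_indicator_asm)
qed

lemma histories_Suc:
  assumes "\<omega> \<in> space (trajectory_algebra \<M>)" "history n \<omega> \<in> histories \<M> n" "\<omega> n \<in> K"
  shows "history (Suc n) \<omega> \<in> histories \<M> (Suc n)"
proof -
  have "fst (\<omega> (Suc n)) \<in> states \<M>"
    using measurable_space[OF comp_T assms(1), of "Suc n"] by (auto simp: space_pair_measure)
  then show ?thesis using assms(2,3)
    by (auto simp: histories_def history_def PiE_iff less_Suc_eq)
qed

lemma histories_0:
  assumes "\<omega> \<in> space (trajectory_algebra \<M>)"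
  shows "history 0 \<omega> \<in> histories \<M> 0"
  using measurable_space[OF comp_T assms, of 0] by (auto simp: histories_def history_def space_pair_measure)

text \<open>The identity at stage \<open>n\<close> is assumed only if the histories of length
  \<open>n\<close> are already almost surely admissible, which the induction supplies. In this form
  the lemma also serves the original conditional probabilities, which are comparable with
  \<open>pol\<close> on admissible histories only.\<close>

lemma AE_histories:
  assumes P: "prob_space P" "sets P = sets (trajectory_algebra \<M>)"
    and dis: "\<And>n. (AE \<omega> in P. history n \<omega> \<in> histories \<M> n) \<Longrightarrow>
      disintegrates P (history n) (H n) (\<lambda>\<omega>. snd (\<omega> n)) Act (pol n)"
  shows "AE \<omega> in P. history n \<omega> \<in> histories \<M> n"
proof (induction n)
  case 0
  show ?case using histories_0 sets_eq_imp_space_eq[OF P(2)] by auto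
next
  case (Suc n)
  have "AE \<omega> in P. \<omega> \<in> space (trajectory_algebra \<M>)" using sets_eq_imp_space_eq[OF P(2)] by auto
  with Suc AE_step[OF P dis[OF Suc] Suc] show ?case
    by eventually_elim (rule histories_Suc)
qed

text \<open>Exchanging \<open>\<pi>\<close> for \<open>pol\<close> and \<open>trans\<close> for
  \<open>ker\<close> is harmless along admissible histories, and admissibility is itself a
  consequence of either set of conditions. Hence the case split at the end: with admissible
  histories the conditions correspond stage by stage, otherwise both sides fail.\<close>

lemma is_strategic_iff: "is_strategic_measure \<M> \<pi> x0 P \<longleftrightarrow> strategic P"
proof (cases "prob_space P \<and> sets P = sets (trajectory_algebra \<M>)")
  case False then show ?thesis by (auto simp: is_strategic_measure_def strategic_def)
next
  case True
  then have P: "prob_space P" "sets P = sets (trajectory_algebra \<M>)" by auto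
  have hm[measurable]: "history n \<in> P \<rightarrow>\<^sub>M H n" for n using history_T P(2) by (simp cong: measurable_cong_sets)
  have cm[measurable]: "(\<lambda>\<omega>. \<omega> n) \<in> P \<rightarrow>\<^sub>M S \<Otimes>\<^sub>M Act" for n using comp_T P(2) by (simp cong: measurable_cong_sets)
  have sm: "(\<lambda>\<omega>. snd (\<omega> n)) \<in> P \<rightarrow>\<^sub>M Act" for n by (rule measurable_compose[OF cm measurable_snd])
  have fm: "(\<lambda>\<omega>. fst (\<omega> n)) \<in> P \<rightarrow>\<^sub>M S" for n by (rule measurable_compose[OF cm measurable_fst])
  have hsm: "(\<lambda>\<omega>. (history n \<omega>, snd (\<omega> n))) \<in> P \<rightarrow>\<^sub>M H n \<Otimes>\<^sub>M Act" for n
    by (intro measurable_Pair hm sm)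
  define cp where "cp n = (\<forall>D \<in> sets Act. AE \<omega> in P.
        real_cond_exp P (vimage_algebra (space P) (history n) (H n))
          (indicator {\<omega> \<in> space P. snd (\<omega> n) \<in> D}) \<omega> = measure (\<pi> n (history n \<omega>)) D)" for n
  define ct where "ct n = (\<forall>B \<in> sets S. AE \<omega> in P.
        real_cond_exp P (vimage_algebra (space P) (\<lambda>\<omega>. (history n \<omega>, snd (\<omega> n))) (H n \<Otimes>\<^sub>M Act))
          (indicator {\<omega> \<in> space P. fst (\<omega> (Suc n)) \<in> B}) \<omega> = measure (trans \<M> (\<omega> n)) B)" for n
  let ?dp = "\<lambda>n. disintegrates P (history n) (H n) (\<lambda>\<omega>. snd (\<omega> n)) Act (pol n)"
  let ?dt = "\<lambda>n. disintegrates P (\<lambda>\<omega>. (history n \<omega>, snd (\<omega> n))) (H n \<Otimes>\<^sub>M Act) (\<lambda>\<omega>. fst (\<omega> (Suc n))) S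
            (\<lambda>w. ker (snd (fst w), snd w))"
  have p: "cp n \<longleftrightarrow> ?dp n" if ae: "AE \<omega> in P. history n \<omega> \<in> histories \<M> n" for n
  proof -
    have "AE \<omega> in P. measure (\<pi> n (history n \<omega>)) D = measure (pol n (history n \<omega>)) D" for D
      using ae by eventually_elim (simp add: pol_def)
    note ae_eq = this
    let ?F = "vimage_algebra (space P) (history n) (H n)" and ?Z = "\<lambda>\<omega>. snd (\<omega> n)"
      and ?m1 = "\<lambda>\<omega>. measure (\<pi> n (history n \<omega>))" and ?m2 = "\<lambda>\<omega>. measure (pol n (history n \<omega>))"
    have "cp n \<longleftrightarrow> (\<forall>D \<in> sets Act. AE \<omega> in P.
        real_cond_exp P (vimage_algebra (space P) (history n) (H n))
          (indicator {\<omega> \<in> space P. snd (\<omega> n) \<in> D}) \<omega> = measure (pol n (history n \<omega>)) D)"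
      unfolding cp_def
    proof (intro ball_cong refl eventually_subst)
      fix D
      show "AE \<omega> in P. (real_cond_exp P (?F) (indicator {\<omega> \<in> space P. ?Z \<omega> \<in> D}) \<omega> = ?m1 \<omega> D)
        = (real_cond_exp P (?F) (indicator {\<omega> \<in> space P. ?Z \<omega> \<in> D}) \<omega> = ?m2 \<omega> D)"
        using ae_eq[of D] by eventually_elim simp
    qed
    then show ?thesis
      using cond_exp_iff_disintegrates[OF P(1) hm sm pol_meas] by simp
  qed
  have t: "ct n \<longleftrightarrow> ?dt n" if ae: "AE \<omega> in P. \<omega> n \<in> K" for n
  proof -
    let ?k = "\<lambda>w::('x,'a) history \<times> 'a. ker (snd (fst w), snd w)"
    have "AE \<omega> in P. measure (trans \<M> (\<omega> n)) D = measure (?k (history n \<omega>, snd (\<omega> n))) D" for D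
      using ae by eventually_elim (simp add: ker_def history_def)
    note ae_eq = this
    let ?F = "vimage_algebra (space P) (\<lambda>\<omega>. (history n \<omega>, snd (\<omega> n))) (H n \<Otimes>\<^sub>M Act)" and ?Z = "\<lambda>\<omega>. fst (\<omega> (Suc n))"
      and ?m1 = "\<lambda>\<omega>. measure (trans \<M> (\<omega> n))" and ?m2 = "\<lambda>\<omega>. measure (?k (history n \<omega>, snd (\<omega> n)))"
    have "ct n \<longleftrightarrow> (\<forall>B \<in> sets S. AE \<omega> in P.
        real_cond_exp P (vimage_algebra (space P) (\<lambda>\<omega>. (history n \<omega>, snd (\<omega> n))) (H n \<Otimes>\<^sub>M Act))
          (indicator {\<omega> \<in> space P. fst (\<omega> (Suc n)) \<in> B}) \<omega> = measure (?k (history n \<omega>, snd (\<omega> n))) B)"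
      unfolding ct_def
    proof (intro ball_cong refl eventually_subst)
      fix D
      show "AE \<omega> in P. (real_cond_exp P (?F) (indicator {\<omega> \<in> space P. ?Z \<omega> \<in> D}) \<omega> = ?m1 \<omega> D)
        = (real_cond_exp P (?F) (indicator {\<omega> \<in> space P. ?Z \<omega> \<in> D}) \<omega> = ?m2 \<omega> D)"
        using ae_eq[of D] by eventually_elim simp
    qed
    also have "\<dots> \<longleftrightarrow> ?dt n"
      by (rule cond_exp_iff_disintegrates[OF P(1) hsm fm ker_hist])
    finally show ?thesis .
  qed
  have "(\<forall>n. cp n) \<and> (\<forall>n. ct n) \<longleftrightarrow> (\<forall>n. ?dp n) \<and> (\<forall>n. ?dt n)"
  proof (cases "\<forall>n. AE \<omega> in P. history n \<omega> \<in> histories \<M> n")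
    case True
    then have "cp n \<longleftrightarrow> ?dp n" for n using p by blast
    moreover have "ct n \<longleftrightarrow> ?dt n" if "?dp n" for n using t AE_step[OF P that] True by blast
    ultimately show ?thesis by blast
  next
    case False
    have "\<not> (\<forall>n. ?dp n)" using AE_histories[OF P] False by blast
    \<comment> \<open>If all \<open>cp n\<close> held, \<open>p\<close> would provide exactly the
      conditional premise of \<open>AE_histories\<close>.\<close>
    moreover have "\<not> (\<forall>n. cp n)" using AE_histories[OF P] False p by blast
    ultimately show ?thesis by blast
  qed
  then show ?thesis
    using P by (simp add: is_strategic_measure_def strategic_def cp_def ct_def)
qed

end

section \<open>Existence and uniqueness of the trajectory measure\<close>

lemma (in Ionescu_Tulcea) CI_eq_C: "CI {0..<n} = C 0 n (\<lambda>_. undefined)"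
proof (rule measure_eqI)
  have s: "sets (C 0 n (\<lambda>_. undefined)) = sets (PiM {0..<n} M)"
    using sets_C[of "\<lambda>_. undefined" 0 n] by simp
  then show "sets (CI {0..<n}) = sets (C 0 n (\<lambda>_. undefined))"
    by (simp add: CI_def)
  fix X assume "X \<in> sets (CI {0..<n})"
  then have X: "X \<in> sets (PiM {0..<n} M)" by (simp add: CI_def)
  then show "emeasure (CI {0..<n}) X = emeasure (C 0 n (\<lambda>_. undefined)) X"
    using sets.sets_into_space[OF X] by (subst emeasure_CI[of "{0..<n}" n]) (auto simp: prod_emb_id space_PiM)
qed

text \<open>The first \<open>n\<close> coordinates of the limit have law \<open>C 0 n\<close>, and
  \<open>C 0 (Suc n)\<close> is by construction \<open>C 0 n\<close> followed by
  \<open>eP n\<close>, which appends a coordinate drawn from \<open>P n\<close>. The claim concerns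
  finitely many coordinates and so reduces to this recursion.\<close>

lemma (in Ionescu_Tulcea) disintegrates_lim:
  "disintegrates PF.lim (\<lambda>\<omega>. restrict \<omega> {0..<n}) (PiM {0..<n} M) (\<lambda>\<omega>. \<omega> n) (M n) (P n)"
  unfolding disintegrates_def
proof
  fix g :: "(nat \<Rightarrow> 'a) \<times> 'a \<Rightarrow> ennreal"
  assume g[measurable]: "g \<in> borel_measurable (PiM {0..<n} M \<Otimes>\<^sub>M M n)"
  have rm: "(\<lambda>x. restrict x {0..<k}) \<in> PF.lim \<rightarrow>\<^sub>M PiM {0..<k} M" for k
    by (simp add: measurable_cong_sets[OF PF.sets_lim refl] measurable_restrict_subset)
  have law: "distr PF.lim (PiM {0..<k} M) (\<lambda>x. restrict x {0..<k}) = C 0 k (\<lambda>_. undefined)" for k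
    using distr_lim[of "{0..<k}"] by (simp add: CI_eq_C)
  have u: "(\<lambda>_. undefined) \<in> space (PiM {0..<0} M)" by (simp add: space_PiM)
  have sC: "sets (C 0 n (\<lambda>_. undefined)) = sets (PiM {0..<n} M)"
    using sets_C[OF u, of n] by simp
  have gm: "(\<lambda>w. g (restrict w {0..<n}, w n)) \<in> borel_measurable (PiM {0..<Suc n} M)"
    by (rule measurable_compose[OF _ g])
      (intro measurable_Pair measurable_restrict_subset measurable_component_singleton, auto)
  have eP: "eP n \<in> C 0 n (\<lambda>_. undefined) \<rightarrow>\<^sub>M subprob_algebra (PiM {0..<Suc n} M)"
    using measurable_eP[of n] by (simp add: measurable_cong_sets[OF sC refl])
  have gi: "(\<lambda>w. \<integral>\<^sup>+p. g (w, p) \<partial>P n w) \<in> borel_measurable (PiM {0..<n} M)"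
    by (rule nn_integral_measurable_subprob_algebra2[OF _ P]) (simp add: split_beta')
  have "(\<integral>\<^sup>+\<omega>. g (restrict \<omega> {0..<n}, \<omega> n) \<partial>PF.lim)
      = (\<integral>\<^sup>+\<omega>. g (restrict (restrict \<omega> {0..<Suc n}) {0..<n}, (restrict \<omega> {0..<Suc n}) n) \<partial>PF.lim)"
    by (simp add: Int_absorb1)
  also have "\<dots> = (\<integral>\<^sup>+w. g (restrict w {0..<n}, w n) \<partial>C 0 (Suc n) (\<lambda>_. undefined))"
    unfolding law[symmetric] by (subst nn_integral_distr[OF rm]) (use gm in auto)
  also have "\<dots> = (\<integral>\<^sup>+w'. \<integral>\<^sup>+w. g (restrict w {0..<n}, w n) \<partial>eP n w' \<partial>C 0 n (\<lambda>_. undefined))"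
    using nn_integral_bind[OF gm eP] by simp
  also have "\<dots> = (\<integral>\<^sup>+w'. \<integral>\<^sup>+p. g (w', p) \<partial>P n w' \<partial>C 0 n (\<lambda>_. undefined))"
  proof (intro nn_integral_cong)
    fix w' assume "w' \<in> space (C 0 n (\<lambda>_. undefined))"
    then have w': "w' \<in> space (PiM {0..<n} M)" using sets_eq_imp_space_eq[OF sC] by simp
    have "restrict (w'(n := p)) {0..<n} = w'" for p
      using w' by (auto simp: space_PiM PiE_iff extensional_def fun_eq_iff)
    then show "(\<integral>\<^sup>+w. g (restrict w {0..<n}, w n) \<partial>eP n w') = (\<integral>\<^sup>+p. g (w', p) \<partial>P n w')"
      by (subst nn_integral_eP[OF w' gm]) simp
  qed
  also have "\<dots> = (\<integral>\<^sup>+\<omega>. \<integral>\<^sup>+p. g (restrict \<omega> {0..<n}, p) \<partial>P n (restrict \<omega> {0..<n}) \<partial>PF.lim)"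
    unfolding law[symmetric] by (subst nn_integral_distr[OF rm]) (use gi in auto)
  finally show "(\<integral>\<^sup>+\<omega>. g (restrict \<omega> {0..<n}, \<omega> n) \<partial>PF.lim)
    = (\<integral>\<^sup>+\<omega>. \<integral>\<^sup>+p. g (restrict \<omega> {0..<n}, p) \<partial>P n (restrict \<omega> {0..<n}) \<partial>PF.lim)" .
qed

context mdp_policy
begin

text \<open>The Ionescu-Tulcea construction takes one kernel per coordinate, and a coordinate is a
  whole pair here. The two draws of a stage, state and then action, are therefore fused into the
  kernel \<open>step\<close>, of which this is the first half.\<close>

definition start :: "nat \<Rightarrow> (nat \<Rightarrow> 'x \<times> 'a) \<Rightarrow> 'x measure" where
  "start n w = (case n of 0 \<Rightarrow> return S x0 | Suc m \<Rightarrow> ker (w m))"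

definition step :: "nat \<Rightarrow> (nat \<Rightarrow> 'x \<times> 'a) \<Rightarrow> ('x \<times> 'a) measure" where
  "step n w = start n w \<bind> (\<lambda>y. pol n (w, y) \<bind> (\<lambda>a. return (S \<Otimes>\<^sub>M Act) (y, a)))"

abbreviation "Hp n \<equiv> Pi\<^sub>M {0..<n} (\<lambda>_. S \<Otimes>\<^sub>M Act)"

lemma H_eq: "H n = Hp n \<Otimes>\<^sub>M S"
  by (simp add: history_algebra_def)

lemma start_meas[measurable]: "start n \<in> Hp n \<rightarrow>\<^sub>M prob_algebra S"
proof (cases n)
  case 0
  have "return S x0 \<in> space (prob_algebra S)"
    using x0 by (auto simp: space_prob_algebra intro!: prob_space_return)
  then show ?thesis by (simp add: start_def[abs_def] 0)
next
  case (Suc m)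
  have "(\<lambda>w. w m) \<in> Hp (Suc m) \<rightarrow>\<^sub>M S \<Otimes>\<^sub>M Act"
    by (rule measurable_component_singleton) simp
  from measurable_compose[OF this ker_meas] show ?thesis
    by (simp add: start_def[abs_def] Suc)
qed

lemma pol_ret: "(\<lambda>h. pol n h \<bind> (\<lambda>a. return (S \<Otimes>\<^sub>M Act) (snd h, a))) \<in> H n \<rightarrow>\<^sub>M prob_algebra (S \<Otimes>\<^sub>M Act)"
proof (rule measurable_bind_prob_space2[OF pol_meas])
  have "(\<lambda>p. (snd (fst p), snd p)) \<in> H n \<Otimes>\<^sub>M Act \<rightarrow>\<^sub>M S \<Otimes>\<^sub>M Act"
    unfolding H_eq by measurable
  from measurable_compose[OF this measurable_return_prob_space]
  show "(\<lambda>(h, a). return (S \<Otimes>\<^sub>M Act) (snd h, a)) \<in> H n \<Otimes>\<^sub>M Act \<rightarrow>\<^sub>M prob_algebra (S \<Otimes>\<^sub>M Act)"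
    by (simp add: split_beta)
qed

lemma step_meas[measurable]: "step n \<in> Hp n \<rightarrow>\<^sub>M prob_algebra (S \<Otimes>\<^sub>M Act)"
  unfolding step_def[abs_def]
  by (rule measurable_bind_prob_space2[OF start_meas]) (use pol_ret[of n] in \<open>simp add: split_beta' H_eq\<close>)

lemma nn_integral_step:
  assumes w: "w \<in> space (Hp n)" and f[measurable]: "f \<in> borel_measurable (S \<Otimes>\<^sub>M Act)"
  shows "(\<integral>\<^sup>+p. f p \<partial>step n w) = (\<integral>\<^sup>+y. \<integral>\<^sup>+a. f (y, a) \<partial>pol n (w, y) \<partial>start n w)"
proof -
  have st: "sets (start n w) = sets S" "space (start n w) = states \<M>"
    using measurable_space[OF start_meas w] sets_eq_imp_space_eq[of "start n w" S]
    by (auto simp: space_prob_algebra)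
  have "(\<lambda>y. (w, y)) \<in> S \<rightarrow>\<^sub>M H n" unfolding H_eq using w by (rule measurable_Pair1')
  from measurable_compose[OF this pol_ret]
  have k: "(\<lambda>y. pol n (w, y) \<bind> (\<lambda>a. return (S \<Otimes>\<^sub>M Act) (y, a))) \<in> start n w \<rightarrow>\<^sub>M subprob_algebra (S \<Otimes>\<^sub>M Act)"
    by (auto simp: measurable_cong_sets[OF st(1) refl] intro: measurable_prob_algebraD)
  have "(\<integral>\<^sup>+p. f p \<partial>step n w) = (\<integral>\<^sup>+y. \<integral>\<^sup>+p. f p \<partial>(pol n (w, y) \<bind> (\<lambda>a. return (S \<Otimes>\<^sub>M Act) (y, a))) \<partial>start n w)"
    unfolding step_def by (rule nn_integral_bind[OF f k])
  also have "\<dots> = (\<integral>\<^sup>+y. \<integral>\<^sup>+a. f (y, a) \<partial>pol n (w, y) \<partial>start n w)"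
  proof (intro nn_integral_cong)
    fix y assume "y \<in> space (start n w)"
    then have y: "y \<in> states \<M>" using st by simp
    then have "(w, y) \<in> space (H n)" using w by (simp add: H_eq space_pair_measure)
    note pp = pol_prob[OF this]
    have "(\<lambda>a. (y, a)) \<in> Act \<rightarrow>\<^sub>M S \<Otimes>\<^sub>M Act" using y by (intro measurable_Pair1') simp
    then have r: "(\<lambda>a. return (S \<Otimes>\<^sub>M Act) (y, a)) \<in> pol n (w, y) \<rightarrow>\<^sub>M subprob_algebra (S \<Otimes>\<^sub>M Act)"
      using pp by (auto intro: measurable_compose[OF _ return_measurable] simp: measurable_cong_sets[of "pol n (w,y)" Act])
    have "(\<integral>\<^sup>+p. f p \<partial>(pol n (w, y) \<bind> (\<lambda>a. return (S \<Otimes>\<^sub>M Act) (y, a))))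
      = (\<integral>\<^sup>+a. \<integral>\<^sup>+p. f p \<partial>return (S \<Otimes>\<^sub>M Act) (y, a) \<partial>pol n (w, y))"
      by (rule nn_integral_bind[OF f r])
    also have "\<dots> = (\<integral>\<^sup>+a. f (y, a) \<partial>pol n (w, y))"
      using pp y by (intro nn_integral_cong nn_integral_return) (auto simp: space_pair_measure)
    finally show "(\<integral>\<^sup>+p. f p \<partial>(pol n (w, y) \<bind> (\<lambda>a. return (S \<Otimes>\<^sub>M Act) (y, a))))
      = (\<integral>\<^sup>+a. f (y, a) \<partial>pol n (w, y))" .
  qed
  finally show ?thesis .
qed

lemma strategic_exists: "\<exists>P. strategic P"
proof -
  interpret IT: Ionescu_Tulcea step "\<lambda>_. S \<Otimes>\<^sub>M Act"
  proof (rule Ionescu_Tulcea.intro)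
    fix i
    show "step i \<in> Hp i \<rightarrow>\<^sub>M subprob_algebra (S \<Otimes>\<^sub>M Act)"
      by (rule measurable_prob_algebraD[OF step_meas])
    fix w assume "w \<in> space (Hp i)"
    then show "prob_space (step i w)"
      using measurable_space[OF step_meas] by (auto simp: space_prob_algebra)
  qed
  define P where "P = IT.PF.lim"
  \<comment> \<open>That the limit has mass one is read off from its marginal on the empty set of
    coordinates.\<close>
  have "(\<lambda>\<omega>. restrict \<omega> {0..<0}) \<in> IT.PF.lim \<rightarrow>\<^sub>M Hp 0"
    by (simp add: measurable_cong_sets[OF IT.PF.sets_lim refl] measurable_restrict_subset)
  moreover have "prob_space (distr IT.PF.lim (Hp 0) (\<lambda>\<omega>. restrict \<omega> {0..<0}))"
    unfolding IT.distr_lim[OF finite_atLeastLessThan] by (rule IT.PF.prob_space_P) auto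
  ultimately have P: "prob_space P" "sets P = sets (trajectory_algebra \<M>)"
    unfolding P_def trajectory_algebra_def by (auto intro: prob_space_distrD)
  interpret prob_space P by fact
  have spT: "space P = space (trajectory_algebra \<M>)" using P(2) by (rule sets_eq_imp_space_eq)
  have rm: "(\<lambda>\<omega>. restrict \<omega> {0..<n}) \<in> P \<rightarrow>\<^sub>M Hp n" for n
    using restrict_H P(2) by (simp cong: measurable_cong_sets)
  have cm[measurable]: "(\<lambda>\<omega>. \<omega> n) \<in> P \<rightarrow>\<^sub>M S \<Otimes>\<^sub>M Act" for n
    using comp_T P(2) by (simp cong: measurable_cong_sets)
  have dis: "(\<integral>\<^sup>+\<omega>. g (restrict \<omega> {0..<n}, \<omega> n) \<partial>P)
      = (\<integral>\<^sup>+\<omega>. \<integral>\<^sup>+y. \<integral>\<^sup>+a. g (restrict \<omega> {0..<n}, (y, a)) \<partial>pol n (restrict \<omega> {0..<n}, y)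
          \<partial>start n (restrict \<omega> {0..<n}) \<partial>P)"
    if g: "g \<in> borel_measurable (Hp n \<Otimes>\<^sub>M (S \<Otimes>\<^sub>M Act))" for g n
  proof -
    have "(\<integral>\<^sup>+\<omega>. g (restrict \<omega> {0..<n}, \<omega> n) \<partial>P)
      = (\<integral>\<^sup>+\<omega>. \<integral>\<^sup>+p. g (restrict \<omega> {0..<n}, p) \<partial>step n (restrict \<omega> {0..<n}) \<partial>P)"
      using IT.disintegrates_lim[of n] g unfolding disintegrates_def P_def by blast
    also have "\<dots> = (\<integral>\<^sup>+\<omega>. \<integral>\<^sup>+y. \<integral>\<^sup>+a. g (restrict \<omega> {0..<n}, (y, a)) \<partial>pol n (restrict \<omega> {0..<n}, y)
          \<partial>start n (restrict \<omega> {0..<n}) \<partial>P)"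
    proof (rule nn_integral_cong)
      fix \<omega> assume "\<omega> \<in> space P"
      then have w: "restrict \<omega> {0..<n} \<in> space (Hp n)" by (rule measurable_space[OF rm])
      have "(\<lambda>p. g (restrict \<omega> {0..<n}, p)) \<in> borel_measurable (S \<Otimes>\<^sub>M Act)"
        by (rule measurable_compose[OF measurable_Pair1'[OF w] g])
      from nn_integral_step[OF w this]
      show "(\<integral>\<^sup>+p. g (restrict \<omega> {0..<n}, p) \<partial>step n (restrict \<omega> {0..<n}))
        = (\<integral>\<^sup>+y. \<integral>\<^sup>+a. g (restrict \<omega> {0..<n}, (y, a)) \<partial>pol n (restrict \<omega> {0..<n}, y)
          \<partial>start n (restrict \<omega> {0..<n}))" .
    qed
    finally show ?thesis .
  qed
  \<comment> \<open>Integrating out the action leaves the law of a state given the preceding pairs.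
    The transition identity below is this statement at \<open>Suc n\<close>, where
    \<open>start (Suc n)\<close> is \<open>ker\<close> applied to the pair with index
    \<open>n\<close>.\<close>
  have marg: "(\<integral>\<^sup>+\<omega>. g (restrict \<omega> {0..<n}, fst (\<omega> n)) \<partial>P)
      = (\<integral>\<^sup>+\<omega>. \<integral>\<^sup>+y. g (restrict \<omega> {0..<n}, y) \<partial>start n (restrict \<omega> {0..<n}) \<partial>P)"
    if g[measurable]: "g \<in> borel_measurable (Hp n \<Otimes>\<^sub>M S)" for g n
  proof -
    have "(\<integral>\<^sup>+\<omega>. g (restrict \<omega> {0..<n}, fst (\<omega> n)) \<partial>P)
      = (\<integral>\<^sup>+\<omega>. \<integral>\<^sup>+y. \<integral>\<^sup>+a. g (restrict \<omega> {0..<n}, y) \<partial>pol n (restrict \<omega> {0..<n}, y)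
          \<partial>start n (restrict \<omega> {0..<n}) \<partial>P)"
      using dis[of "\<lambda>(w, p). g (w, fst p)" n] by simp
    also have "\<dots> = (\<integral>\<^sup>+\<omega>. \<integral>\<^sup>+y. g (restrict \<omega> {0..<n}, y) \<partial>start n (restrict \<omega> {0..<n}) \<partial>P)"
    proof (intro nn_integral_cong)
      fix \<omega> y assume "\<omega> \<in> space P" and y: "y \<in> space (start n (restrict \<omega> {0..<n}))"
      then have w: "restrict \<omega> {0..<n} \<in> space (Hp n)" by (intro measurable_space[OF rm])
      have "y \<in> states \<M>"
        using measurable_space[OF start_meas w] y sets_eq_imp_space_eq[of "start n (restrict \<omega> {0..<n})" S]
        by (auto simp: space_prob_algebra)
      with w have "(restrict \<omega> {0..<n}, y) \<in> space (H n)" by (simp add: H_eq space_pair_measure)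
      from pol_prob[OF this] show "(\<integral>\<^sup>+a. g (restrict \<omega> {0..<n}, y) \<partial>pol n (restrict \<omega> {0..<n}, y)) = g (restrict \<omega> {0..<n}, y)"
        using prob_space.emeasure_space_1[of "pol n (restrict \<omega> {0..<n}, y)"] by simp
    qed
    finally show ?thesis .
  qed
  have "strategic P"
    unfolding strategic_def
  proof (intro conjI allI P)
    have set0[measurable]: "{x0} \<in> sets S"
      using x0 model by (auto simp: state_algebra_def sets_restrict_space markov_decision_model_def image_iff intro!: bexI[of _ "{x0}"])
    have [measurable]: "(\<lambda>\<omega>. fst (\<omega> 0)) \<in> P \<rightarrow>\<^sub>M S" by (rule measurable_compose[OF cm measurable_fst])
    have "emeasure P {\<omega> \<in> space P. fst (\<omega> 0) = x0} = (\<integral>\<^sup>+\<omega>. indicator {x0} (fst (\<omega> 0)) \<partial>P)"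
    proof -
      have "{\<omega> \<in> space P. fst (\<omega> 0) = x0} = (\<lambda>\<omega>. fst (\<omega> 0)) -` {x0} \<inter> space P" by auto
      also have "\<dots> \<in> sets P" by measurable
      finally have "emeasure P {\<omega> \<in> space P. fst (\<omega> 0) = x0}
        = (\<integral>\<^sup>+\<omega>. indicator {\<omega> \<in> space P. fst (\<omega> 0) = x0} \<omega> \<partial>P)" by simp
      also have "\<dots> = (\<integral>\<^sup>+\<omega>. indicator {x0} (fst (\<omega> 0)) \<partial>P)"
        by (intro nn_integral_cong) (simp add: indicator_def)
      finally show ?thesis .
    qed
    also have "\<dots> = (\<integral>\<^sup>+\<omega>. \<integral>\<^sup>+y. indicator {x0} y \<partial>start 0 (restrict \<omega> {0..<0}) \<partial>P)"
      using marg[of "\<lambda>(w, y). indicator {x0} y" 0] by simp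
    also have "\<dots> = 1"
      using x0 by (simp add: start_def nn_integral_return emeasure_space_1)
    finally show "measure P {\<omega> \<in> space P. fst (\<omega> 0) = x0} = 1" by (simp add: measure_def)
  next
    fix n
    show "disintegrates P (history n) (H n) (\<lambda>\<omega>. snd (\<omega> n)) Act (pol n)"
      unfolding disintegrates_def
    proof
      fix g :: "('x, 'a) history \<times> 'a \<Rightarrow> ennreal"
      assume g: "g \<in> borel_measurable (H n \<Otimes>\<^sub>M Act)"
      then have g'[measurable]: "g \<in> borel_measurable ((Hp n \<Otimes>\<^sub>M S) \<Otimes>\<^sub>M Act)" by (simp add: H_eq)
      have gi: "(\<lambda>h. \<integral>\<^sup>+a. g (h, a) \<partial>pol n h) \<in> borel_measurable (H n)"
        by (rule nn_integral_measurable_subprob_algebra2[OF _ measurable_prob_algebraD[OF pol_meas]])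
          (use g in \<open>auto simp: split_beta\<close>)
      have "(\<integral>\<^sup>+\<omega>. g (history n \<omega>, snd (\<omega> n)) \<partial>P)
        = (\<integral>\<^sup>+\<omega>. \<integral>\<^sup>+y. \<integral>\<^sup>+a. g ((restrict \<omega> {0..<n}, y), a) \<partial>pol n (restrict \<omega> {0..<n}, y)
          \<partial>start n (restrict \<omega> {0..<n}) \<partial>P)"
        using dis[of "\<lambda>(w, p). g ((w, fst p), snd p)" n] by (simp add: history_def)
      also have "\<dots> = (\<integral>\<^sup>+\<omega>. \<integral>\<^sup>+a. g (history n \<omega>, a) \<partial>pol n (history n \<omega>) \<partial>P)"
        using marg[of "\<lambda>h. \<integral>\<^sup>+a. g (h, a) \<partial>pol n h" n] gi by (simp add: history_def H_eq)
      finally show "(\<integral>\<^sup>+\<omega>. g (history n \<omega>, snd (\<omega> n)) \<partial>P)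
        = (\<integral>\<^sup>+\<omega>. \<integral>\<^sup>+a. g (history n \<omega>, a) \<partial>pol n (history n \<omega>) \<partial>P)" .
    qed
    show "disintegrates P (\<lambda>\<omega>. (history n \<omega>, snd (\<omega> n))) (H n \<Otimes>\<^sub>M Act) (\<lambda>\<omega>. fst (\<omega> (Suc n))) S
      (\<lambda>w. ker (snd (fst w), snd w))"
      unfolding disintegrates_def
    proof
      fix g :: "(('x, 'a) history \<times> 'a) \<times> 'x \<Rightarrow> ennreal"
      assume g: "g \<in> borel_measurable ((H n \<Otimes>\<^sub>M Act) \<Otimes>\<^sub>M S)"
      \<comment> \<open>Recovers the history and the action of stage \<open>n\<close> from the first
        \<open>Suc n\<close> pairs, so that \<open>marg\<close> at \<open>Suc n\<close> can be
        used.\<close>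
      define \<Phi> where "\<Phi> w = ((restrict w {0..<n}, fst (w n)), snd (w n))" for w :: "nat \<Rightarrow> 'x \<times> 'a"
      have cS: "(\<lambda>w. w n) \<in> Hp (Suc n) \<rightarrow>\<^sub>M S \<Otimes>\<^sub>M Act"
        by (rule measurable_component_singleton) simp
      have \<Phi>: "\<Phi> \<in> Hp (Suc n) \<rightarrow>\<^sub>M H n \<Otimes>\<^sub>M Act"
        unfolding \<Phi>_def[abs_def] H_eq
        by (intro measurable_Pair measurable_restrict_subset measurable_compose[OF cS measurable_fst]
            measurable_compose[OF cS measurable_snd]) auto
      have \<Phi>r: "\<Phi> (restrict \<omega> {0..<Suc n}) = (history n \<omega>, snd (\<omega> n))" for \<omega>
        by (simp add: \<Phi>_def history_def Int_absorb1)
      have "(\<lambda>p. (\<Phi> (fst p), snd p)) \<in> Hp (Suc n) \<Otimes>\<^sub>M S \<rightarrow>\<^sub>M (H n \<Otimes>\<^sub>M Act) \<Otimes>\<^sub>M S"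
        by (intro measurable_Pair measurable_compose[OF measurable_fst \<Phi>] measurable_snd)
      from measurable_compose[OF this g]
      have "(\<integral>\<^sup>+\<omega>. g (\<Phi> (restrict \<omega> {0..<Suc n}), fst (\<omega> (Suc n))) \<partial>P)
        = (\<integral>\<^sup>+\<omega>. \<integral>\<^sup>+y. g (\<Phi> (restrict \<omega> {0..<Suc n}), y) \<partial>start (Suc n) (restrict \<omega> {0..<Suc n}) \<partial>P)"
        using marg[of "\<lambda>p. g (\<Phi> (fst p), snd p)" "Suc n"] by simp
      then show "(\<integral>\<^sup>+\<omega>. g ((history n \<omega>, snd (\<omega> n)), fst (\<omega> (Suc n))) \<partial>P)
        = (\<integral>\<^sup>+\<omega>. \<integral>\<^sup>+z. g ((history n \<omega>, snd (\<omega> n)), z)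
            \<partial>ker (snd (fst (history n \<omega>, snd (\<omega> n))), snd (history n \<omega>, snd (\<omega> n))) \<partial>P)"
        by (simp add: \<Phi>r start_def history_def)
    qed
  qed
  then show ?thesis ..
qed

text \<open>The law of the history at stage \<open>Suc n\<close> arises from that at stage
  \<open>n\<close> by two kernel integrations: \<open>g1\<close> integrates out the new state and
  \<open>g2\<close> the action before it. Neither depends on the measure.\<close>

lemma strategic_law_unique:
  assumes P: "strategic P" and Q: "strategic Q" and g: "g \<in> borel_measurable (H n)"
  shows "(\<integral>\<^sup>+\<omega>. g (history n \<omega>) \<partial>P) = (\<integral>\<^sup>+\<omega>. g (history n \<omega>) \<partial>Q)"
  using g
proof (induction n arbitrary: g)
  case 0
  have *: "(\<integral>\<^sup>+\<omega>. g (history 0 \<omega>) \<partial>P) = g ((\<lambda>_. undefined), x0)" if "strategic P" for P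
  proof -
    interpret prob_space P using that by (simp add: strategic_def)
    have "AE \<omega> in P. \<omega> \<in> {\<omega> \<in> space P. fst (\<omega> 0) = x0}"
      using that by (intro AE_prob_1) (simp add: strategic_def)
    then have "AE \<omega> in P. fst (\<omega> 0) = x0" by eventually_elim simp
    then have "(\<integral>\<^sup>+\<omega>. g (history 0 \<omega>) \<partial>P) = (\<integral>\<^sup>+\<omega>. g ((\<lambda>_. undefined), x0) \<partial>P)"
      by (intro nn_integral_cong_AE) (auto simp: history_def restrict_def)
    then show ?thesis by (simp add: emeasure_space_1)
  qed
  show ?case by (simp add: *[OF P] *[OF Q])
next
  case (Suc n)
  note g = Suc.prems
  \<comment> \<open>Glues a history, an action and a next state into the longer history: the former
    current state and the action become the pair with index \<open>n\<close>.\<close>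
  define \<Phi> where "\<Phi> w = ((fst (fst (fst w)))(n := (snd (fst (fst w)), snd (fst w))), snd w)"
    for w :: "(('x, 'a) history \<times> 'a) \<times> 'x"
  have upd: "(\<lambda>w. (fst (fst (fst w)))(n := (snd (fst (fst w)), snd (fst w))))
      \<in> (H n \<Otimes>\<^sub>M Act) \<Otimes>\<^sub>M S \<rightarrow>\<^sub>M Hp (Suc n)"
    by (rule measurable_fun_upd[where J="{0..<n}"]) (auto simp: H_eq)
  have "\<Phi> \<in> (H n \<Otimes>\<^sub>M Act) \<Otimes>\<^sub>M S \<rightarrow>\<^sub>M H (Suc n)"
    unfolding \<Phi>_def[abs_def] H_eq[of "Suc n"] by (intro measurable_Pair upd measurable_snd)
  from measurable_compose[OF this g]
  have g\<Phi>: "(\<lambda>w. g (\<Phi> w)) \<in> borel_measurable ((H n \<Otimes>\<^sub>M Act) \<Otimes>\<^sub>M S)" .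
  define g1 where "g1 w = (\<integral>\<^sup>+y. g (\<Phi> (w, y)) \<partial>ker (snd (fst w), snd w))" for w
  have g1: "g1 \<in> borel_measurable (H n \<Otimes>\<^sub>M Act)"
    unfolding g1_def[abs_def]
    by (rule nn_integral_measurable_subprob_algebra2[OF _ measurable_prob_algebraD[OF ker_hist]])
      (use g\<Phi> in \<open>simp add: split_beta\<close>)
  define g2 where "g2 h = (\<integral>\<^sup>+a. g1 (h, a) \<partial>pol n h)" for h
  have g2: "g2 \<in> borel_measurable (H n)"
    unfolding g2_def[abs_def]
    by (rule nn_integral_measurable_subprob_algebra2[OF _ measurable_prob_algebraD[OF pol_meas]])
      (use g1 in \<open>simp add: split_beta\<close>)
  have \<Phi>h: "\<Phi> ((history n \<omega>, snd (\<omega> n)), fst (\<omega> (Suc n))) = history (Suc n) \<omega>" for \<omega>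
    by (auto simp: \<Phi>_def history_def fun_eq_iff restrict_def)
  have *: "(\<integral>\<^sup>+\<omega>. g (history (Suc n) \<omega>) \<partial>P) = (\<integral>\<^sup>+\<omega>. g2 (history n \<omega>) \<partial>P)" if "strategic P" for P
  proof -
    have "(\<integral>\<^sup>+\<omega>. g (history (Suc n) \<omega>) \<partial>P) = (\<integral>\<^sup>+\<omega>. g (\<Phi> ((history n \<omega>, snd (\<omega> n)), fst (\<omega> (Suc n)))) \<partial>P)"
      by (simp add: \<Phi>h)
    also have "\<dots> = (\<integral>\<^sup>+\<omega>. g1 (history n \<omega>, snd (\<omega> n)) \<partial>P)"
      using that[unfolded strategic_def disintegrates_def, THEN conjunct2, THEN conjunct2, THEN conjunct2, THEN conjunct2, rule_format, OF g\<Phi>]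
      unfolding g1_def .
    also have "\<dots> = (\<integral>\<^sup>+\<omega>. g2 (history n \<omega>) \<partial>P)"
      using that g1 unfolding strategic_def disintegrates_def g2_def by blast
    finally show ?thesis .
  qed
  show ?case by (simp add: *[OF P] *[OF Q] Suc.IH[OF g2])
qed

text \<open>Cylinder sets determine a finite measure on the infinite product, and a cylinder over
  finitely many indices is an event of a sufficiently long history.\<close>

lemma strategic_unique:
  assumes P: "strategic P" and Q: "strategic Q"
  shows "P = Q"
proof (rule measure_eqI_PiM_infinite)
  show "sets P = sets (Pi\<^sub>M UNIV (\<lambda>_. S \<Otimes>\<^sub>M Act))" "sets Q = sets (Pi\<^sub>M UNIV (\<lambda>_. S \<Otimes>\<^sub>M Act))"
    using P Q by (auto simp: strategic_def trajectory_algebra_def)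
  show "finite_measure P" using P by (auto simp: strategic_def prob_space_def)
  fix A J assume J: "finite J" and A: "\<And>i::nat. i \<in> J \<Longrightarrow> A i \<in> sets (S \<Otimes>\<^sub>M Act)"
  obtain n where n: "J \<subseteq> {0..<n}"
    using finite_nat_set_iff_bounded[of J] J by (auto simp: subset_eq)
  let ?E = "prod_emb UNIV (\<lambda>_. S \<Otimes>\<^sub>M Act) J (Pi\<^sub>E J A)"
  let ?F = "prod_emb {0..<n} (\<lambda>_. S \<Otimes>\<^sub>M Act) J (Pi\<^sub>E J A)"
  have F: "?F \<in> sets (Hp n)" by (rule sets_PiM_I[OF J n]) (use A in auto)
  have E: "?E \<in> sets (Pi\<^sub>M UNIV (\<lambda>_. S \<Otimes>\<^sub>M Act))" by (rule sets_PiM_I[OF J]) (use A in auto)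
  have *: "emeasure P ?E = (\<integral>\<^sup>+\<omega>. indicator ?F (fst (history n \<omega>)) \<partial>P)" if "strategic P" for P
  proof -
    have s: "sets P = sets (Pi\<^sub>M UNIV (\<lambda>_. S \<Otimes>\<^sub>M Act))"
      using that by (auto simp: strategic_def trajectory_algebra_def)
    have "\<omega> \<in> ?E \<longleftrightarrow> fst (history n \<omega>) \<in> ?F" if "\<omega> \<in> space P" for \<omega>
      using that n by (auto simp: sets_eq_imp_space_eq[OF s] prod_emb_def history_def space_PiM PiE_iff Int_absorb1)
    then have "(\<integral>\<^sup>+\<omega>. indicator ?E \<omega> \<partial>P) = (\<integral>\<^sup>+\<omega>. indicator ?F (fst (history n \<omega>)) \<partial>P)"
      by (intro nn_integral_cong) (simp add: indicator_def)
    then show ?thesis using E s by simp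
  qed
  have "(\<lambda>h. indicator ?F (fst h) :: ennreal) \<in> borel_measurable (H n)"
    unfolding H_eq by (rule measurable_compose[OF measurable_fst]) (use F in simp)
  from strategic_law_unique[OF P Q this]
  show "emeasure P ?E = emeasure Q ?E" by (simp add: *[OF P] *[OF Q])
qed

text \<open>Existence and uniqueness discharge the definite description; later arguments see the
  measure only through \<open>strategic\<close>.\<close>

lemma strategic_strategic_measure: "strategic (strategic_measure \<M> \<pi> x0)"
proof -
  obtain P where P: "strategic P" using strategic_exists by blast
  have "strategic_measure \<M> \<pi> x0 = P"
    unfolding strategic_measure_def is_strategic_iff
    using P strategic_unique by (intro the_equality) auto
  with P show ?thesis by simp
qed

end

section \<open>The discounted cost of a policy\<close>

context mdp_policy
begin

abbreviation "\<P> \<equiv> strategic_measure \<M> \<pi> x0"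

lemma prob_P: "prob_space \<P>" and sets_P: "sets \<P> = sets (trajectory_algebra \<M>)"
  using strategic_strategic_measure by (auto simp: strategic_def)

lemma component_P[measurable]: "(\<lambda>\<omega>. \<omega> n) \<in> \<P> \<rightarrow>\<^sub>M S \<Otimes>\<^sub>M Act"
  using comp_T sets_P by (simp cong: measurable_cong_sets)

lemma state_P[measurable]: "(\<lambda>\<omega>. fst (\<omega> n)) \<in> \<P> \<rightarrow>\<^sub>M S"
  by (rule measurable_compose[OF component_P measurable_fst])

lemma AE_history: "AE \<omega> in \<P>. history n \<omega> \<in> histories \<M> n"
  using AE_histories[OF prob_P sets_P] strategic_strategic_measure by (simp add: strategic_def)

lemma AE_K: "AE \<omega> in \<P>. \<omega> n \<in> K"
  using AE_step[OF prob_P sets_P _ AE_history] strategic_strategic_measure by (simp add: strategic_def)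

lemma AE_initial: "AE \<omega> in \<P>. fst (\<omega> 0) = x0"
proof -
  interpret prob_space \<P> by (rule prob_P)
  have "AE \<omega> in \<P>. \<omega> \<in> {\<omega> \<in> space \<P>. fst (\<omega> 0) = x0}"
    using strategic_strategic_measure by (intro AE_prob_1) (simp add: strategic_def)
  then show ?thesis by eventually_elim simp
qed

text \<open>The transition identity for a test function of the next state alone, where the history
  drops out; \<open>ker\<close> gives way to \<open>trans\<close> because almost every pair is
  admissible.\<close>

lemma nn_integral_next:
  assumes g: "g \<in> borel_measurable S"
  shows "(\<integral>\<^sup>+\<omega>. g (fst (\<omega> (Suc n))) \<partial>\<P>) = (\<integral>\<^sup>+\<omega>. \<integral>\<^sup>+y. g y \<partial>trans \<M> (\<omega> n) \<partial>\<P>)"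
proof -
  have "(\<lambda>w. g (snd w)) \<in> borel_measurable ((H n \<Otimes>\<^sub>M Act) \<Otimes>\<^sub>M S)"
    by (rule measurable_compose[OF measurable_snd g])
  from strategic_strategic_measure[unfolded strategic_def disintegrates_def, THEN conjunct2,
      THEN conjunct2, THEN conjunct2, THEN conjunct2, rule_format, OF this]
  have "(\<integral>\<^sup>+\<omega>. g (fst (\<omega> (Suc n))) \<partial>\<P>) = (\<integral>\<^sup>+\<omega>. \<integral>\<^sup>+y. g y \<partial>ker (\<omega> n) \<partial>\<P>)"
    by (simp add: history_def)
  also have "\<dots> = (\<integral>\<^sup>+\<omega>. \<integral>\<^sup>+y. g y \<partial>trans \<M> (\<omega> n) \<partial>\<P>)"
    using AE_K[of n] by (intro nn_integral_cong_AE) (auto simp: ker_def)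
  finally show ?thesis .
qed

end

context mdp_model
begin

lemma adm_sets:
  assumes "x \<in> states \<M>"
  shows "adm \<M> x \<in> sets Act"
proof -
  have "(\<lambda>a. (x, a)) \<in> Act \<rightarrow>\<^sub>M S \<Otimes>\<^sub>M Act" using assms by (intro measurable_Pair1') simp
  from measurable_sets[OF this K_sets]
  have "{a \<in> actions \<M>. (x, a) \<in> K} \<in> sets Act" by (simp add: vimage_def Int_def conj_commute)
  also have "{a \<in> actions \<M>. (x, a) \<in> K} = adm \<M> x"
    using assms K_sub by (auto simp: adm_pairs_def)
  finally show ?thesis .
qed

lemma selector_K: "f \<in> selectors \<M> \<Longrightarrow> x \<in> states \<M> \<Longrightarrow> (x, f x) \<in> K"
  by (simp add: selectors_def adm_pairs_def)

lemma stationary_policy: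
  assumes f: "f \<in> selectors \<M>"
  shows "stationary \<M> f \<in> policies \<M>"
  unfolding policies_def mem_Collect_eq
proof (intro allI conjI ballI)
  fix n
  have fm: "f \<in> S \<rightarrow>\<^sub>M Act" using f by (simp add: selectors_def)
  have "snd \<in> H n \<rightarrow>\<^sub>M S" unfolding history_algebra_def by (rule measurable_snd)
  from measurable_compose[OF measurable_compose[OF this fm] measurable_return_prob_space]
  show "stationary \<M> f n \<in> restrict_space (H n) (histories \<M> n) \<rightarrow>\<^sub>M prob_algebra Act"
    unfolding stationary_def by (rule measurable_restrict_space1)
  fix h assume "h \<in> histories \<M> n"
  then have s: "snd h \<in> states \<M>" by (auto simp: histories_def)
  then have "f (snd h) \<in> adm \<M> (snd h)" using f by (simp add: selectors_def)
  then show "measure (stationary \<M> f n h) (adm \<M> (snd h)) = 1"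
    using adm_sets[OF s] by (simp add: stationary_def measure_return)
qed

end

section \<open>Weighted bounds and expected growth along a trajectory\<close>

locale mdp_growth = mdp_model \<M>
  for \<M> :: "('x::polish_space, 'a::polish_space) mdp" +
  fixes \<alpha> M \<beta> :: real and W :: "'x \<Rightarrow> real"
  assumes \<alpha>: "0 < \<alpha>" and growth: "growth_conditions \<M> \<alpha> M \<beta> W"
    and W_meas[measurable]: "W \<in> borel_measurable S"
begin

abbreviation "\<gamma> \<equiv> \<beta> * \<alpha>"

lemma M_pos: "M > 0" and \<beta>: "\<beta> > 1" and \<gamma>1: "\<gamma> < 1" and \<gamma>0: "\<gamma> > 0"
  using growth \<alpha> by (auto simp: growth_conditions_def)

lemma W1: "x \<in> states \<M> \<Longrightarrow> W x \<ge> 1"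
  using growth by (auto simp: growth_conditions_def)

lemma cost_bound: "k \<in> K \<Longrightarrow> \<bar>cost \<M> k\<bar> \<le> M * W (fst k)"
  and W_integrable: "k \<in> K \<Longrightarrow> integrable (trans \<M> k) W"
  and QW: "k \<in> K \<Longrightarrow> trans_op \<M> W k \<le> \<beta> * W (fst k)"
  using growth by (auto simp: growth_conditions_def)

text \<open>Balls of the weighted space with the radius as a parameter: the invariance arguments
  below have to carry the constant itself, beyond its finiteness.\<close>

definition W_bounded :: "real \<Rightarrow> ('x \<Rightarrow> real) \<Rightarrow> bool" where
  "W_bounded c u \<longleftrightarrow> u \<in> borel_measurable S \<and> (\<forall>x\<in>states \<M>. \<bar>u x\<bar> \<le> c * W x)"

lemma W_boundedD: "W_bounded c u \<Longrightarrow> x \<in> states \<M> \<Longrightarrow> \<bar>u x\<bar> \<le> c * W x"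
  and W_bounded_meas[measurable_dest]: "W_bounded c u \<Longrightarrow> u \<in> borel_measurable S"
  by (auto simp: W_bounded_def)

lemma W_bounded_integrable:
  assumes u: "W_bounded c u" and k: "k \<in> K"
  shows "integrable (trans \<M> k) u"
proof (rule Bochner_Integration.integrable_bound)
  show "integrable (trans \<M> k) (\<lambda>y. c * W y)" using W_integrable[OF k] by simp
  show "u \<in> borel_measurable (trans \<M> k)"
    using W_bounded_meas[OF u] by (simp add: measurable_cong_sets[OF trans_sets[OF k] refl])
  show "AE y in trans \<M> k. norm (u y) \<le> norm (c * W y)"
    using W_boundedD[OF u] by (intro AE_I2) (force simp: trans_space[OF k])
qed

lemma trans_op_mono:
  assumes "W_bounded c u" "W_bounded d v" "k \<in> K" "\<And>x. x \<in> states \<M> \<Longrightarrow> u x \<le> v x"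
  shows "trans_op \<M> u k \<le> trans_op \<M> v k"
  unfolding trans_op_def
  by (intro integral_mono W_bounded_integrable[OF assms(1,3)] W_bounded_integrable[OF assms(2,3)])
    (use assms(4) trans_space[OF assms(3)] in auto)

lemma W_bounded_W: "W_bounded c (\<lambda>x. c' * W x)" if "\<bar>c'\<bar> \<le> c"
  unfolding W_bounded_def
proof (intro conjI ballI)
  fix x assume "x \<in> states \<M>"
  then show "\<bar>c' * W x\<bar> \<le> c * W x" using W1[of x] that by (simp add: abs_mult mult_right_mono)
qed simp

lemma trans_op_shift:
  assumes "W_bounded c u" "k \<in> K"
  shows "trans_op \<M> (\<lambda>x. u x + d * W x) k = trans_op \<M> u k + d * trans_op \<M> W k"
  unfolding trans_op_def
  using W_bounded_integrable[OF assms] W_integrable[OF assms(2)] by simp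

lemma trans_op_bound:
  assumes u: "W_bounded c u" and k: "k \<in> K" and c: "c \<ge> 0"
  shows "\<bar>trans_op \<M> u k\<bar> \<le> c * \<beta> * W (fst k)"
proof -
  have "trans_op \<M> u k \<le> trans_op \<M> (\<lambda>x. c * W x) k"
    using W_boundedD[OF u] c by (intro trans_op_mono[OF u W_bounded_W k]) (auto simp: abs_le_iff)
  moreover have "trans_op \<M> (\<lambda>x. (- c) * W x) k \<le> trans_op \<M> u k"
    using W_boundedD[OF u] c by (intro trans_op_mono[OF W_bounded_W u k]) (force simp: abs_le_iff)+
  moreover have "c * trans_op \<M> W k \<le> c * (\<beta> * W (fst k))"
    using QW[OF k] c by (rule mult_left_mono)
  ultimately show ?thesis by (simp add: trans_op_def abs_le_iff)
qed

lemma trans_op_K_meas: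
  assumes "W_bounded c u"
  shows "trans_op \<M> u \<in> borel_measurable (restrict_space (S \<Otimes>\<^sub>M Act) K)"
  unfolding trans_op_def[abs_def]
  by (rule measurable_compose[OF measurable_prob_algebraD[OF trans_K] integral_measurable_subprob_algebra])
    (rule W_bounded_meas[OF assms])

text \<open>The residual of the optimality equation at a single action: nonnegative for
  subsolutions, and zero at the actions of \<open>f\<close> for a fixed point of
  \<open>policy_op\<close>. The value 0 off \<open>K\<close> keeps it measurable on the whole
  product.\<close>

definition gap :: "('x \<Rightarrow> real) \<Rightarrow> 'x \<times> 'a \<Rightarrow> real" where
  "gap u k = (if k \<in> K then cost \<M> k + \<alpha> * trans_op \<M> u k - u (fst k) else 0)"

lemma gap_meas:
  assumes u: "W_bounded c u"
  shows "gap u \<in> borel_measurable (S \<Otimes>\<^sub>M Act)"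
  unfolding gap_def[abs_def]
proof (subst measurable_If_restrict_space_iff, simp, intro conjI)
  have [measurable]: "(\<lambda>k. u (fst k)) \<in> borel_measurable (restrict_space (S \<Otimes>\<^sub>M Act) K)"
    by (intro measurable_restrict_space1 measurable_compose[OF measurable_fst W_bounded_meas[OF u]])
  note cost_K[measurable] trans_op_K_meas[OF u, measurable]
  show "(\<lambda>k. cost \<M> k + \<alpha> * trans_op \<M> u k - u (fst k)) \<in> borel_measurable (restrict_space (S \<Otimes>\<^sub>M Act) {k. k \<in> K})"
    by simp
qed simp

end

locale mdp_growth_policy = mdp_growth \<M> \<alpha> M \<beta> W + mdp_policy \<M> \<pi> x0
  for \<M> :: "('x::polish_space, 'a::polish_space) mdp" and \<alpha> M \<beta> W \<pi> x0
begin

interpretation P: prob_space \<P> by (rule prob_P)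

text \<open>Every transition costs one factor \<beta> by \<open>QW\<close>. The extended integral
  comes first because integrability of \<open>W\<close> along the trajectory is deduced from this
  bound.\<close>

lemma nn_integral_W: "(\<integral>\<^sup>+\<omega>. ennreal (W (fst (\<omega> n))) \<partial>\<P>) \<le> ennreal (\<beta> ^ n * W x0)"
proof (induction n)
  case 0
  have "(\<integral>\<^sup>+\<omega>. ennreal (W (fst (\<omega> 0))) \<partial>\<P>) = (\<integral>\<^sup>+\<omega>. ennreal (W x0) \<partial>\<P>)"
    using AE_initial by (intro nn_integral_cong_AE) auto
  then show ?case by (simp add: P.emeasure_space_1)
next
  case (Suc n)
  have "(\<integral>\<^sup>+\<omega>. ennreal (W (fst (\<omega> (Suc n)))) \<partial>\<P>) = (\<integral>\<^sup>+\<omega>. \<integral>\<^sup>+y. ennreal (W y) \<partial>trans \<M> (\<omega> n) \<partial>\<P>)"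
    by (rule nn_integral_next) measurable
  also have "\<dots> \<le> (\<integral>\<^sup>+\<omega>. ennreal \<beta> * ennreal (W (fst (\<omega> n))) \<partial>\<P>)"
  proof (rule nn_integral_mono_AE)
    show "AE \<omega> in \<P>. (\<integral>\<^sup>+y. ennreal (W y) \<partial>trans \<M> (\<omega> n)) \<le> ennreal \<beta> * ennreal (W (fst (\<omega> n)))"
      using AE_K[of n]
    proof eventually_elim
      case (elim \<omega>)
      have "AE y in trans \<M> (\<omega> n). 0 \<le> W y"
        using W1 by (intro AE_I2) (force simp: trans_space[OF elim])
      then have "(\<integral>\<^sup>+y. ennreal (W y) \<partial>trans \<M> (\<omega> n)) = ennreal (trans_op \<M> W (\<omega> n))"
        unfolding trans_op_def by (rule nn_integral_eq_integral[OF W_integrable[OF elim]])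
      also have "\<dots> \<le> ennreal (\<beta> * W (fst (\<omega> n)))" using QW[OF elim] by (rule ennreal_leI)
      finally show ?case using \<beta> by (simp add: ennreal_mult')
    qed
  qed
  also have "\<dots> = ennreal \<beta> * (\<integral>\<^sup>+\<omega>. ennreal (W (fst (\<omega> n))) \<partial>\<P>)"
    by (rule nn_integral_cmult) measurable
  also have "\<dots> \<le> ennreal \<beta> * ennreal (\<beta> ^ n * W x0)"
    using Suc by (rule mult_left_mono) simp
  finally show ?case using \<beta> by (simp add: ennreal_mult' mult.assoc)
qed

lemma states_P: "\<omega> \<in> space \<P> \<Longrightarrow> fst (\<omega> n) \<in> states \<M>"
  using measurable_space[OF state_P] by simp

lemma integrable_W: "integrable \<P> (\<lambda>\<omega>. W (fst (\<omega> n)))"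
  and integral_W: "(\<integral>\<omega>. W (fst (\<omega> n)) \<partial>\<P>) \<le> \<beta> ^ n * W x0"
proof -
  have nn: "AE \<omega> in \<P>. 0 \<le> W (fst (\<omega> n))"
    using W1 states_P by (intro AE_I2) (meson order_trans zero_le_one)
  have "(\<integral>\<^sup>+\<omega>. ennreal (W (fst (\<omega> n))) \<partial>\<P>) < \<infinity>"
    using nn_integral_W[of n] by (simp add: order_le_less_trans)
  then show i: "integrable \<P> (\<lambda>\<omega>. W (fst (\<omega> n)))"
    using nn by (intro integrableI_nonneg) auto
  show "(\<integral>\<omega>. W (fst (\<omega> n)) \<partial>\<P>) \<le> \<beta> ^ n * W x0"
    using nn_integral_W[of n] W1[OF x0] \<beta> unfolding nn_integral_eq_integral[OF i nn]
    by (subst (asm) ennreal_le_iff) auto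
qed

lemma integrable_bounded:
  assumes "g \<in> borel_measurable (S \<Otimes>\<^sub>M Act)" "\<And>k. k \<in> space (S \<Otimes>\<^sub>M Act) \<Longrightarrow> \<bar>g k\<bar> \<le> c * W (fst k)"
  shows "integrable \<P> (\<lambda>\<omega>. g (\<omega> n))" "(\<integral>\<omega>. \<bar>g (\<omega> n)\<bar> \<partial>\<P>) \<le> c * (\<integral>\<omega>. W (fst (\<omega> n)) \<partial>\<P>)"
proof -
  show i: "integrable \<P> (\<lambda>\<omega>. g (\<omega> n))"
  proof (rule Bochner_Integration.integrable_bound)
    show "integrable \<P> (\<lambda>\<omega>. c * W (fst (\<omega> n)))" using integrable_W by simp
    show "(\<lambda>\<omega>. g (\<omega> n)) \<in> borel_measurable \<P>" by (rule measurable_compose[OF component_P assms(1)])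
    show "AE \<omega> in \<P>. norm (g (\<omega> n)) \<le> norm (c * W (fst (\<omega> n)))"
    proof (rule AE_I2)
      fix \<omega> assume "\<omega> \<in> space \<P>"
      from assms(2)[OF measurable_space[OF component_P this, of n]]
      show "norm (g (\<omega> n)) \<le> norm (c * W (fst (\<omega> n)))" unfolding real_norm_def by linarith
    qed
  qed
  have "(\<integral>\<omega>. \<bar>g (\<omega> n)\<bar> \<partial>\<P>) \<le> (\<integral>\<omega>. c * W (fst (\<omega> n)) \<partial>\<P>)"
    by (intro integral_mono integrable_abs i integrable_mult_right integrable_W assms(2)
        measurable_space[OF component_P])
  then show "(\<integral>\<omega>. \<bar>g (\<omega> n)\<bar> \<partial>\<P>) \<le> c * (\<integral>\<omega>. W (fst (\<omega> n)) \<partial>\<P>)" by simp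
qed

lemma integrable_u:
  assumes u: "W_bounded c u"
  shows "integrable \<P> (\<lambda>\<omega>. u (fst (\<omega> n)))" "\<bar>\<integral>\<omega>. u (fst (\<omega> n)) \<partial>\<P>\<bar> \<le> c * (\<integral>\<omega>. W (fst (\<omega> n)) \<partial>\<P>)"
proof -
  have 1: "(\<lambda>k. u (fst k)) \<in> borel_measurable (S \<Otimes>\<^sub>M Act)"
    by (rule measurable_compose[OF measurable_fst W_bounded_meas[OF u]])
  have 2: "\<bar>u (fst k)\<bar> \<le> c * W (fst k)" if "k \<in> space (S \<Otimes>\<^sub>M Act)" for k
    using W_boundedD[OF u] that by (auto simp: space_pair_measure)
  note * = integrable_bounded[of "\<lambda>k. u (fst k)", OF 1 2]
  show "integrable \<P> (\<lambda>\<omega>. u (fst (\<omega> n)))" by (rule *(1))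
  show "\<bar>\<integral>\<omega>. u (fst (\<omega> n)) \<partial>\<P>\<bar> \<le> c * (\<integral>\<omega>. W (fst (\<omega> n)) \<partial>\<P>)"
    using *(2)[of n] integral_abs_bound[of \<P> "\<lambda>\<omega>. u (fst (\<omega> n))"] by linarith
qed

lemma trans_op_P:
  assumes u: "W_bounded c u" and c: "c \<ge> 0"
  shows "(\<lambda>k. if k \<in> K then trans_op \<M> u k else 0) \<in> borel_measurable (S \<Otimes>\<^sub>M Act)"
    and "integrable \<P> (\<lambda>\<omega>. if \<omega> n \<in> K then trans_op \<M> u (\<omega> n) else 0)"
proof -
  show m: "(\<lambda>k. if k \<in> K then trans_op \<M> u k else 0) \<in> borel_measurable (S \<Otimes>\<^sub>M Act)"
    by (subst measurable_If_restrict_space_iff) (use trans_op_K_meas[OF u] in auto)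
  show "integrable \<P> (\<lambda>\<omega>. if \<omega> n \<in> K then trans_op \<M> u (\<omega> n) else 0)"
  proof (rule integrable_bounded(1)[where c="c * \<beta>", OF m])
    fix k :: "'x \<times> 'a" assume "k \<in> space (S \<Otimes>\<^sub>M Act)"
    then have "W (fst k) \<ge> 1" using W1 by (auto simp: space_pair_measure)
    moreover have "c * \<beta> \<ge> 0" using c \<beta> by simp
    ultimately have "0 \<le> (c * \<beta>) * W (fst k)" by (intro mult_nonneg_nonneg[of "c * \<beta>"]) linarith+
    then show "\<bar>if k \<in> K then trans_op \<M> u k else 0\<bar> \<le> c * \<beta> * W (fst k)"
      using trans_op_bound[OF u _ c] by simp
  qed
qed

lemma integral_next_nonneg:
  assumes u: "W_bounded c u" and c: "c \<ge> 0" and nn: "\<And>x. x \<in> states \<M> \<Longrightarrow> 0 \<le> u x"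
  shows "(\<integral>\<omega>. u (fst (\<omega> (Suc n))) \<partial>\<P>) = (\<integral>\<omega>. (if \<omega> n \<in> K then trans_op \<M> u (\<omega> n) else 0) \<partial>\<P>)"
proof -
  have tnn: "0 \<le> trans_op \<M> u k" if "k \<in> K" for k
    unfolding trans_op_def using nn trans_space[OF that] by (intro integral_nonneg_AE AE_I2) auto
  have "ennreal (\<integral>\<omega>. u (fst (\<omega> (Suc n))) \<partial>\<P>) = (\<integral>\<^sup>+\<omega>. ennreal (u (fst (\<omega> (Suc n)))) \<partial>\<P>)"
    using nn states_P by (intro nn_integral_eq_integral[symmetric] integrable_u(1)[OF u] AE_I2) auto
  also have "\<dots> = (\<integral>\<^sup>+\<omega>. \<integral>\<^sup>+y. ennreal (u y) \<partial>trans \<M> (\<omega> n) \<partial>\<P>)"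
    using W_bounded_meas[OF u] by (intro nn_integral_next) simp
  also have "\<dots> = (\<integral>\<^sup>+\<omega>. ennreal (if \<omega> n \<in> K then trans_op \<M> u (\<omega> n) else 0) \<partial>\<P>)"
  proof (rule nn_integral_cong_AE)
    show "AE \<omega> in \<P>. (\<integral>\<^sup>+y. ennreal (u y) \<partial>trans \<M> (\<omega> n)) = ennreal (if \<omega> n \<in> K then trans_op \<M> u (\<omega> n) else 0)"
      using AE_K[of n]
    proof eventually_elim
      case (elim \<omega>)
      have "AE y in trans \<M> (\<omega> n). 0 \<le> u y" using nn by (intro AE_I2) (auto simp: trans_space[OF elim])
      from nn_integral_eq_integral[OF W_bounded_integrable[OF u elim] this] show ?case
        using elim by (simp add: trans_op_def)
    qed
  qed
  also have "\<dots> = ennreal (\<integral>\<omega>. (if \<omega> n \<in> K then trans_op \<M> u (\<omega> n) else 0) \<partial>\<P>)"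
    using tnn by (intro nn_integral_eq_integral trans_op_P(2)[OF u c] AE_I2) auto
  finally show ?thesis
    using nn states_P tnn by (subst (asm) ennreal_inj) (auto intro!: integral_nonneg_AE AE_I2)
qed

text \<open>The extended integral handles nonnegative functions only. Adding \<open>c * W\<close>
  makes \<open>u\<close> nonnegative, and the added term can be subtracted again since it satisfies
  the same identity with finite integrals.\<close>

lemma integral_next:
  assumes u: "W_bounded c u" and c: "c \<ge> 0"
  shows "(\<integral>\<omega>. u (fst (\<omega> (Suc n))) \<partial>\<P>) = (\<integral>\<omega>. (if \<omega> n \<in> K then trans_op \<M> u (\<omega> n) else 0) \<partial>\<P>)"
proof -
  have W: "W_bounded c (\<lambda>x. c * W x)" by (rule W_bounded_W) (use c in simp)
  have unn: "0 \<le> u x + c * W x" if "x \<in> states \<M>" for x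
    using W_boundedD[OF u that] by linarith
  have s: "W_bounded (2 * c) (\<lambda>x. u x + c * W x)"
    unfolding W_bounded_def
  proof (intro conjI ballI)
    show "(\<lambda>x. u x + c * W x) \<in> borel_measurable S" using W_bounded_meas[OF u] by simp
    show "\<bar>u x + c * W x\<bar> \<le> 2 * c * W x" if "x \<in> states \<M>" for x
      using W_boundedD[OF u that] by (simp add: abs_le_iff)
  qed
  note Wi = trans_op_P(2)[OF W c, of n] and ui = trans_op_P(2)[OF u c, of n]
  have "(\<integral>\<omega>. u (fst (\<omega> (Suc n))) + c * W (fst (\<omega> (Suc n))) \<partial>\<P>)
      = (\<integral>\<omega>. (if \<omega> n \<in> K then trans_op \<M> (\<lambda>x. u x + c * W x) (\<omega> n) else 0) \<partial>\<P>)"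
    by (rule integral_next_nonneg[OF s]) (use c unn in auto)
  also have "\<dots> = (\<integral>\<omega>. (if \<omega> n \<in> K then trans_op \<M> u (\<omega> n) else 0)
      + (if \<omega> n \<in> K then trans_op \<M> (\<lambda>x. c * W x) (\<omega> n) else 0) \<partial>\<P>)"
    using trans_op_shift[OF u, of _ c] by (intro Bochner_Integration.integral_cong) (auto simp: trans_op_def)
  also have "\<dots> = (\<integral>\<omega>. (if \<omega> n \<in> K then trans_op \<M> u (\<omega> n) else 0) \<partial>\<P>)
      + (\<integral>\<omega>. (if \<omega> n \<in> K then trans_op \<M> (\<lambda>x. c * W x) (\<omega> n) else 0) \<partial>\<P>)"
    using ui Wi by simp
  also have "(\<integral>\<omega>. (if \<omega> n \<in> K then trans_op \<M> (\<lambda>x. c * W x) (\<omega> n) else 0) \<partial>\<P>) = (\<integral>\<omega>. c * W (fst (\<omega> (Suc n))) \<partial>\<P>)"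
    by (rule integral_next_nonneg[OF W c, symmetric]) (use c in \<open>auto intro!: mult_nonneg_nonneg order_trans[OF zero_le_one W1]\<close>)
  finally show ?thesis
    using integrable_u(1)[OF u, of "Suc n"] integrable_u(1)[OF W, of "Suc n"] by simp
qed

lemma cost0_bound: "k \<in> space (S \<Otimes>\<^sub>M Act) \<Longrightarrow> \<bar>cost0 k\<bar> \<le> M * W (fst k)"
  using cost_bound[of k] M_pos W1[of "fst k"] by (auto simp: cost0_def space_pair_measure)

lemma integral_gap:
  assumes u: "W_bounded c u" and c: "c \<ge> 0"
  shows "(\<integral>\<omega>. gap u (\<omega> n) \<partial>\<P>)
    = (\<integral>\<omega>. cost0 (\<omega> n) \<partial>\<P>) + \<alpha> * (\<integral>\<omega>. u (fst (\<omega> (Suc n))) \<partial>\<P>) - (\<integral>\<omega>. u (fst (\<omega> n)) \<partial>\<P>)"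
proof -
  note ic = integrable_bounded(1)[OF cost0_meas cost0_bound, of n]
    and it = trans_op_P(2)[OF u c, of n] and iu = integrable_u(1)[OF u, of n]
  have "(\<integral>\<omega>. gap u (\<omega> n) \<partial>\<P>)
    = (\<integral>\<omega>. cost0 (\<omega> n) + \<alpha> * (if \<omega> n \<in> K then trans_op \<M> u (\<omega> n) else 0) - u (fst (\<omega> n)) \<partial>\<P>)"
  proof (rule integral_cong_AE)
    show "(\<lambda>\<omega>. gap u (\<omega> n)) \<in> borel_measurable \<P>"
      by (rule measurable_compose[OF component_P gap_meas[OF u]])
    show "(\<lambda>\<omega>. cost0 (\<omega> n) + \<alpha> * (if \<omega> n \<in> K then trans_op \<M> u (\<omega> n) else 0) - u (fst (\<omega> n))) \<in> borel_measurable \<P>"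
      using ic it iu by (intro borel_measurable_diff borel_measurable_add borel_measurable_times) auto
    show "AE \<omega> in \<P>. gap u (\<omega> n) = cost0 (\<omega> n) + \<alpha> * (if \<omega> n \<in> K then trans_op \<M> u (\<omega> n) else 0) - u (fst (\<omega> n))"
      using AE_K[of n] by eventually_elim (simp add: gap_def cost0_def)
  qed
  also have "\<dots> = (\<integral>\<omega>. cost0 (\<omega> n) \<partial>\<P>) + \<alpha> * (\<integral>\<omega>. (if \<omega> n \<in> K then trans_op \<M> u (\<omega> n) else 0) \<partial>\<P>) - (\<integral>\<omega>. u (fst (\<omega> n)) \<partial>\<P>)"
    using ic it iu by simp
  finally show ?thesis by (simp add: integral_next[OF u c])
qed

text \<open>Sum and expectation are exchanged by absolute convergence: the expected absolute cost at
  stage \<open>k\<close> is at most \<open>M * \<beta> ^ k * W x0\<close>, so discounting leaves a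
  geometric series of ratio \<gamma>.\<close>

lemma policy_value_sums: "(\<lambda>k. \<alpha> ^ k * (\<integral>\<omega>. cost0 (\<omega> k) \<partial>\<P>)) sums policy_value \<M> \<alpha> \<pi> x0"
proof -
  define F where "F k \<omega> = \<alpha> ^ k * cost0 (\<omega> k)" for k \<omega>
  have iF: "integrable \<P> (F k)" for k
    unfolding F_def using integrable_bounded(1)[OF cost0_meas cost0_bound, of k] by simp
  have nF: "(\<integral>\<omega>. norm (F k \<omega>) \<partial>\<P>) \<le> M * W x0 * \<gamma> ^ k" for k
  proof -
    have "(\<integral>\<omega>. norm (F k \<omega>) \<partial>\<P>) = \<alpha> ^ k * (\<integral>\<omega>. \<bar>cost0 (\<omega> k)\<bar> \<partial>\<P>)"
      using \<alpha> by (simp add: F_def abs_mult power_abs)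
    also have "\<dots> \<le> \<alpha> ^ k * (M * (\<beta> ^ k * W x0))"
      using integrable_bounded(2)[OF cost0_meas cost0_bound, of k] integral_W[of k] M_pos \<alpha>
      by (intro mult_left_mono) (auto intro: order_trans mult_left_mono)
    finally show ?thesis by (simp add: power_mult_distrib ac_simps)
  qed
  have sg: "summable (\<lambda>k. M * W x0 * \<gamma> ^ k)"
    using \<gamma>0 \<gamma>1 by (intro summable_mult summable_geometric) simp
  have s1: "summable (\<lambda>k. \<integral>\<omega>. norm (F k \<omega>) \<partial>\<P>)"
    by (rule summable_comparison_test'[OF sg, of 0]) (use nF in auto)
  have "(\<integral>\<^sup>+\<omega>. (\<Sum>k. ennreal (norm (F k \<omega>))) \<partial>\<P>) = (\<Sum>k. \<integral>\<^sup>+\<omega>. ennreal (norm (F k \<omega>)) \<partial>\<P>)"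
    using iF by (intro nn_integral_suminf) auto
  also have "\<dots> = (\<Sum>k. ennreal (\<integral>\<omega>. norm (F k \<omega>) \<partial>\<P>))"
    using iF by (intro suminf_cong nn_integral_eq_integral integrable_norm) auto
  also have "\<dots> = ennreal (\<Sum>k. \<integral>\<omega>. norm (F k \<omega>) \<partial>\<P>)"
    using s1 by (intro suminf_ennreal2) auto
  finally have "(\<integral>\<^sup>+\<omega>. (\<Sum>k. ennreal (norm (F k \<omega>))) \<partial>\<P>) \<noteq> \<infinity>" by simp
  then have "AE \<omega> in \<P>. (\<Sum>k. ennreal (norm (F k \<omega>))) \<noteq> \<infinity>"
    using iF by (intro nn_integral_PInf_AE) auto
  then have s2: "AE \<omega> in \<P>. summable (\<lambda>k. norm (F k \<omega>))"
    by eventually_elim (auto intro: summable_suminf_not_top)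
  have "(\<lambda>k. \<integral>\<omega>. F k \<omega> \<partial>\<P>) sums (\<integral>\<omega>. (\<Sum>k. F k \<omega>) \<partial>\<P>)"
    by (rule sums_integral[OF iF s2 s1])
  then show ?thesis by (simp add: F_def cost0_def policy_value_def)
qed

text \<open>The series telescopes: the \<open>k\<close>-th term is
  \<open>\<alpha>\<^sup>k E C(x\<^sub>k, a\<^sub>k) + \<alpha>\<^sup>k\<^sup>+\<^sup>1 E u(x\<^sub>k\<^sub>+\<^sub>1) - \<alpha>\<^sup>k E u(x\<^sub>k)\<close>.\<close>

lemma gap_sums:
  assumes u: "W_bounded c u" and c: "c \<ge> 0"
  shows "(\<lambda>k. \<alpha> ^ k * (\<integral>\<omega>. gap u (\<omega> k) \<partial>\<P>)) sums (policy_value \<M> \<alpha> \<pi> x0 - u x0)"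
proof -
  let ?e = "\<lambda>n. \<alpha> ^ n * (\<integral>\<omega>. u (fst (\<omega> n)) \<partial>\<P>)"
  have "(\<integral>\<omega>. u (fst (\<omega> 0)) \<partial>\<P>) = (\<integral>\<omega>. u x0 \<partial>\<P>)"
    using AE_initial integrable_u(1)[OF u, of 0] by (intro integral_cong_AE) auto
  then have e0: "?e 0 = u x0" by (simp add: P.prob_space)
  \<comment> \<open>The boundary term of the telescope: the growth of \<open>W\<close> along the
    trajectory bounds it by a multiple of \<open>\<gamma> ^ n\<close>.\<close>
  have "?e \<longlonglongrightarrow> 0"
  proof (rule Lim_null_comparison)
    show "\<forall>\<^sub>F n in sequentially. norm (?e n) \<le> c * W x0 * \<gamma> ^ n"
    proof (intro always_eventually allI)
      fix n
      have "norm (?e n) = \<alpha> ^ n * \<bar>\<integral>\<omega>. u (fst (\<omega> n)) \<partial>\<P>\<bar>" using \<alpha> by (simp add: abs_mult power_abs)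
      also have "\<dots> \<le> \<alpha> ^ n * (c * (\<beta> ^ n * W x0))"
        using integrable_u(2)[OF u, of n] integral_W[of n] c \<alpha>
        by (intro mult_left_mono) (auto intro: order_trans mult_left_mono)
      finally show "norm (?e n) \<le> c * W x0 * \<gamma> ^ n" by (simp add: power_mult_distrib ac_simps)
    qed
    show "(\<lambda>n. c * W x0 * \<gamma> ^ n) \<longlonglongrightarrow> 0"
      using \<gamma>0 \<gamma>1 by (intro tendsto_mult_right_zero LIMSEQ_power_zero) simp
  qed
  from telescope_sums[OF this] have "(\<lambda>k. ?e (Suc k) - ?e k) sums (0 - ?e 0)" .
  from sums_add[OF policy_value_sums this]
  show ?thesis
    by (simp add: e0[simplified] integral_gap[OF u c] algebra_simps)
qed

lemma policy_value_ge:
  assumes u: "W_bounded c u" and c: "c \<ge> 0"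
    and sub: "\<And>k. k \<in> K \<Longrightarrow> u (fst k) \<le> cost \<M> k + \<alpha> * trans_op \<M> u k"
  shows "u x0 \<le> policy_value \<M> \<alpha> \<pi> x0"
proof -
  have "0 \<le> \<alpha> ^ k * (\<integral>\<omega>. gap u (\<omega> k) \<partial>\<P>)" for k
    using sub \<alpha> by (intro mult_nonneg_nonneg integral_nonneg_AE AE_I2) (auto simp: gap_def)
  from sums_le[OF this sums_zero gap_sums[OF u c]] show ?thesis by simp
qed

end

text \<open>The conditional law of the action is the Dirac measure at \<open>f\<close> of the
  current state, where the residual of a fixed point vanishes. Testing with the absolute residual
  shows that it is zero almost surely, so every term of \<open>gap_sums\<close> is zero.\<close>

lemma (in mdp_growth) policy_value_stationary:
  assumes f: "f \<in> selectors \<M>" and x: "x \<in> states \<M>"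
    and u: "W_bounded c u" and c: "c \<ge> 0"
    and fp: "\<And>y. y \<in> states \<M> \<Longrightarrow> policy_op \<M> \<alpha> f u y = u y"
  shows "policy_value \<M> \<alpha> (stationary \<M> f) x = u x"
proof -
  interpret mdp_growth_policy \<M> \<alpha> M \<beta> W "stationary \<M> f" x
    by unfold_locales (use stationary_policy[OF f] x in auto)
  have "(\<integral>\<omega>. gap u (\<omega> n) \<partial>\<P>) = 0" for n
  proof -
    define g :: "('x, 'a) history \<times> 'a \<Rightarrow> ennreal" where "g = (\<lambda>w. ennreal \<bar>gap u (snd (fst w), snd w)\<bar>)"
    have "(\<lambda>w. (snd (fst w), snd w)) \<in> H n \<Otimes>\<^sub>M Act \<rightarrow>\<^sub>M S \<Otimes>\<^sub>M Act"
      unfolding H_eq by measurable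
    from measurable_compose[OF this gap_meas[OF u]]
    have g: "g \<in> borel_measurable (H n \<Otimes>\<^sub>M Act)" unfolding g_def by measurable
    from strategic_strategic_measure[unfolded strategic_def disintegrates_def, THEN conjunct2,
        THEN conjunct2, THEN conjunct2, THEN conjunct1, rule_format, OF g]
    have "(\<integral>\<^sup>+\<omega>. ennreal \<bar>gap u (\<omega> n)\<bar> \<partial>\<P>) = (\<integral>\<^sup>+\<omega>. \<integral>\<^sup>+a. g (history n \<omega>, a) \<partial>pol n (history n \<omega>) \<partial>\<P>)"
      by (simp add: g_def history_def)
    also have "\<dots> = (\<integral>\<^sup>+\<omega>. 0 \<partial>\<P>)"
    proof (rule nn_integral_cong_AE)
      show "AE \<omega> in \<P>. (\<integral>\<^sup>+a. g (history n \<omega>, a) \<partial>pol n (history n \<omega>)) = 0"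
        using AE_history[of n]
      proof eventually_elim
        case (elim \<omega>)
        let ?h = "history n \<omega>"
        have s: "snd ?h \<in> states \<M>" using elim by (auto simp: histories_def)
        have hs: "?h \<in> space (H n)" using elim sets.sets_into_space[OF histories_sets] by auto
        have k: "(snd ?h, f (snd ?h)) \<in> K" by (rule selector_K[OF f s])
        have "(\<lambda>a. g (?h, a)) \<in> borel_measurable Act"
          by (rule measurable_compose[OF measurable_Pair1'[OF hs] g])
        then have "(\<integral>\<^sup>+a. g (?h, a) \<partial>pol n ?h) = g (?h, f (snd ?h))"
          using k K_sub elim unfolding pol_def by (simp add: stationary_def) (subst nn_integral_return, auto)
        then show ?case
          using fp[OF s] k by (simp add: g_def gap_def policy_op_def)
      qed
    qed
    finally have z: "(\<integral>\<^sup>+\<omega>. ennreal \<bar>gap u (\<omega> n)\<bar> \<partial>\<P>) = 0" by simp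
    have "(\<lambda>\<omega>. ennreal \<bar>gap u (\<omega> n)\<bar>) \<in> borel_measurable \<P>"
      using measurable_compose[OF component_P gap_meas[OF u], of n] by measurable
    from nn_integral_0_iff_AE[OF this] z have "AE \<omega> in \<P>. ennreal \<bar>gap u (\<omega> n)\<bar> = 0" by simp
    then show ?thesis by (intro integral_eq_zero_AE) auto
  qed
  then have "(\<lambda>k. 0) sums (policy_value \<M> \<alpha> (stationary \<M> f) x - u x)"
    using gap_sums[OF u c] by simp
  from sums_unique[OF this] show ?thesis by simp
qed

section \<open>Lower semicontinuous functions\<close>

lemma lower_semicontinuous_on_iff:
  "lower_semicontinuous_on X g \<longleftrightarrow>
    (\<forall>x\<in>X. \<forall>c<g x. \<exists>U. open U \<and> x \<in> U \<and> (\<forall>z\<in>X \<inter> U. c < g z))"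
proof
  assume L: "lower_semicontinuous_on X g"
  show "\<forall>x\<in>X. \<forall>c<g x. \<exists>U. open U \<and> x \<in> U \<and> (\<forall>z\<in>X \<inter> U. c < g z)"
  proof (intro ballI allI impI)
    fix x c assume x: "x \<in> X" "c < g x"
    from L obtain U where U: "open U" "{z \<in> X. c < g z} = X \<inter> U"
      by (auto simp: lower_semicontinuous_on_def openin_open)
    have "x \<in> {z \<in> X. c < g z}" using x by simp
    then have "x \<in> U" unfolding U by simp
    moreover have "\<forall>z\<in>X \<inter> U. c < g z" unfolding U(2)[symmetric] by simp
    ultimately show "\<exists>U. open U \<and> x \<in> U \<and> (\<forall>z\<in>X \<inter> U. c < g z)" using U(1) by blast
  qed
next
  assume R: "\<forall>x\<in>X. \<forall>c<g x. \<exists>U. open U \<and> x \<in> U \<and> (\<forall>z\<in>X \<inter> U. c < g z)"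
  show "lower_semicontinuous_on X g"
    unfolding lower_semicontinuous_on_def
  proof (intro allI)
    fix c
    show "openin (top_of_set X) {z \<in> X. c < g z}"
    proof (subst openin_subopen, intro ballI)
      fix x assume "x \<in> {z \<in> X. c < g z}"
      with R obtain U where "open U" "x \<in> U" "\<forall>z\<in>X \<inter> U. c < g z" "x \<in> X" by blast
      then show "\<exists>T. openin (top_of_set X) T \<and> x \<in> T \<and> T \<subseteq> {z \<in> X. c < g z}"
        by (intro exI[of _ "X \<inter> U"]) auto
    qed
  qed
qed

lemma lower_semicontinuous_onD:
  assumes "lower_semicontinuous_on X g" "x \<in> X" "c < g x"
  shows "\<exists>U. open U \<and> x \<in> U \<and> (\<forall>z\<in>X \<inter> U. c < g z)"
  using assms unfolding lower_semicontinuous_on_iff by blast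

lemma lower_semicontinuous_on_continuous:
  assumes "continuous_on X g"
  shows "lower_semicontinuous_on X g"
  unfolding lower_semicontinuous_on_def
proof
  fix c
  have "openin (top_of_set X) (X \<inter> g -` {c<..})"
    using assms by (rule continuous_openin_preimage_gen) simp
  then show "openin (top_of_set X) {z \<in> X. c < g z}" by (simp add: vimage_def Int_def)
qed

lemma lower_semicontinuous_on_add:
  assumes f: "lower_semicontinuous_on X f" and g: "lower_semicontinuous_on X g"
  shows "lower_semicontinuous_on X (\<lambda>x. f x + g x)"
  unfolding lower_semicontinuous_on_iff
proof (intro ballI allI impI)
  fix x c assume x: "x \<in> X" and c: "c < f x + g x"
  define d where "d = (f x + g x - c) / 2"
  have d: "d > 0" using c by (simp add: d_def)
  obtain U where U: "open U" "x \<in> U" "\<forall>z\<in>X \<inter> U. f x - d < f z"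
    using lower_semicontinuous_onD[OF f x, of "f x - d"] d by auto
  obtain V where V: "open V" "x \<in> V" "\<forall>z\<in>X \<inter> V. g x - d < g z"
    using lower_semicontinuous_onD[OF g x, of "g x - d"] d by auto
  have "c < f z + g z" if "z \<in> X \<inter> (U \<inter> V)" for z
  proof -
    have "f x - d < f z" "g x - d < g z" using U(3) V(3) that by auto
    moreover have "2 * d = f x + g x - c" by (simp add: d_def)
    ultimately show ?thesis by linarith
  qed
  then show "\<exists>U. open U \<and> x \<in> U \<and> (\<forall>z\<in>X \<inter> U. c < f z + g z)"
    using U V by (intro exI[of _ "U \<inter> V"]) auto
qed

lemma lower_semicontinuous_on_cmult:
  assumes f: "lower_semicontinuous_on X f" and a: "(a::real) > 0"
  shows "lower_semicontinuous_on X (\<lambda>x. a * f x)"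
proof -
  have "{z \<in> X. c < a * f z} = {z \<in> X. c / a < f z}" for c
    using a by (auto simp: field_simps)
  then show ?thesis using f by (simp add: lower_semicontinuous_on_def)
qed

text \<open>The index set may be uncountable; together with
  \<open>lower_semicontinuous_on_measurable\<close> this keeps the Knaster--Tarski supremum
  measurable.\<close>

lemma lower_semicontinuous_on_SUP:
  assumes lsc: "\<And>i. i \<in> I \<Longrightarrow> lower_semicontinuous_on X (g i)"
    and I: "I \<noteq> {}" and bdd: "\<And>x. x \<in> X \<Longrightarrow> bdd_above ((\<lambda>i. g i x) ` I)"
  shows "lower_semicontinuous_on X (\<lambda>x. SUP i\<in>I. g i x)"
  unfolding lower_semicontinuous_on_iff
proof (intro ballI allI impI)
  fix x c assume x: "x \<in> X" and "c < (SUP i\<in>I. g i x)"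
  then obtain i where i: "i \<in> I" "c < g i x"
    using less_cSUP_iff[OF I bdd[OF x]] by auto
  obtain U where U: "open U" "x \<in> U" "\<forall>z\<in>X \<inter> U. c < g i z"
    using lower_semicontinuous_onD[OF lsc[OF i(1)] x i(2)] by auto
  have "c < (SUP i\<in>I. g i z)" if "z \<in> X" "z \<in> U" for z
    using U(3)[rule_format, of z] that cSUP_upper[OF i(1) bdd[OF that(1)]] by simp
  then show "\<exists>U. open U \<and> x \<in> U \<and> (\<forall>z\<in>X \<inter> U. c < (SUP i\<in>I. g i z))"
    using U by blast
qed

lemma lower_semicontinuous_on_measurable:
  assumes "lower_semicontinuous_on X g" "X \<in> sets borel"
  shows "g \<in> borel_measurable (restrict_space borel X)"
  unfolding borel_measurable_iff_greater
proof
  fix c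
  obtain U where "open U" "{z \<in> X. c < g z} = X \<inter> U"
    using assms(1) by (auto simp: lower_semicontinuous_on_def openin_open)
  then show "{w \<in> space (restrict_space borel X). c < g w} \<in> sets (restrict_space borel X)"
    by (auto simp: space_restrict_space sets_restrict_space)
qed

section \<open>The envelope as the greatest lower semicontinuous minorant\<close>

context
  fixes \<M> :: "('x::metric_space, 'a) mdp" and u b :: "'x \<Rightarrow> real"
  assumes b: "lower_semicontinuous_on (states \<M>) b" and bu: "\<forall>x\<in>states \<M>. b x \<le> u x"
begin

text \<open>The envelope before its conversion to a real number. On the states the minorant
  \<open>b\<close> keeps it away from -\<infinity> and \<open>u\<close> keeps it away from
  \<infinity>, so the conversion loses nothing there.\<close>

private definition env where
  "env x = (SUP r\<in>{0<..}. INF y\<in>ball x r \<inter> states \<M>. ereal (u y))"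

private lemma minorant_le_env:
  assumes g: "lower_semicontinuous_on (states \<M>) g" and gu: "\<And>x. x \<in> states \<M> \<Longrightarrow> g x \<le> u x"
    and x: "x \<in> states \<M>"
  shows "ereal (g x) \<le> env x"
proof (rule dense_le)
  fix t assume t: "t < ereal (g x)"
  show "t \<le> env x"
  proof (cases t)
    case (real c)
    obtain U where U: "open U" "x \<in> U" "\<forall>z\<in>states \<M> \<inter> U. c < g z"
      using lower_semicontinuous_onD[OF g x, of c] t real by auto
    then obtain r where r: "r > 0" "ball x r \<subseteq> U" by (meson openE)
    have "ereal c \<le> (INF y\<in>ball x r \<inter> states \<M>. ereal (u y))"
    proof (rule INF_greatest)
      fix y assume "y \<in> ball x r \<inter> states \<M>"
      then have "c < g y" "g y \<le> u y" using U(3) r gu by auto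
      then show "ereal c \<le> ereal (u y)" by simp
    qed
    also have "\<dots> \<le> env x" unfolding env_def by (rule SUP_upper) (use r in simp)
    finally show ?thesis by (simp add: real)
  qed (use t in auto)
qed

private lemma env_le: "x \<in> states \<M> \<Longrightarrow> env x \<le> ereal (u x)"
  unfolding env_def by (rule SUP_least) (rule INF_lower, auto)

private lemma env_real: "x \<in> states \<M> \<Longrightarrow> ereal (lsc_envelope \<M> u x) = env x"
  using minorant_le_env[OF b bspec[OF bu], of x] env_le[of x]
  by (cases "env x") (auto simp: lsc_envelope_def env_def[symmetric])

lemma lsc_envelope_le: "x \<in> states \<M> \<Longrightarrow> lsc_envelope \<M> u x \<le> u x"
  using env_le[of x] env_real[of x] by (metis ereal_less_eq(3))

lemma lsc_envelope_greatest:
  assumes "lower_semicontinuous_on (states \<M>) g" "\<And>x. x \<in> states \<M> \<Longrightarrow> g x \<le> u x" "x \<in> states \<M>"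
  shows "g x \<le> lsc_envelope \<M> u x"
  using minorant_le_env[OF assms] env_real[OF assms(3)] by (metis ereal_less_eq(3))

lemma lower_semicontinuous_on_lsc_envelope: "lower_semicontinuous_on (states \<M>) (lsc_envelope \<M> u)"
  unfolding lower_semicontinuous_on_iff
proof (intro ballI allI impI)
  fix x c assume x: "x \<in> states \<M>" and "c < lsc_envelope \<M> u x"
  then have "ereal c < env x" using env_real[OF x] by (metis ereal_less_eq(3) not_less)
  then obtain r where r: "r > 0" "ereal c < (INF y\<in>ball x r \<inter> states \<M>. ereal (u y))"
    unfolding env_def less_SUP_iff by auto
  \<comment> \<open>Balls of half the radius around points of the half ball stay inside the ball
    around \<open>x\<close>, on which the infimum exceeds \<open>c\<close>.\<close>
  have "c < lsc_envelope \<M> u z" if "z \<in> states \<M> \<inter> ball x (r / 2)" for z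
  proof -
    have "ball z (r / 2) \<subseteq> ball x r"
    proof
      fix y assume "y \<in> ball z (r / 2)"
      then have "dist z y < r / 2" "dist x z < r / 2" using that by auto
      then show "y \<in> ball x r" using dist_triangle[of x y z] by simp
    qed
    then have "(INF y\<in>ball x r \<inter> states \<M>. ereal (u y)) \<le> (INF y\<in>ball z (r / 2) \<inter> states \<M>. ereal (u y))"
      by (intro INF_superset_mono) auto
    also have "\<dots> \<le> env z" unfolding env_def by (rule SUP_upper) (use r in simp)
    finally have "ereal c < env z" using r(2) by simp
    moreover have "env z = ereal (lsc_envelope \<M> u z)" using env_real that by simp
    ultimately show ?thesis by simp
  qed
  then show "\<exists>U. open U \<and> x \<in> U \<and> (\<forall>z\<in>states \<M> \<inter> U. c < lsc_envelope \<M> u z)"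
    using r(1) by (intro exI[of _ "ball x (r / 2)"]) auto
qed

end

section \<open>Weak continuity and the Bellman operator\<close>

text \<open>The Pasch--Hausdorff regularization, that is, the infimal convolution of \<phi> with
  \<open>k\<close> times the distance, truncated at \<open>k\<close>. The convolution makes it
  Lipschitz and the truncation bounds it from above, which for nonnegative \<phi> brings it within
  reach of weak continuity.\<close>

definition lipschitz_minorant :: "'x::metric_space set \<Rightarrow> ('x \<Rightarrow> real) \<Rightarrow> nat \<Rightarrow> 'x \<Rightarrow> real" where
  "lipschitz_minorant X \<phi> k x = min (real k) (INF y\<in>X. \<phi> y + real k * dist x y)"

context
  fixes X :: "'x::metric_space set" and \<phi> :: "'x \<Rightarrow> real"
  assumes nn: "\<And>x. x \<in> X \<Longrightarrow> 0 \<le> \<phi> x"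
begin

private lemma bdd: "bdd_below ((\<lambda>y. \<phi> y + real k * dist x y) ` X)"
  using nn by (intro bdd_belowI[of _ 0]) auto

lemma lipschitz_minorant_nonneg: "x \<in> X \<Longrightarrow> 0 \<le> lipschitz_minorant X \<phi> k x"
  unfolding lipschitz_minorant_def using nn by (auto intro!: cINF_greatest)

lemma lipschitz_minorant_le:
  assumes "x \<in> X"
  shows "lipschitz_minorant X \<phi> k x \<le> \<phi> x"
  using cINF_lower[OF bdd[of k x] assms] by (simp add: lipschitz_minorant_def min_def)

lemma lipschitz_minorant_bounded: "bounded (lipschitz_minorant X \<phi> k ` X)"
proof -
  have "\<bar>lipschitz_minorant X \<phi> k x\<bar> \<le> real k" if "x \<in> X" for x
    using lipschitz_minorant_nonneg[OF that, of k] by (simp add: lipschitz_minorant_def)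
  then show ?thesis unfolding bounded_iff by (intro exI[of _ "real k"]) auto
qed

lemma lipschitz_minorant_continuous: "continuous_on X (lipschitz_minorant X \<phi> k)"
proof -
  have le: "(INF y\<in>X. \<phi> y + real k * dist x y) - real k * dist x z \<le> (INF y\<in>X. \<phi> y + real k * dist z y)"
    if "x \<in> X" "z \<in> X" for x z
  proof (rule cINF_greatest)
    fix y assume y: "y \<in> X"
    have "(INF y\<in>X. \<phi> y + real k * dist x y) \<le> \<phi> y + real k * dist x y"
      by (rule cINF_lower[OF bdd y])
    also have "\<dots> \<le> \<phi> y + real k * (dist x z + dist z y)"
      by (intro add_left_mono mult_left_mono dist_triangle) simp
    finally show "(INF y\<in>X. \<phi> y + real k * dist x y) - real k * dist x z \<le> \<phi> y + real k * dist z y"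
      by (simp add: algebra_simps)
  qed (use that in auto)
  have "(real k)-lipschitz_on X (\<lambda>x. INF y\<in>X. \<phi> y + real k * dist x y)"
  proof (rule lipschitz_onI)
    fix x z assume "x \<in> X" "z \<in> X"
    then show "dist (INF y\<in>X. \<phi> y + real k * dist x y) (INF y\<in>X. \<phi> y + real k * dist z y) \<le> real k * dist x z"
      using le[of x z] le[of z x] by (simp add: dist_real_def abs_le_iff dist_commute)
  qed simp
  from lipschitz_on_continuous_on[OF this] show ?thesis
    unfolding lipschitz_minorant_def by (intro continuous_on_min continuous_on_const)
qed

lemma lipschitz_minorant_tendsto:
  assumes lsc: "lower_semicontinuous_on X \<phi>" and x: "x \<in> X"
  shows "(\<lambda>k. lipschitz_minorant X \<phi> k x) \<longlonglongrightarrow> \<phi> x"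
proof (rule order_tendstoI)
  fix t assume "t < \<phi> x"
  then obtain c where c: "t < c" "c < \<phi> x" using dense by blast
  obtain U where U: "open U" "x \<in> U" "\<forall>z\<in>X \<inter> U. c < \<phi> z"
    using lower_semicontinuous_onD[OF lsc x c(2)] by auto
  then obtain r where r: "r > 0" "ball x r \<subseteq> U" by (meson openE)
  \<comment> \<open>Two demands on \<open>k\<close>: the truncation level must reach
    \<open>c\<close>, and beyond distance \<open>r\<close> the penalty \<open>k * r\<close> alone
    must reach \<open>c\<close>. Closer to \<open>x\<close> the function itself exceeds
    \<open>c\<close>.\<close>
  obtain N where N: "real N \<ge> max c (c / r)" using real_arch_simple by blast
  have "t < lipschitz_minorant X \<phi> k x" if "k \<ge> N" for k
  proof -
    have k: "real k \<ge> c" "real k * r \<ge> c"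
      using N that r(1) by (auto simp: field_simps intro: order_trans)
    have "c \<le> (INF y\<in>X. \<phi> y + real k * dist x y)"
    proof (rule cINF_greatest)
      fix y assume y: "y \<in> X"
      show "c \<le> \<phi> y + real k * dist x y"
      proof (cases "dist x y < r")
        case True
        then have "c < \<phi> y" using U(3) y r(2) by auto
        then show ?thesis by (simp add: add_increasing2)
      next
        case False
        then have "real k * r \<le> real k * dist x y" by (intro mult_left_mono) auto
        then show ?thesis using k(2) nn[OF y] by linarith
      qed
    qed (use x in auto)
    then show ?thesis using c(1) k(1) by (simp add: lipschitz_minorant_def)
  qed
  then show "\<forall>\<^sub>F k in sequentially. t < lipschitz_minorant X \<phi> k x"
    unfolding eventually_sequentially by blast
next
  fix t assume "\<phi> x < t"
  then show "\<forall>\<^sub>F k in sequentially. lipschitz_minorant X \<phi> k x < t"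
    using lipschitz_minorant_le[OF x] by (intro always_eventually allI) (rule le_less_trans)
qed

end

section \<open>Semicontinuity of the transition and Bellman operators\<close>

locale mdp_compact = mdp_growth \<M> \<alpha> M \<beta> W
  for \<M> :: "('x::polish_space, 'a::polish_space) mdp" and \<alpha> M \<beta> W +
  assumes compact_cont: "compactness_continuity_conditions \<M> W"
    and adm_ne: "\<And>x. x \<in> states \<M> \<Longrightarrow> adm \<M> x \<noteq> {}"
begin

abbreviation "X \<equiv> states \<M>"

lemma usc_adm: "upper_semicontinuous_multifunction X (actions \<M>) (adm \<M>)"
  and adm_compact: "x \<in> X \<Longrightarrow> compact (adm \<M> x)"
  and cost_lsc: "lower_semicontinuous_on K (cost \<M>)"
  and weakly_continuous: "continuous_on X g \<Longrightarrow> bounded (g ` X) \<Longrightarrow> continuous_on K (trans_op \<M> g)"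
  and W_cont: "continuous_on X W" and QW_cont: "continuous_on K (trans_op \<M> W)"
  using compact_cont by (auto simp: compactness_continuity_conditions_def)

lemma W_bounded_lscI:
  assumes "lower_semicontinuous_on X u" "\<And>x. x \<in> X \<Longrightarrow> \<bar>u x\<bar> \<le> c * W x"
  shows "W_bounded c u"
  using lower_semicontinuous_on_measurable[OF assms(1)] assms(2) model
  by (auto simp: W_bounded_def state_algebra_def markov_decision_model_def)

lemma W_pos: "x \<in> X \<Longrightarrow> 0 < W x"
  using W1 by force

text \<open>Weak continuity speaks of bounded continuous functions only. The shift by
  \<open>c * W\<close> makes \<open>u\<close> nonnegative, hence a limit of Lipschitz minorants,
  whose integrals are continuous in the pair; the shift can be undone since
  \<open>trans_op \<M> W\<close> is continuous. This gives continuous functions below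
  \<open>trans_op \<M> u\<close> that come arbitrarily close to it at \<open>k0\<close>.\<close>

lemma trans_op_lsc:
  assumes u: "W_bounded c u" and c: "c \<ge> 0" and lsc: "lower_semicontinuous_on X u"
  shows "lower_semicontinuous_on K (trans_op \<M> u)"
  unfolding lower_semicontinuous_on_iff
proof (intro ballI allI impI)
  fix k0 t assume k0: "k0 \<in> K" and t: "t < trans_op \<M> u k0"
  define \<phi> where "\<phi> x = u x + c * W x" for x
  have nn: "0 \<le> \<phi> x" if "x \<in> X" for x
    using W_boundedD[OF u that] by (simp add: \<phi>_def abs_le_iff)
  have \<phi>lsc: "lower_semicontinuous_on X \<phi>"
    unfolding \<phi>_def
    by (intro lower_semicontinuous_on_add lsc lower_semicontinuous_on_continuous continuous_intros W_cont)
  have \<phi>: "W_bounded (2 * c) \<phi>"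
  proof (rule W_bounded_lscI[OF \<phi>lsc])
    fix x assume "x \<in> X"
    from W_boundedD[OF u this] nn[OF this] show "\<bar>\<phi> x\<bar> \<le> 2 * c * W x" by (simp add: \<phi>_def abs_le_iff)
  qed
  define m where "m = lipschitz_minorant X \<phi>"
  have mc: "continuous_on X (m j)" for j
    unfolding m_def by (rule lipschitz_minorant_continuous[OF nn])
  have m0: "0 \<le> m j x" and m1: "m j x \<le> \<phi> x" if "x \<in> X" for j x
    using lipschitz_minorant_nonneg[of X \<phi>, OF nn that] lipschitz_minorant_le[of X \<phi>, OF nn that]
    by (auto simp: m_def)
  have mW: "W_bounded (2 * c) (m j)" for j
  proof (rule W_bounded_lscI[OF lower_semicontinuous_on_continuous[OF mc]])
    fix x assume x: "x \<in> X"
    show "\<bar>m j x\<bar> \<le> 2 * c * W x"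
      using m0[OF x, of j] m1[OF x, of j] W_boundedD[OF \<phi> x] by linarith
  qed
  have "(\<lambda>j. trans_op \<M> (m j) k0) \<longlonglongrightarrow> trans_op \<M> \<phi> k0"
    unfolding trans_op_def
  proof (rule integral_dominated_convergence)
    show "\<phi> \<in> borel_measurable (trans \<M> k0)" "m j \<in> borel_measurable (trans \<M> k0)" for j
      using W_bounded_integrable[OF \<phi> k0] W_bounded_integrable[OF mW k0] by auto
    show "integrable (trans \<M> k0) \<phi>" by (rule W_bounded_integrable[OF \<phi> k0])
    show "AE x in trans \<M> k0. (\<lambda>j. m j x) \<longlonglongrightarrow> \<phi> x"
      unfolding m_def using lipschitz_minorant_tendsto[OF nn \<phi>lsc]
      by (intro AE_I2) (simp add: trans_space[OF k0])
    show "AE x in trans \<M> k0. norm (m j x) \<le> \<phi> x" for j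
      using m0 m1 by (intro AE_I2) (simp add: trans_space[OF k0])
  qed
  moreover have sh: "trans_op \<M> \<phi> k = trans_op \<M> u k + c * trans_op \<M> W k" if "k \<in> K" for k
    unfolding \<phi>_def by (rule trans_op_shift[OF u that])
  ultimately have "\<forall>\<^sub>F j in sequentially. t + c * trans_op \<M> W k0 < trans_op \<M> (m j) k0"
    using t k0 by (intro order_tendstoD) auto
  then obtain j where j: "t < trans_op \<M> (m j) k0 - c * trans_op \<M> W k0"
    by (auto simp: eventually_sequentially less_diff_eq)
  have "continuous_on K (\<lambda>k. trans_op \<M> (m j) k - c * trans_op \<M> W k)"
    unfolding m_def
    by (intro continuous_intros weakly_continuous QW_cont lipschitz_minorant_continuous[OF nn]
        lipschitz_minorant_bounded[OF nn])
  from lower_semicontinuous_onD[OF lower_semicontinuous_on_continuous[OF this] k0 j]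
  obtain U where U: "open U" "k0 \<in> U"
    "\<forall>k\<in>K \<inter> U. t < trans_op \<M> (m j) k - c * trans_op \<M> W k" by blast
  have "t < trans_op \<M> u k" if k: "k \<in> K \<inter> U" for k
  proof -
    have "trans_op \<M> (m j) k \<le> trans_op \<M> \<phi> k"
      using k m1 by (intro trans_op_mono[OF mW \<phi>]) auto
    then show ?thesis using U(3) sh[of k] k by force
  qed
  then show "\<exists>U. open U \<and> k0 \<in> U \<and> (\<forall>k\<in>K \<inter> U. t < trans_op \<M> u k)"
    using U by blast
qed

context
  fixes u c assumes u: "W_bounded c u" and c: "c \<ge> 0"
begin

lemma action_value_bounds:
  assumes "x \<in> X" "a \<in> adm \<M> x"
  shows "- ((M + \<gamma> * c) * W x) \<le> cost \<M> (x, a) + \<alpha> * trans_op \<M> u (x, a)"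
    and "cost \<M> (x, a) + \<alpha> * trans_op \<M> u (x, a) \<le> (M + \<gamma> * c) * W x"
proof -
  have k: "(x, a) \<in> K" using assms by (simp add: adm_pairs_def)
  have "\<bar>\<alpha> * trans_op \<M> u (x, a)\<bar> \<le> \<alpha> * (c * \<beta> * W x)"
    using trans_op_bound[OF u k c] \<alpha> by (simp add: abs_mult)
  then show "- ((M + \<gamma> * c) * W x) \<le> cost \<M> (x, a) + \<alpha> * trans_op \<M> u (x, a)"
    "cost \<M> (x, a) + \<alpha> * trans_op \<M> u (x, a) \<le> (M + \<gamma> * c) * W x"
    using cost_bound[OF k] by (auto simp: algebra_simps abs_le_iff)
qed

lemma bellman_le:
  assumes "x \<in> X" "a \<in> adm \<M> x"
  shows "bellman_op \<M> \<alpha> u x \<le> cost \<M> (x, a) + \<alpha> * trans_op \<M> u (x, a)"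
  unfolding bellman_op_def
  by (rule cINF_lower[OF _ assms(2)]) (use action_value_bounds(1)[OF assms(1)] in \<open>auto intro!: bdd_belowI2\<close>)

lemma bellman_greatest:
  assumes "x \<in> X" "\<And>a. a \<in> adm \<M> x \<Longrightarrow> t \<le> cost \<M> (x, a) + \<alpha> * trans_op \<M> u (x, a)"
  shows "t \<le> bellman_op \<M> \<alpha> u x"
  unfolding bellman_op_def by (rule cINF_greatest[OF adm_ne[OF assms(1)] assms(2)])

lemma bellman_bound:
  assumes x: "x \<in> X"
  shows "\<bar>bellman_op \<M> \<alpha> u x\<bar> \<le> (M + \<gamma> * c) * W x"
proof -
  obtain a where a: "a \<in> adm \<M> x" using adm_ne[OF x] by blast
  have "bellman_op \<M> \<alpha> u x \<le> (M + \<gamma> * c) * W x"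
    using bellman_le[OF x a] action_value_bounds(2)[OF x a] by linarith
  moreover have "- ((M + \<gamma> * c) * W x) \<le> bellman_op \<M> \<alpha> u x"
    by (rule bellman_greatest[OF x]) (rule action_value_bounds(1)[OF x])
  ultimately show ?thesis by (simp add: abs_le_iff)
qed

text \<open>A Berge-type argument without minimizing actions: around each admissible
  \<open>a\<close> the action value exceeds \<open>s\<close> on an open box, compactness selects
  finitely many boxes, and upper semicontinuity keeps the admissible actions of nearby states inside
  their union.\<close>

lemma bellman_lsc:
  assumes lsc: "lower_semicontinuous_on X u"
  shows "lower_semicontinuous_on X (bellman_op \<M> \<alpha> u)"
  unfolding lower_semicontinuous_on_iff
proof (intro ballI allI impI)
  fix x t assume x: "x \<in> X" and t: "t < bellman_op \<M> \<alpha> u x"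
  let ?g = "\<lambda>k. cost \<M> k + \<alpha> * trans_op \<M> u k"
  \<comment> \<open>A strict bound for every action gives only a weak one for the infimum; the
    intermediate \<open>s\<close> restores strictness above \<open>t\<close>.\<close>
  obtain s where s: "t < s" "s < bellman_op \<M> \<alpha> u x" using dense[OF t] by blast
  have glsc: "lower_semicontinuous_on K ?g"
    by (intro lower_semicontinuous_on_add cost_lsc lower_semicontinuous_on_cmult trans_op_lsc[OF u c lsc] \<alpha>)
  have "\<exists>A B. open A \<and> open B \<and> x \<in> A \<and> a \<in> B \<and> (\<forall>k\<in>K \<inter> A \<times> B. s < ?g k)"
    if a: "a \<in> adm \<M> x" for a
  proof -
    have k: "(x, a) \<in> K" using x a by (simp add: adm_pairs_def)
    have "s < ?g (x, a)" using bellman_le[OF x a] s by simp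
    from lower_semicontinuous_onD[OF glsc k this]
    obtain U where U: "open U" "(x, a) \<in> U" "\<forall>k\<in>K \<inter> U. s < ?g k" by blast
    have "\<exists>A B. open A \<and> open B \<and> (x, a) \<in> A \<times> B \<and> A \<times> B \<subseteq> U"
      using U(1)[unfolded open_prod_def] U(2) by (rule bspec)
    then obtain A B where "open A" "open B" "x \<in> A" "a \<in> B" "A \<times> B \<subseteq> U" by auto
    then show ?thesis using U(3) by (intro exI[of _ A] exI[of _ B]) auto
  qed
  then obtain A B where AB: "\<And>a. a \<in> adm \<M> x \<Longrightarrow> open (A a) \<and> open (B a) \<and> x \<in> A a \<and> a \<in> B a
      \<and> (\<forall>k\<in>K \<inter> A a \<times> B a. s < ?g k)"
    by metis
  obtain F where F: "F \<subseteq> adm \<M> x" "finite F" "adm \<M> x \<subseteq> (\<Union>a\<in>F. B a)"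
    using compactE_image[OF adm_compact[OF x], of "adm \<M> x" B] AB by blast
  define U1 where "U1 = (\<Inter>a\<in>F. A a)"
  define V where "V = actions \<M> \<inter> (\<Union>a\<in>F. B a)"
  have "openin (top_of_set (actions \<M>)) V"
    unfolding V_def using AB F(1) by (intro openin_open_Int open_UN) auto
  then have "openin (top_of_set X) {z \<in> X. adm \<M> z \<subseteq> V}"
    using usc_adm by (auto simp: upper_semicontinuous_multifunction_def)
  then obtain U2 where U2: "open U2" "{z \<in> X. adm \<M> z \<subseteq> V} = X \<inter> U2"
    by (auto simp: openin_open)
  have "adm \<M> x \<subseteq> actions \<M>" using model x by (simp add: markov_decision_model_def)
  then have xV: "adm \<M> x \<subseteq> V" using F(3) by (simp add: V_def)
  have "t < bellman_op \<M> \<alpha> u z" if z: "z \<in> X \<inter> (U1 \<inter> U2)" for z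
  proof -
    have zV: "adm \<M> z \<subseteq> V" using z U2(2) by blast
    have "s \<le> bellman_op \<M> \<alpha> u z"
    proof (rule bellman_greatest)
      fix b assume b: "b \<in> adm \<M> z"
      then obtain a where a: "a \<in> F" "b \<in> B a" using zV by (auto simp: V_def)
      have "(z, b) \<in> K \<inter> A a \<times> B a" using z b a by (auto simp: U1_def adm_pairs_def)
      moreover have "a \<in> adm \<M> x" using a F(1) by blast
      ultimately have "s < ?g (z, b)" using AB[of a] by blast
      then show "s \<le> cost \<M> (z, b) + \<alpha> * trans_op \<M> u (z, b)" by simp
    qed (use z in simp)
    then show ?thesis using s by simp
  qed
  moreover have "open (U1 \<inter> U2)" using AB F U2(1) by (auto simp: U1_def)
  moreover have "x \<in> U1 \<inter> U2" using AB F(1) U2(2) x xV by (auto simp: U1_def)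
  ultimately show "\<exists>U. open U \<and> x \<in> U \<and> (\<forall>z\<in>X \<inter> U. t < bellman_op \<M> \<alpha> u z)" by blast
qed

end

section \<open>Monotonicity, discounting and the fixed point of the Bellman operator\<close>

lemma bellman_mono:
  assumes u: "W_bounded c u" and v: "W_bounded d v" and c: "c \<ge> 0"
    and le: "\<And>x. x \<in> X \<Longrightarrow> u x \<le> v x" and x: "x \<in> X"
  shows "bellman_op \<M> \<alpha> u x \<le> bellman_op \<M> \<alpha> v x"
  unfolding bellman_op_def[of _ _ v]
proof (rule cINF_greatest[OF adm_ne[OF x]])
  fix a assume a: "a \<in> adm \<M> x"
  then have "(x, a) \<in> K" using x by (simp add: adm_pairs_def)
  then have "\<alpha> * trans_op \<M> u (x, a) \<le> \<alpha> * trans_op \<M> v (x, a)"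
    using \<alpha> by (intro mult_left_mono trans_op_mono[OF u v] le) auto
  with bellman_le[OF u c x a]
  show "bellman_op \<M> \<alpha> u x \<le> cost \<M> (x, a) + \<alpha> * trans_op \<M> v (x, a)" by linarith
qed

text \<open>Blackwell's discounting condition with weight \<open>W\<close>: the factor \<beta> from
  \<open>QW\<close> joins the discount factor to give \<gamma>. With monotonicity it amounts to the
  contraction property in one-sided form.\<close>

lemma bellman_shift:
  assumes u: "W_bounded c u" and c: "c \<ge> 0" and d: "d \<ge> 0" and x: "x \<in> X"
  shows "bellman_op \<M> \<alpha> (\<lambda>y. u y + d * W y) x \<le> bellman_op \<M> \<alpha> u x + \<gamma> * d * W x"
proof -
  have s: "W_bounded (c + d) (\<lambda>y. u y + d * W y)"
    unfolding W_bounded_def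
  proof (intro conjI ballI)
    show "(\<lambda>y. u y + d * W y) \<in> borel_measurable S" using W_bounded_meas[OF u] by simp
    fix y assume y: "y \<in> X"
    have "0 \<le> d * W y" using d W_pos[OF y] by simp
    then show "\<bar>u y + d * W y\<bar> \<le> (c + d) * W y"
      using W_boundedD[OF u y] by (simp add: abs_le_iff distrib_right)
  qed
  have "bellman_op \<M> \<alpha> (\<lambda>y. u y + d * W y) x - \<gamma> * d * W x \<le> bellman_op \<M> \<alpha> u x"
  proof (rule bellman_greatest[OF u c x])
    fix a assume a: "a \<in> adm \<M> x"
    then have k: "(x, a) \<in> K" using x by (simp add: adm_pairs_def)
    have "bellman_op \<M> \<alpha> (\<lambda>y. u y + d * W y) x \<le> cost \<M> (x, a) + \<alpha> * trans_op \<M> (\<lambda>y. u y + d * W y) (x, a)"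
      by (rule bellman_le[OF s _ x a]) (use c d in simp)
    also have "\<dots> = cost \<M> (x, a) + \<alpha> * trans_op \<M> u (x, a) + \<alpha> * (d * trans_op \<M> W (x, a))"
      by (simp add: trans_op_shift[OF u k] algebra_simps)
    also have "\<alpha> * (d * trans_op \<M> W (x, a)) \<le> \<alpha> * (d * (\<beta> * W x))"
      using QW[OF k] d \<alpha> by (intro mult_left_mono) auto
    finally show "bellman_op \<M> \<alpha> (\<lambda>y. u y + d * W y) x - \<gamma> * d * W x
        \<le> cost \<M> (x, a) + \<alpha> * trans_op \<M> u (x, a)" by (simp add: ac_simps)
  qed
  then show ?thesis by simp
qed

text \<open>The radius of a \<open>W\<close>-ball that is invariant under all the operators:
  \<open>M + \<gamma> * radius = radius\<close>.\<close>

definition radius :: real where "radius = M / (1 - \<gamma>)"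

lemma radius_nonneg: "radius \<ge> 0"
  using M_pos \<gamma>1 by (simp add: radius_def)

lemma radius_eq: "M + \<gamma> * radius = radius"
  using \<gamma>1 by (simp add: radius_def field_simps)

text \<open>Knaster--Tarski on the lower semicontinuous subsolutions.\<close>

lemma bellman_fixed_point:
  "\<exists>w. W_bounded radius w \<and> lower_semicontinuous_on X w \<and> (\<forall>x\<in>X. bellman_op \<M> \<alpha> w x = w x)"
proof -
  let ?B = "bellman_op \<M> \<alpha>"
  define U where "U = {u. lower_semicontinuous_on X u \<and> W_bounded radius u \<and> (\<forall>x\<in>X. u x \<le> ?B u x)}"
  define w where "w x = (SUP u\<in>U. u x)" for x
  \<comment> \<open>The lowest function of the ball is a subsolution because the ball is invariant;
    this makes \<open>U\<close> nonempty.\<close>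
  let ?b = "\<lambda>x. - radius * W x"
  have b: "W_bounded radius ?b" by (rule W_bounded_W) (simp add: radius_nonneg)
  have "lower_semicontinuous_on X ?b"
    by (intro lower_semicontinuous_on_continuous continuous_intros W_cont)
  moreover have "?b x \<le> ?B ?b x" if "x \<in> X" for x
    using bellman_bound[OF b radius_nonneg that] by (simp add: radius_eq abs_le_iff)
  ultimately have bU: "?b \<in> U" using b by (simp add: U_def)
  have ubd: "u x \<le> radius * W x" if "u \<in> U" "x \<in> X" for u x
    using W_boundedD[of radius u x] that by (auto simp: U_def abs_le_iff)
  have bdd: "bdd_above ((\<lambda>u. u x) ` U)" if "x \<in> X" for x
    using ubd that by (intro bdd_aboveI2[of _ _ "radius * W x"]) auto
  have up: "u x \<le> w x" if "u \<in> U" "x \<in> X" for u x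
    unfolding w_def by (rule cSUP_upper[OF that(1) bdd[OF that(2)]])
  have wlsc: "lower_semicontinuous_on X w"
    unfolding w_def
    by (rule lower_semicontinuous_on_SUP[OF _ _ bdd]) (use bU in \<open>auto simp: U_def\<close>)
  have w: "W_bounded radius w"
  proof (rule W_bounded_lscI[OF wlsc])
    fix x assume x: "x \<in> X"
    have "w x \<le> radius * W x"
      unfolding w_def using ubd x bU by (intro cSUP_least) auto
    then show "\<bar>w x\<bar> \<le> radius * W x" using up[OF bU x] by (simp add: abs_le_iff)
  qed
  have le: "w x \<le> ?B w x" if x: "x \<in> X" for x
    unfolding w_def[of x]
  proof (rule cSUP_least)
    show "U \<noteq> {}" using bU by blast
    fix u assume uU: "u \<in> U"
    then have u: "W_bounded radius u" "u x \<le> ?B u x" using x by (auto simp: U_def)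
    note u(2)
    also have "?B u x \<le> ?B w x" by (rule bellman_mono[OF u(1) w radius_nonneg up[OF uU] x])
    finally show "u x \<le> ?B w x" .
  qed
  have Blsc: "lower_semicontinuous_on X (?B w)" by (rule bellman_lsc[OF w radius_nonneg wlsc])
  have BW: "W_bounded radius (?B w)"
    by (rule W_bounded_lscI[OF Blsc]) (use bellman_bound[OF w radius_nonneg] in \<open>simp add: radius_eq\<close>)
  \<comment> \<open>The image of \<open>w\<close> is again a lower semicontinuous subsolution in the
    ball, hence a member of \<open>U\<close> and below its supremum \<open>w\<close>.\<close>
  have "?B w x \<le> ?B (?B w) x" if "x \<in> X" for x
    by (rule bellman_mono[OF w BW radius_nonneg le that])
  then have "?B w \<in> U" using Blsc BW by (simp add: U_def)
  then have "?B w x = w x" if "x \<in> X" for x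
    using up[of "?B w" x] le[OF that] that by simp
  then show ?thesis using w wlsc by blast
qed

section \<open>Values of stationary policies as least fixed points\<close>

lemma policy_op_cong:
  assumes "f \<in> selectors \<M>" "x \<in> X" "\<And>y. y \<in> X \<Longrightarrow> u y = v y"
  shows "policy_op \<M> \<alpha> f u x = policy_op \<M> \<alpha> f v x"
proof -
  have "trans_op \<M> u (x, f x) = trans_op \<M> v (x, f x)"
    unfolding trans_op_def using assms(3) trans_space[OF selector_K[OF assms(1,2)]]
    by (intro Bochner_Integration.integral_cong) auto
  then show ?thesis by (simp add: policy_op_def)
qed

lemma policy_op_mono:
  assumes "f \<in> selectors \<M>" "W_bounded c u" "W_bounded d v" "\<And>x. x \<in> X \<Longrightarrow> u x \<le> v x" "x \<in> X"
  shows "policy_op \<M> \<alpha> f u x \<le> policy_op \<M> \<alpha> f v x"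
  unfolding policy_op_def
  using trans_op_mono[OF assms(2,3) selector_K[OF assms(1,5)] assms(4)] \<alpha> by simp

lemma policy_op_W_bounded:
  assumes f: "f \<in> selectors \<M>" and u: "W_bounded radius u"
  shows "W_bounded radius (policy_op \<M> \<alpha> f u)"
  unfolding W_bounded_def
proof (intro conjI ballI)
  have fm: "f \<in> S \<rightarrow>\<^sub>M Act" using f by (simp add: selectors_def)
  have gm: "(\<lambda>x. (x, f x)) \<in> S \<rightarrow>\<^sub>M restrict_space (S \<Otimes>\<^sub>M Act) K"
    by (intro measurable_restrict_space2 measurable_Pair measurable_ident fm)
      (use selector_K[OF f] in auto)
  note [measurable] = measurable_compose[OF gm cost_K] measurable_compose[OF gm trans_op_K_meas[OF u]]
  show "policy_op \<M> \<alpha> f u \<in> borel_measurable S"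
    unfolding policy_op_def[abs_def] by measurable
  fix x assume x: "x \<in> X"
  then have "f x \<in> adm \<M> x" using f by (simp add: selectors_def)
  from action_value_bounds[OF u radius_nonneg x this]
  show "\<bar>policy_op \<M> \<alpha> f u x\<bar> \<le> radius * W x"
    by (simp add: policy_op_def radius_eq abs_le_iff)
qed

text \<open>Since \<open>f\<close> is only measurable, semicontinuity cannot keep a supremum over
  subsolutions measurable here. Iterating from the bottom of the ball gives an increasing sequence
  instead; its limit is measurable, and fixed by dominated convergence. Starting at the bottom keeps
  every iterate below each supersolution in the ball.\<close>

lemma policy_fixed_point:
  assumes f: "f \<in> selectors \<M>"
  shows "\<exists>w. W_bounded radius w \<and> (\<forall>x\<in>X. policy_op \<M> \<alpha> f w x = w x)
    \<and> (\<forall>u. W_bounded radius u \<longrightarrow> (\<forall>y\<in>X. policy_op \<M> \<alpha> f u y \<le> u y) \<longrightarrow> (\<forall>x\<in>X. w x \<le> u x))"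
proof -
  let ?T = "policy_op \<M> \<alpha> f"
  define w where "w n = (?T ^^ n) (\<lambda>x. - radius * W x)" for n
  have w0: "w 0 x = - radius * W x" and wS: "w (Suc n) = ?T (w n)" for n x
    by (auto simp: w_def)
  have wb: "W_bounded radius (w n)" for n
  proof (induction n)
    case 0
    show ?case unfolding w_def funpow_0 by (rule W_bounded_W) (simp add: radius_nonneg)
  qed (simp add: wS policy_op_W_bounded[OF f])
  have inc: "x \<in> X \<Longrightarrow> w n x \<le> w (Suc n) x" for n x
  proof (induction n arbitrary: x)
    case 0
    then show ?case using W_boundedD[OF wb[of 1], of x] by (simp add: w0 abs_le_iff)
  next
    case (Suc n)
    have "?T (w n) x \<le> ?T (w (Suc n)) x" by (rule policy_op_mono[OF f wb wb Suc.IH Suc.prems])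
    then show ?case by (simp add: wS)
  qed
  define l where "l x = lim (\<lambda>n. w n x)" for x
  have lim: "(\<lambda>n. w n x) \<longlonglongrightarrow> l x" if x: "x \<in> X" for x
  proof -
    have "incseq (\<lambda>n. w n x)" using inc[OF x] by (rule incseq_SucI)
    moreover have "w n x \<le> radius * W x" for n using W_boundedD[OF wb x] by (simp add: abs_le_iff)
    ultimately obtain L where "(\<lambda>n. w n x) \<longlonglongrightarrow> L"
      by (metis incseq_convergent)
    then show ?thesis unfolding l_def by (simp add: limI)
  qed
  have lb: "W_bounded radius l"
    unfolding W_bounded_def
  proof (intro conjI ballI)
    show "l \<in> borel_measurable S"
      by (rule borel_measurable_LIMSEQ_metric[of w]) (use lim W_bounded_meas[OF wb] in auto)
    fix x assume x: "x \<in> X"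
    show "\<bar>l x\<bar> \<le> radius * W x"
      by (rule LIMSEQ_le_const2[OF tendsto_rabs[OF lim[OF x]]]) (use W_boundedD[OF wb x] in auto)
  qed
  have fp: "?T l x = l x" if x: "x \<in> X" for x
  proof -
    have k: "(x, f x) \<in> K" by (rule selector_K[OF f x])
    have "(\<lambda>n. trans_op \<M> (w n) (x, f x)) \<longlonglongrightarrow> trans_op \<M> l (x, f x)"
      unfolding trans_op_def
    proof (rule integral_dominated_convergence)
      show "l \<in> borel_measurable (trans \<M> (x, f x))" "w n \<in> borel_measurable (trans \<M> (x, f x))" for n
        using W_bounded_integrable[OF lb k] W_bounded_integrable[OF wb k] by auto
      show "integrable (trans \<M> (x, f x)) (\<lambda>y. radius * W y)" using W_integrable[OF k] by simp
      show "AE y in trans \<M> (x, f x). (\<lambda>n. w n y) \<longlonglongrightarrow> l y"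
        using lim by (intro AE_I2) (simp add: trans_space[OF k])
      show "AE y in trans \<M> (x, f x). norm (w n y) \<le> radius * W y" for n
        using W_boundedD[OF wb] by (intro AE_I2) (simp add: trans_space[OF k])
    qed
    then have "(\<lambda>n. ?T (w n) x) \<longlonglongrightarrow> ?T l x"
      unfolding policy_op_def by (intro tendsto_intros)
    moreover have "(\<lambda>n. ?T (w n) x) \<longlonglongrightarrow> l x"
      using LIMSEQ_Suc[OF lim[OF x]] by (simp add: wS)
    ultimately show ?thesis by (rule LIMSEQ_unique)
  qed
  have least: "l x \<le> u x" if u: "W_bounded radius u" and sup: "\<And>y. y \<in> X \<Longrightarrow> ?T u y \<le> u y" and x: "x \<in> X" for u x
  proof -
    have "y \<in> X \<Longrightarrow> w n y \<le> u y" for n y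
    proof (induction n arbitrary: y)
      case 0
      then show ?case using W_boundedD[OF u, of y] by (simp add: w0 abs_le_iff)
    next
      case (Suc n)
      have "?T (w n) y \<le> ?T u y" using Suc by (intro policy_op_mono[OF f wb u])
      also have "\<dots> \<le> u y" by (rule sup[OF Suc.prems])
      finally show ?case by (simp add: wS)
    qed
    then show ?thesis using x by (intro LIMSEQ_le_const2[OF lim[OF x]]) auto
  qed
  show ?thesis using lb fp least by blast
qed

text \<open>Transfers the properties of the least fixed point to the value function, which agrees
  with it on the states. The third claim is the comparison principle behind policy
  improvement.\<close>

lemma policy_value_fixed_point:
  assumes f: "f \<in> selectors \<M>"
  defines "v \<equiv> policy_value \<M> \<alpha> (stationary \<M> f)"
  shows "W_bounded radius v"
    and "\<And>x. x \<in> X \<Longrightarrow> policy_op \<M> \<alpha> f v x = v x"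
    and "\<And>u x. W_bounded radius u \<Longrightarrow> (\<And>y. y \<in> X \<Longrightarrow> policy_op \<M> \<alpha> f u y \<le> u y) \<Longrightarrow> x \<in> X \<Longrightarrow> v x \<le> u x"
proof -
  from policy_fixed_point[OF f] obtain w where w: "W_bounded radius w"
    "\<forall>x\<in>X. policy_op \<M> \<alpha> f w x = w x"
    "\<forall>u. W_bounded radius u \<longrightarrow> (\<forall>y\<in>X. policy_op \<M> \<alpha> f u y \<le> u y) \<longrightarrow> (\<forall>x\<in>X. w x \<le> u x)"
    by (elim exE conjE)
  have vw: "v x = w x" if "x \<in> X" for x
    unfolding v_def by (rule policy_value_stationary[OF f that w(1) radius_nonneg bspec[OF w(2)]])
  have "v \<in> borel_measurable S \<longleftrightarrow> w \<in> borel_measurable S"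
    by (rule measurable_cong) (simp add: vw)
  then show "W_bounded radius v" using w(1) by (simp add: W_bounded_def vw)
  show "policy_op \<M> \<alpha> f v x = v x" if "x \<in> X" for x
    using policy_op_cong[OF f that, of v w] bspec[OF w(2) that] by (simp add: vw that)
  show "v x \<le> u x" if "W_bounded radius u" "\<And>y. y \<in> X \<Longrightarrow> policy_op \<M> \<alpha> f u y \<le> u y" "x \<in> X" for u x
    using w(3) that vw[OF that(3)] by simp
qed

lemma policy_value_lower:
  assumes \<pi>: "\<pi> \<in> policies \<M>" and x: "x \<in> X" and w: "W_bounded radius w"
    and fp: "\<And>x. x \<in> X \<Longrightarrow> bellman_op \<M> \<alpha> w x = w x"
  shows "w x \<le> policy_value \<M> \<alpha> \<pi> x"
proof -
  interpret mdp_growth_policy \<M> \<alpha> M \<beta> W \<pi> x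
    by unfold_locales (use \<pi> x in auto)
  show ?thesis
  proof (rule policy_value_ge[OF w radius_nonneg])
    fix k assume "k \<in> K"
    then have "fst k \<in> X" "snd k \<in> adm \<M> (fst k)" by (auto simp: adm_pairs_def)
    from bellman_le[OF w radius_nonneg this] fp[OF this(1)]
    show "w (fst k) \<le> cost \<M> k + \<alpha> * trans_op \<M> w k" by simp
  qed
qed

text \<open>Here \<open>d\<close> plays the role of the weighted distance from \<open>v\<close> to
  \<open>w\<close>, of which only the upper side is tracked.\<close>

lemma improvement_step:
  assumes f: "f \<in> selectors \<M>" and g: "g \<in> selectors \<M>"
    and w: "W_bounded radius w" "lower_semicontinuous_on X w"
    and fp: "\<And>x. x \<in> X \<Longrightarrow> bellman_op \<M> \<alpha> w x = w x"
  defines "v \<equiv> policy_value \<M> \<alpha> (stationary \<M> f)"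
  assumes greedy: "\<And>x. x \<in> X \<Longrightarrow>
      bellman_op \<M> \<alpha> (lsc_envelope \<M> v) x = policy_op \<M> \<alpha> g (lsc_envelope \<M> v) x"
    and d: "d \<ge> 0" and vd: "\<And>x. x \<in> X \<Longrightarrow> v x \<le> w x + d * W x"
    and x: "x \<in> X"
  shows "policy_value \<M> \<alpha> (stationary \<M> g) x \<le> w x + \<gamma> * d * W x"
proof -
  let ?B = "bellman_op \<M> \<alpha>"
  define e where "e = lsc_envelope \<M> v"
  note v = policy_value_fixed_point(1,2)[OF f, folded v_def]
  note vg = policy_value_fixed_point[OF g]
  \<comment> \<open>The bottom of the ball is the lower semicontinuous minorant that keeps the
    envelope finite.\<close>
  have blsc: "lower_semicontinuous_on X (\<lambda>x. - radius * W x)"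
    by (intro lower_semicontinuous_on_continuous continuous_intros W_cont)
  have bv: "- radius * W x \<le> v x" if "x \<in> X" for x
    using W_boundedD[OF v(1) that] by (simp add: abs_le_iff)
  then have bv': "\<forall>x\<in>X. - radius * W x \<le> v x" by blast
  note env = lsc_envelope_le[OF blsc bv', folded e_def] lsc_envelope_greatest[OF blsc bv', folded e_def]
    lower_semicontinuous_on_lsc_envelope[OF blsc bv', folded e_def]
  have e: "W_bounded radius e"
  proof (rule W_bounded_lscI[OF env(3)])
    fix x assume x: "x \<in> X"
    show "\<bar>e x\<bar> \<le> radius * W x"
      using env(1)[OF x] env(2)[OF blsc bv x] W_boundedD[OF v(1) x] by (simp add: abs_le_iff)
  qed
  have Bev: "?B e y \<le> v y" if y: "y \<in> X" for y
  proof -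
    have "f y \<in> adm \<M> y" using f y by (simp add: selectors_def)
    then have "?B e y \<le> policy_op \<M> \<alpha> f e y"
      unfolding policy_op_def by (rule bellman_le[OF e radius_nonneg y])
    also have "\<dots> \<le> policy_op \<M> \<alpha> f v y" by (rule policy_op_mono[OF f e v(1) env(1) y])
    finally show ?thesis using v(2)[OF y] by simp
  qed
  have Bee: "?B e y \<le> e y" if y: "y \<in> X" for y
    by (rule env(2)[OF bellman_lsc[OF e radius_nonneg env(3)] Bev y])
  have greedy_e: "policy_op \<M> \<alpha> g e y = ?B e y" if "y \<in> X" for y
    using greedy[OF that] by (simp add: e_def)
  let ?v' = "policy_value \<M> \<alpha> (stationary \<M> g)"
  have ve: "?v' y \<le> e y" if "y \<in> X" for y
    by (rule vg(3)[OF e _ that]) (simp add: greedy_e Bee)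
  \<comment> \<open>The comparison function may leave the invariant ball, hence the larger
    constant.\<close>
  have wd: "W_bounded (radius + d) (\<lambda>y. w y + d * W y)"
  proof (rule W_bounded_lscI)
    show "lower_semicontinuous_on X (\<lambda>y. w y + d * W y)"
      by (intro lower_semicontinuous_on_add w(2) lower_semicontinuous_on_continuous continuous_intros W_cont)
    fix y assume y: "y \<in> X"
    have "0 \<le> d * W y" using d W_pos[OF y] by simp
    then show "\<bar>w y + d * W y\<bar> \<le> (radius + d) * W y"
      using W_boundedD[OF w(1) y] by (simp add: abs_le_iff distrib_right)
  qed
  have "?v' x = policy_op \<M> \<alpha> g ?v' x" using vg(2)[OF x] by simp
  also have "\<dots> \<le> policy_op \<M> \<alpha> g e x" by (rule policy_op_mono[OF g vg(1) e ve x])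
  also have "\<dots> = ?B e x" by (rule greedy_e[OF x])
  also have "\<dots> \<le> ?B (\<lambda>y. w y + d * W y) x"
  proof (rule bellman_mono[OF e wd radius_nonneg _ x])
    show "e y \<le> w y + d * W y" if "y \<in> X" for y
      using env(1)[OF that] vd[OF that] by linarith
  qed
  also have "\<dots> \<le> ?B w x + \<gamma> * d * W x" by (rule bellman_shift[OF w(1) radius_nonneg d x])
  finally show ?thesis by (simp add: fp[OF x])
qed

end

section \<open>Error bounds in the weighted norm and the linear rate\<close>

theorem corollary4p3:
  fixes \<M> :: "('x::polish_space, 'a::polish_space) mdp"
    and \<alpha> M \<beta> \<gamma> :: real and W :: "'x \<Rightarrow> real"
    and f\<^sub>0 :: "'x \<Rightarrow> 'a" and f :: "nat \<Rightarrow> 'x \<Rightarrow> 'a"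
    and v :: "nat \<Rightarrow> 'x \<Rightarrow> real" and L :: ennreal and err :: "nat \<Rightarrow> ennreal"
  assumes model: "markov_decision_model \<M>"
    and discount: "0 < \<alpha>" "\<alpha> < 1"
    and growth: "growth_conditions \<M> \<alpha> M \<beta> W"
    and compact_cont: "compactness_continuity_conditions \<M> W"
    and gamma: "\<gamma> = \<beta> * \<alpha>"
    and start: "f\<^sub>0 \<in> selectors \<M>" "f 0 = f\<^sub>0"
    and evaluation: "\<And>n. v n = policy_value \<M> \<alpha> (stationary \<M> (f n))"
    and improvement: "\<And>n. f (Suc n) \<in> selectors \<M>"
      "\<And>n x. x \<in> states \<M> \<Longrightarrow>
         bellman_op \<M> \<alpha> (lsc_envelope \<M> (v n)) x
         = policy_op \<M> \<alpha> (f (Suc n)) (lsc_envelope \<M> (v n)) x"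
    and err: "\<And>n. err n = weighted_norm \<M> W (\<lambda>x. v n x - optimal_value \<M> \<alpha> x)"
    and L: "L = err 0"
  shows "L < \<infinity> \<and> err \<longlonglongrightarrow> 0
    \<and> (\<forall>n\<ge>1. err (Suc n) \<le> ennreal \<gamma> * err n \<and> ennreal \<gamma> * err n \<le> L * ennreal \<gamma> ^ n)
    \<and> limsup (\<lambda>n. err (Suc n) / err n) \<le> ennreal \<gamma>"
proof -
  have sel: "f n \<in> selectors \<M>" for n
    using start improvement(1) by (cases n) auto
  interpret mdp_compact \<M> \<alpha> M \<beta> W
  proof unfold_locales
    have "continuous_on (states \<M>) W" using compact_cont by (simp add: compactness_continuity_conditions_def)
    then show "W \<in> borel_measurable (state_algebra \<M>)"
      unfolding state_algebra_def by (rule borel_measurable_continuous_on_restrict)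
    \<comment> \<open>Nonemptiness of the admissible sets comes from the existence of a
      selector.\<close>
    show "adm \<M> x \<noteq> {}" if "x \<in> states \<M>" for x
      using sel[of 0] that by (auto simp: selectors_def)
  qed (rule model discount growth compact_cont)+
  obtain w where w: "W_bounded radius w" "lower_semicontinuous_on X w"
    "\<And>x. x \<in> X \<Longrightarrow> bellman_op \<M> \<alpha> w x = w x"
    using bellman_fixed_point by blast
  note pol = stationary_policy[OF sel]
  note vb = policy_value_fixed_point(1)[OF sel, folded evaluation]
  have wv: "w x \<le> v n x" if "x \<in> X" for n x
    unfolding evaluation by (rule policy_value_lower[OF pol that w(1,3)])
  have step: "v (Suc n) x \<le> w x + \<gamma> * d * W x"
    if "d \<ge> 0" "\<And>x. x \<in> X \<Longrightarrow> v n x \<le> w x + d * W x" "x \<in> X" for n d x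
    using improvement_step[of "f n" "f (Suc n)" w d x, folded evaluation] sel w improvement(2) that
    unfolding gamma by blast
  have \<gamma>: "0 < \<gamma>" "\<gamma> < 1" using \<gamma>0 \<gamma>1 gamma by auto
  \<comment> \<open>Both \<open>v 0\<close> and \<open>w\<close> lie in the ball of size
    \<open>radius\<close>, hence the factor 2.\<close>
  have v0: "v 0 x \<le> w x + (2 * radius) * W x" if "x \<in> X" for x
    using W_boundedD[OF vb[of 0] that] W_boundedD[OF w(1) that] by (simp add: abs_le_iff)
  have vn: "x \<in> X \<Longrightarrow> v n x \<le> w x + (\<gamma> ^ n * (2 * radius)) * W x" for n x
  proof (induction n arbitrary: x)
    case (Suc n)
    from step[of "\<gamma> ^ n * (2 * radius)" n x] Suc radius_nonneg \<gamma> show ?case by (simp add: mult.assoc)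
  qed (use v0 in simp)
  have lim0: "(\<lambda>n. \<gamma> ^ n * c) \<longlonglongrightarrow> 0" for c :: real
    using \<gamma> by (intro tendsto_mult_left_zero LIMSEQ_power_zero) simp
  have opt: "optimal_value \<M> \<alpha> x = w x" if x: "x \<in> X" for x
  proof (rule antisym)
    \<comment> \<open>A real infimum is meaningful only over a set bounded below; \<open>w x\<close>
      provides the bound.\<close>
    have bdd: "bdd_below ((\<lambda>\<pi>. policy_value \<M> \<alpha> \<pi> x) ` policies \<M>)"
      using policy_value_lower[OF _ x w(1,3)] by (intro bdd_belowI2)
    have "optimal_value \<M> \<alpha> x \<le> v n x" for n
      unfolding optimal_value_def evaluation by (rule cINF_lower[OF bdd pol])
    then have "optimal_value \<M> \<alpha> x \<le> w x + \<gamma> ^ n * (2 * radius * W x)" for n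
      using vn[OF x, of n] by (smt (verit) mult.assoc)
    moreover have "(\<lambda>n. w x + \<gamma> ^ n * (2 * radius * W x)) \<longlonglongrightarrow> w x + 0"
      by (intro tendsto_add tendsto_const lim0)
    ultimately show "optimal_value \<M> \<alpha> x \<le> w x"
      by (intro LIMSEQ_le_const[of _ "w x"]) auto
    show "w x \<le> optimal_value \<M> \<alpha> x"
      unfolding optimal_value_def
      using policy_value_lower[OF _ x w(1,3)] pol[of 0] by (intro cINF_greatest) auto
  qed
  \<comment> \<open>As \<open>w\<close> is below \<open>v n\<close>, the absolute value disappears
    and a bound on the weighted norm becomes the one-sided inequality that
    \<open>improvement_step\<close> propagates.\<close>
  have err_le: "err n \<le> ennreal d \<longleftrightarrow> (\<forall>x\<in>X. v n x \<le> w x + d * W x)" if d: "d \<ge> 0" for n d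
  proof -
    have "ennreal (\<bar>v n x - optimal_value \<M> \<alpha> x\<bar> / W x) \<le> ennreal d \<longleftrightarrow> v n x \<le> w x + d * W x" if x: "x \<in> X" for x
      using wv[OF x, of n] W_pos[OF x] d opt[OF x] by (simp add: ennreal_le_iff divide_le_eq algebra_simps)
    then show ?thesis unfolding err weighted_norm_def SUP_le_iff by auto
  qed
  have fin: "err n \<noteq> \<infinity>" for n
  proof -
    have "err n \<le> ennreal (\<gamma> ^ n * (2 * radius))"
      using vn radius_nonneg \<gamma> by (subst err_le) auto
    then show ?thesis by (auto simp: top_unique)
  qed
  have contr: "err (Suc n) \<le> ennreal \<gamma> * err n" for n
  proof -
    \<comment> \<open>The error is finite and is its own best bound, so it can itself serve as the
      constant \<open>d\<close>.\<close>
    obtain d where d: "d \<ge> 0" "err n = ennreal d" using fin[of n] by (cases "err n") auto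
    then have "\<And>x. x \<in> X \<Longrightarrow> v n x \<le> w x + d * W x" using err_le[OF d(1), of n] by auto
    from step[OF d(1) this] have "err (Suc n) \<le> ennreal (\<gamma> * d)"
      using d(1) \<gamma> by (subst err_le) auto
    then show ?thesis using d \<gamma> by (simp add: ennreal_mult)
  qed
  have geo: "err n \<le> L * ennreal \<gamma> ^ n" for n
  proof (induction n)
    case (Suc n)
    have "err (Suc n) \<le> ennreal \<gamma> * err n" by (rule contr)
    also have "\<dots> \<le> ennreal \<gamma> * (L * ennreal \<gamma> ^ n)" by (intro mult_left_mono Suc) simp
    finally show ?case by (simp add: ac_simps)
  qed (simp add: L)
  \<comment> \<open>The claim has exponent \<open>n\<close>, one less than \<open>geo\<close> would
    give for the left-hand side; the factor \<gamma> is simply bounded by 1.\<close>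
  have "ennreal \<gamma> * err n \<le> L * ennreal \<gamma> ^ n" for n
  proof -
    have "ennreal \<gamma> * err n \<le> 1 * err n" using \<gamma> by (intro mult_right_mono) auto
    then show ?thesis using geo[of n] by simp
  qed
  moreover have "err \<longlonglongrightarrow> 0"
  proof (rule tendsto_sandwich[OF _ _ tendsto_const])
    show "\<forall>\<^sub>F n in sequentially. err n \<le> ennreal (\<gamma> ^ n * (2 * radius))"
      using vn radius_nonneg \<gamma> by (intro always_eventually allI) (subst err_le, auto)
    show "(\<lambda>n. ennreal (\<gamma> ^ n * (2 * radius))) \<longlonglongrightarrow> 0"
      using tendsto_ennrealI[OF lim0[of "2 * radius"]] by simp
  qed simp
  moreover have "err (Suc n) / err n \<le> ennreal \<gamma>" for n
  proof (cases "err n = 0")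
    \<comment> \<open>By \<open>contr\<close> the next error vanishes as well, and in
      \<open>ennreal\<close> the quotient of 0 by 0 is 0, in agreement with the convention for the
      ratio.\<close>
    case True
    then show ?thesis using contr[of n] by simp
  next
    case False
    have "err (Suc n) / err n \<le> (ennreal \<gamma> * err n) / err n"
      by (rule divide_right_mono_ennreal[OF contr])
    also have "\<dots> = ennreal \<gamma>" using False fin[of n]
      by (simp add: ennreal_mult_divide_eq)
    finally show ?thesis .
  qed
  then have "limsup (\<lambda>n. err (Suc n) / err n) \<le> ennreal \<gamma>"
    by (intro Limsup_bounded) auto
  ultimately show ?thesis
    using contr fin[of 0] L by (auto simp: less_top)
qed

end
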